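(* Let $(M,g)$ be a complete, non-compact Riemannian manifold of dimension $n>2$ with finite volume which is a non-expanding $m$-quasi Einstein manifold with potential vector field $X$; that is, $X$ is a smooth vector field on $M$ satisfying $$Ric+\frac12\pounds_X g-\frac1m X^\flat\otimes X^\flat=\lambda g$$ for constants $\lambda\ge 0$ and $0<m\le\infty$. If $X$ has finite global norm, i.e. $\|X\|^2=\int_M |X|^2\,dV<\infty$, then there exists a (nonempty) open ball in $M$ on which the scalar curvature $R$ satisfies $R\ge\lambda n$.
   Context: Manifolds are smooth and connected. $Ric$ is the Ricci tensor, $R$ the scalar curvature, $\pounds_X$ the Lie derivative, $X^\flat$ the 1-form dual to $X$ with respect to $g$, and $dV$ the Riemannian volume measure. For $m=\infty$ the $\frac1m$ term is understood to be $0$. The $m$-quasi Einstein manifold is expanding if $\lambda<0$, steady if $\lambda=0$, shrinking if $\lambda>0$; non-expanding means $\lambda\ge 0$. On an oriented Riemannian manifold the global inner product of $k$-forms is $\langle\eta,\omega\rangle=\int_M\eta\wedge *\omega$, with $*$ the Hodge star, and the global norm is $\|\eta\|^2=\langle\eta,\eta\rangle\le\infty$; the global norm of a vector field $X$ is that of $X^\flat$, i.e. $\|X\|^2=\int_M|X|^2\,dV$. $(M,g)$ is assumed oriented, as in this definition. *)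

theory Defs
  imports "HOL-Analysis.Analysis"
begin

section \<open>Smooth maps on open subsets of Euclidean space\<close>

(* Meant for open S only: all derivatives are two-sided derivatives at the points of S. *)
primrec Ck_on :: "nat \<Rightarrow> 'b::real_normed_vector set \<Rightarrow> ('b \<Rightarrow> 'c::real_normed_vector) \<Rightarrow> bool" where
  "Ck_on 0 S f \<longleftrightarrow> continuous_on S f"
| "Ck_on (Suc k) S f \<longleftrightarrow>
     (\<forall>x\<in>S. f differentiable (at x)) \<and> (\<forall>v. Ck_on k S (\<lambda>x. frechet_derivative f (at x) v))"

definition smooth_on :: "'b::real_normed_vector set \<Rightarrow> ('b \<Rightarrow> 'c::real_normed_vector) \<Rightarrow> bool" where
  "smooth_on S f \<longleftrightarrow> (\<forall>k. Ck_on k S f)"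

definition partial :: "'n::finite \<Rightarrow> (real^'n \<Rightarrow> real) \<Rightarrow> real^'n \<Rightarrow> real" where
  "partial i f x = frechet_derivative f (at x) (axis i 1)"


section \<open>Oriented smooth manifolds\<close>

(* The manifold is the whole type 'a with its topology.  A chart is a pair (U, phi) of an open
   coordinate domain U and a coordinate map phi, whose values outside U are irrelevant. *)
type_synonym ('a, 'n) chart = "'a set \<times> ('a \<Rightarrow> real^'n)"

abbreviation chart_dom :: "('a, 'n::finite) chart \<Rightarrow> 'a set" where
  "chart_dom c \<equiv> fst c"

abbreviation coord :: "('a, 'n::finite) chart \<Rightarrow> 'a \<Rightarrow> real^'n" where
  "coord c \<equiv> snd c"

abbreviation chart_img :: "('a, 'n::finite) chart \<Rightarrow> (real^'n) set" where
  "chart_img c \<equiv> coord c ` chart_dom c"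

definition param :: "('a, 'n::finite) chart \<Rightarrow> real^'n \<Rightarrow> 'a" where
  "param c = inv_into (chart_dom c) (coord c)"

definition is_chart :: "('a::topological_space, 'n::finite) chart \<Rightarrow> bool" where
  "is_chart c \<longleftrightarrow> open (chart_dom c) \<and> open (chart_img c) \<and>
     homeomorphism (chart_dom c) (chart_img c) (coord c) (param c)"

definition transition :: "('a, 'n::finite) chart \<Rightarrow> ('a, 'n) chart \<Rightarrow> real^'n \<Rightarrow> real^'n" where
  "transition c d = coord d \<circ> param c"

definition overlap :: "('a, 'n::finite) chart \<Rightarrow> ('a, 'n) chart \<Rightarrow> (real^'n) set" where
  "overlap c d = coord c ` (chart_dom c \<inter> chart_dom d)"

definition smooth_atlas :: "('a::topological_space, 'n::finite) chart set \<Rightarrow> bool" where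
  "smooth_atlas A \<longleftrightarrow>
     (\<forall>c\<in>A. is_chart c) \<and> (\<Union>c\<in>A. chart_dom c) = UNIV \<and>
     (\<forall>c\<in>A. \<forall>d\<in>A. smooth_on (overlap c d) (transition c d))"

(* The atlas is not required to be maximal; it determines the smooth structure and the
   orientation. *)
definition oriented_smooth_atlas :: "('a::topological_space, 'n::finite) chart set \<Rightarrow> bool" where
  "oriented_smooth_atlas A \<longleftrightarrow> smooth_atlas A \<and>
     (\<forall>c\<in>A. \<forall>d\<in>A. \<forall>x\<in>overlap c d.
        det (matrix (frechet_derivative (transition c d) (at x))) > 0)"


section \<open>Tensor fields\<close>

(* A tensor field is given by its components in every chart of the atlas, as functions on the
   image of the chart, subject to the tensorial transformation law.  Its components in charts
   outside the atlas, and outside the image of a chart, are irrelevant. *)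
type_synonym ('a, 'n) vfield = "('a, 'n) chart \<Rightarrow> real^'n \<Rightarrow> real^'n"
type_synonym ('a, 'n) tensor2 = "('a, 'n) chart \<Rightarrow> real^'n \<Rightarrow> real^'n^'n"
type_synonym ('a, 'n) scalar = "('a, 'n) chart \<Rightarrow> real^'n \<Rightarrow> real"

definition smooth_vector_field :: "('a, 'n::finite) chart set \<Rightarrow> ('a, 'n) vfield \<Rightarrow> bool" where
  "smooth_vector_field A X \<longleftrightarrow>
     (\<forall>c\<in>A. smooth_on (chart_img c) (X c)) \<and>
     (\<forall>c\<in>A. \<forall>d\<in>A. \<forall>x\<in>overlap c d.
        X d (transition c d x) = frechet_derivative (transition c d) (at x) (X c x))"

definition riemannian_metric :: "('a, 'n::finite) chart set \<Rightarrow> ('a, 'n) tensor2 \<Rightarrow> bool" where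
  "riemannian_metric A g \<longleftrightarrow>
     (\<forall>c\<in>A. smooth_on (chart_img c) (g c)) \<and>
     (\<forall>c\<in>A. \<forall>x\<in>chart_img c. transpose (g c x) = g c x \<and> (\<forall>v. v \<noteq> 0 \<longrightarrow> v \<bullet> (g c x *v v) > 0)) \<and>
     (\<forall>c\<in>A. \<forall>d\<in>A. \<forall>x\<in>overlap c d. \<forall>u v.
        u \<bullet> (g c x *v v) =
          frechet_derivative (transition c d) (at x) u \<bullet>
            (g d (transition c d x) *v frechet_derivative (transition c d) (at x) v))"

definition chart_at :: "('a, 'n::finite) chart set \<Rightarrow> 'a \<Rightarrow> ('a, 'n) chart" where
  "chart_at A p = (SOME c. c \<in> A \<and> p \<in> chart_dom c)"

(* The value at a point of the manifold of a scalar given by coordinate expressions.  It is used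
   only for scalars whose value does not depend on the chart. *)
definition at_point :: "('a, 'n::finite) chart set \<Rightarrow> ('a, 'n) scalar \<Rightarrow> 'a \<Rightarrow> real" where
  "at_point A f p = f (chart_at A p) (coord (chart_at A p) p)"


section \<open>Curvature and Lie derivative\<close>

(* christoffel g c x k i j is the component with upper index k and lower indices i, j. *)
definition christoffel ::
    "('a, 'n::finite) tensor2 \<Rightarrow> ('a, 'n) chart \<Rightarrow> real^'n \<Rightarrow> 'n \<Rightarrow> 'n \<Rightarrow> 'n \<Rightarrow> real" where
  "christoffel g c x k i j =
     (1/2) * (\<Sum>l\<in>UNIV. matrix_inv (g c x) $ k $ l *
        (partial i (\<lambda>y. g c y $ j $ l) x + partial j (\<lambda>y. g c y $ i $ l) x
          - partial l (\<lambda>y. g c y $ i $ j) x))"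

(* riemann g c x l i j k is the l-th component of R(e_i, e_j) e_k for the coordinate frame e,
   with R(X,Y)Z = D_X D_Y Z - D_Y D_X Z - D_[X,Y] Z and D the Levi-Civita connection. *)
definition riemann ::
    "('a, 'n::finite) tensor2 \<Rightarrow> ('a, 'n) chart \<Rightarrow> real^'n \<Rightarrow> 'n \<Rightarrow> 'n \<Rightarrow> 'n \<Rightarrow> 'n \<Rightarrow> real" where
  "riemann g c x l i j k =
     partial i (\<lambda>y. christoffel g c y l j k) x - partial j (\<lambda>y. christoffel g c y l i k) x
     + (\<Sum>m\<in>UNIV. christoffel g c x m j k * christoffel g c x l i m
                 - christoffel g c x m i k * christoffel g c x l j m)"

(* Ric(Y,Z) is the trace of X |-> R(X,Y)Z, so that round spheres have positive Ricci tensor. *)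
definition ricci :: "('a, 'n::finite) tensor2 \<Rightarrow> ('a, 'n) tensor2" where
  "ricci g c x = (\<chi> j k. \<Sum>i\<in>UNIV. riemann g c x i i j k)"

definition scalar_curvature :: "('a, 'n::finite) tensor2 \<Rightarrow> ('a, 'n) scalar" where
  "scalar_curvature g c x = (\<Sum>i\<in>UNIV. \<Sum>j\<in>UNIV. matrix_inv (g c x) $ i $ j * ricci g c x $ i $ j)"

definition lie_derivative :: "('a, 'n::finite) vfield \<Rightarrow> ('a, 'n) tensor2 \<Rightarrow> ('a, 'n) tensor2" where
  "lie_derivative X h c x = (\<chi> i j. \<Sum>k\<in>UNIV.
      X c x $ k * partial k (\<lambda>y. h c y $ i $ j) x
      + h c x $ k $ j * partial i (\<lambda>y. X c y $ k) x
      + h c x $ i $ k * partial j (\<lambda>y. X c y $ k) x)"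

definition flat :: "('a, 'n::finite) tensor2 \<Rightarrow> ('a, 'n) vfield \<Rightarrow> ('a, 'n) chart \<Rightarrow> real^'n \<Rightarrow> real^'n" where
  "flat g X c x = g c x *v X c x"

definition norm_sq :: "('a, 'n::finite) tensor2 \<Rightarrow> ('a, 'n) vfield \<Rightarrow> ('a, 'n) scalar" where
  "norm_sq g X c x = X c x \<bullet> (g c x *v X c x)"

(* For m = \<infinity> the extended-real quotient 1 / m is 0. *)
definition quasi_einstein ::
    "('a, 'n::finite) chart set \<Rightarrow> ('a, 'n) tensor2 \<Rightarrow> ('a, 'n) vfield \<Rightarrow> ereal \<Rightarrow> real \<Rightarrow> bool" where
  "quasi_einstein A g X m lam \<longleftrightarrow>
     (\<forall>c\<in>A. \<forall>x\<in>chart_img c. \<forall>i j.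
        ricci g c x $ i $ j + (1/2) * lie_derivative X g c x $ i $ j
          - real_of_ereal (1 / m) * (flat g X c x $ i * flat g X c x $ j)
        = lam * g c x $ i $ j)"


section \<open>Riemannian distance and volume\<close>

definition pw_C1_curve :: "('a::topological_space, 'n::finite) chart set \<Rightarrow> (real \<Rightarrow> 'a) \<Rightarrow> bool" where
  "pw_C1_curve A \<gamma> \<longleftrightarrow> continuous_on {0..1} \<gamma> \<and>
     (\<forall>c\<in>A. \<forall>a b. 0 \<le> a \<and> a < b \<and> b \<le> 1 \<and> \<gamma> ` {a..b} \<subseteq> chart_dom c \<longrightarrow>
        (coord c \<circ> \<gamma>) piecewise_C1_differentiable_on {a..b})"

definition speed ::
    "('a, 'n::finite) chart set \<Rightarrow> ('a, 'n) tensor2 \<Rightarrow> (real \<Rightarrow> 'a) \<Rightarrow> real \<Rightarrow> real" where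
  "speed A g \<gamma> t =
     (let c = chart_at A (\<gamma> t); v = vector_derivative (coord c \<circ> \<gamma>) (at t)
      in sqrt (v \<bullet> (g c (coord c (\<gamma> t)) *v v)))"

(* Piecewise C1 in the library's sense admits unbounded derivatives at the break points, so the
   length may be infinite; this does not affect the infimum below. *)
definition curve_length ::
    "('a, 'n::finite) chart set \<Rightarrow> ('a, 'n) tensor2 \<Rightarrow> (real \<Rightarrow> 'a) \<Rightarrow> ennreal" where
  "curve_length A g \<gamma> = (\<integral>\<^sup>+ t\<in>{0..1}. ennreal (speed A g \<gamma> t) \<partial>lborel)"

definition riem_dist ::
    "('a::topological_space, 'n::finite) chart set \<Rightarrow> ('a, 'n) tensor2 \<Rightarrow> 'a \<Rightarrow> 'a \<Rightarrow> real" where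
  "riem_dist A g p q =
     enn2real (INF \<gamma>\<in>{\<gamma>. pw_C1_curve A \<gamma> \<and> \<gamma> 0 = p \<and> \<gamma> 1 = q}. curve_length A g \<gamma>)"

definition complete_riemannian ::
    "('a::topological_space, 'n::finite) chart set \<Rightarrow> ('a, 'n) tensor2 \<Rightarrow> bool" where
  "complete_riemannian A g \<longleftrightarrow> Metric_space.mcomplete UNIV (riem_dist A g)"

definition riem_ball ::
    "('a::topological_space, 'n::finite) chart set \<Rightarrow> ('a, 'n) tensor2 \<Rightarrow> 'a \<Rightarrow> real \<Rightarrow> 'a set" where
  "riem_ball A g = Metric_space.mball UNIV (riem_dist A g)"

(* The Riemannian volume measure is the unique Borel measure with density sqrt (det g_ij) with
   respect to Lebesgue measure in every chart. *)
definition riemannian_volume ::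
    "('a::topological_space, 'n::finite) chart set \<Rightarrow> ('a, 'n) tensor2 \<Rightarrow> 'a measure \<Rightarrow> bool" where
  "riemannian_volume A g dV \<longleftrightarrow> sets dV = sets borel \<and>
     (\<forall>c\<in>A. \<forall>B\<in>sets borel. B \<subseteq> chart_dom c \<longrightarrow>
        emeasure dV B = (\<integral>\<^sup>+ x\<in>coord c ` B. ennreal (sqrt (det (g c x))) \<partial>lborel))"

definition global_norm_sq ::
    "('a, 'n::finite) chart set \<Rightarrow> ('a, 'n) tensor2 \<Rightarrow> 'a measure \<Rightarrow> ('a, 'n) vfield \<Rightarrow> ennreal" where
  "global_norm_sq A g dV X = (\<integral>\<^sup>+ p. ennreal (at_point A (norm_sq g X) p) \<partial>dV)"

end

theory Submission
  imports Defs
begin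

text \<open>
  Tracing the quasi-Einstein equation gives \<open>div X = \<lambda> n - R + |X|\<^sup>2 / m\<close>.  If every ball contained a
  point with \<open>R < \<lambda> n\<close>, then \<open>div X\<close> would be positive on a dense set, hence nonnegative, and
  it would suffice to see that its integral vanishes.

  By the Hopf-Rinow theorem, \<open>\<phi>\<^sub>k = max 0 (min 1 (2 - d(p, \<cdot>) / k))\<close> has compact support, and it is
  \<open>1/k\<close>-Lipschitz, so that \<open>\<bar>\<integral> \<phi>\<^sub>k div X dV\<bar> \<le> (4 n / k) \<integral> |X| dV\<close>, which tends to \<open>0\<close> because finite volume
  and \<open>\<integral> |X|\<^sup>2 dV < \<infinity>\<close> make \<open>|X|\<close> integrable.  The estimate avoids differentiating \<open>\<phi>\<^sub>k\<close>: in a chart,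
  the derivatives of the components of \<open>X\<close> in a fixed Auerbach basis are replaced by difference quotients,
  which are moved to \<open>\<phi>\<^sub>k\<close> by translation invariance.  The constant \<open>4 n\<close> is uniform, since each chart is used only
  near a point, where the metric is comparable to a constant one.
\<close>

section \<open>Continuously differentiable maps\<close>

text \<open>The distance function is only Lipschitz, so the divergence theorem cannot be applied
  directly to the field multiplied by a cut-off \<open>\<phi>\<close>; only
  \<open>\<bar>\<phi> p - \<phi> q\<bar> \<le> L * riem_dist A g p q\<close> is used. The obstacle
  is localisation: the supports of the cut-offs may grow with k, and with them the number of charts
  needed to cover them, so a constant depending on the charts would destroy the factor 1/k. The
  local estimate is therefore stated for a weight f supported in one chart, in the form
  \<bar>\<integral> \<phi> div (f X)\<bar> \<le> 4 n L \<integral> f |X|. Its constant is absolute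
  and its right side is linear in f, so that estimates add up without loss as long as the weights
  sum to at most 1. Once they sum to 1 near the support of \<phi>, the derivatives of the weights
  have disappeared. The contradiction is finally obtained pointwise, from the continuity of the
  divergence and the positive volume of nonempty open sets.\<close>

abbreviation C1_on :: "'b::real_normed_vector set \<Rightarrow> ('b \<Rightarrow> 'c::real_normed_vector) \<Rightarrow> bool" where
  "C1_on \<equiv> Ck_on (Suc 0)"

lemma C1_onI:
  assumes "\<And>x. x \<in> S \<Longrightarrow> (f has_derivative f' x) (at x)"
    and "\<And>v. continuous_on S (\<lambda>x. f' x v)"
  shows "C1_on S f"
proof -
  have "frechet_derivative f (at x) = f' x" if "x \<in> S" for x
    using assms(1)[OF that] frechet_derivative_at by metis
  then show ?thesis
    using assms by (auto simp: differentiable_def cong: continuous_on_cong)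
qed

lemma C1_on_has_derivative:
  "C1_on S f \<Longrightarrow> x \<in> S \<Longrightarrow> (f has_derivative frechet_derivative f (at x)) (at x)"
  by (simp add: frechet_derivative_works)

lemma C1_on_continuous_derivative:
  "C1_on S f \<Longrightarrow> continuous_on S (\<lambda>x. frechet_derivative f (at x) v)"
  by simp

lemma C1_on_imp_continuous_on: "C1_on S f \<Longrightarrow> continuous_on S f"
  by (simp add: continuous_at_imp_continuous_on differentiable_imp_continuous_within)

declare Ck_on.simps [simp del]

lemma smooth_on_imp_C1_on: "smooth_on S f \<Longrightarrow> C1_on S f"
  unfolding smooth_on_def by blast

lemma smooth_on_frechet_derivative:
  "smooth_on S f \<Longrightarrow> smooth_on S (\<lambda>x. frechet_derivative f (at x) v)"
  unfolding smooth_on_def by (metis Ck_on.simps(2))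

lemma C1_on_const [simp]: "C1_on S (\<lambda>x. c)"
  by (rule C1_onI[where f' = "\<lambda>x v. 0"]) auto

lemma C1_on_bounded_linear:
  assumes "bounded_linear L" "C1_on S f"
  shows "C1_on S (\<lambda>x. L (f x))"
  by (rule C1_onI[where f' = "\<lambda>x v. L (frechet_derivative f (at x) v)"])
    (use assms in \<open>auto intro: bounded_linear.has_derivative C1_on_has_derivative
       bounded_linear.continuous_on C1_on_continuous_derivative\<close>)

lemma C1_on_add:
  assumes "C1_on S f" "C1_on S h"
  shows "C1_on S (\<lambda>x. f x + h x)"
  by (rule C1_onI[where f' = "\<lambda>x v. frechet_derivative f (at x) v + frechet_derivative h (at x) v"])
    (use assms in \<open>auto intro!: has_derivative_add C1_on_has_derivative continuous_on_add C1_on_continuous_derivative\<close>)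

lemma C1_on_scaleR:
  assumes "C1_on S f" "C1_on S h"
  shows "C1_on S (\<lambda>x. f x *\<^sub>R h x)"
proof (rule C1_onI[where f' = "\<lambda>x v. f x *\<^sub>R frechet_derivative h (at x) v
        + frechet_derivative f (at x) v *\<^sub>R h x"])
  show "((\<lambda>x. f x *\<^sub>R h x) has_derivative (\<lambda>v. f x *\<^sub>R frechet_derivative h (at x) v
        + frechet_derivative f (at x) v *\<^sub>R h x)) (at x)" if "x \<in> S" for x
    by (rule has_derivative_scaleR[OF C1_on_has_derivative[OF assms(1) that]
          C1_on_has_derivative[OF assms(2) that]])
  have "continuous_on S f" "continuous_on S h"
    using assms C1_on_imp_continuous_on by auto
  then show "continuous_on S (\<lambda>x. f x *\<^sub>R frechet_derivative h (at x) v
        + frechet_derivative f (at x) v *\<^sub>R h x)" for v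
    using C1_on_continuous_derivative[OF assms(1), of v] C1_on_continuous_derivative[OF assms(2), of v]
    by (intro continuous_on_add continuous_on_scaleR)
qed

lemma C1_on_mult:
  fixes f h :: "'b::real_normed_vector \<Rightarrow> real"
  shows "C1_on S f \<Longrightarrow> C1_on S h \<Longrightarrow> C1_on S (\<lambda>x. f x * h x)"
  using C1_on_scaleR[of S f h] by simp

lemma C1_on_sum:
  "finite I \<Longrightarrow> (\<And>i. i \<in> I \<Longrightarrow> C1_on S (f i)) \<Longrightarrow> C1_on S (\<lambda>x. \<Sum>i\<in>I. f i x)"
proof (induction rule: finite_induct)
  case (insert i I)
  then show ?case
    using C1_on_add[of S "f i" "\<lambda>x. \<Sum>i\<in>I. f i x"] by simp
qed simp

lemma C1_on_prod:
  fixes f :: "'i \<Rightarrow> 'b::real_normed_vector \<Rightarrow> real"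
  shows "finite I \<Longrightarrow> (\<And>i. i \<in> I \<Longrightarrow> C1_on S (f i)) \<Longrightarrow> C1_on S (\<lambda>x. \<Prod>i\<in>I. f i x)"
proof (induction rule: finite_induct)
  case (insert i I)
  then show ?case
    using C1_on_mult[of S "f i" "\<lambda>x. \<Prod>i\<in>I. f i x"] by simp
qed simp

text \<open>\<open>Ck_on\<close> speaks of the derivative along a fixed vector only. For a direction
  \<open>w x\<close> that moves with the point, the derivative is expanded in \<open>Basis\<close>,
  so that finitely many fixed directions suffice.\<close>

lemma C1_on_continuous_derivative_compose:
  fixes g :: "'b::euclidean_space \<Rightarrow> 'c::real_normed_vector"
  assumes "C1_on T g" "continuous_on S f" "f ` S \<subseteq> T" "continuous_on S w"
  shows "continuous_on S (\<lambda>x. frechet_derivative g (at (f x)) (w x))"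
proof -
  have "frechet_derivative g (at (f x)) (w x)
      = (\<Sum>b\<in>Basis. (w x \<bullet> b) *\<^sub>R frechet_derivative g (at (f x)) b)" if "x \<in> S" for x
  proof -
    have lin: "linear (frechet_derivative g (at (f x)))"
      using assms that C1_on_has_derivative has_derivative_linear by blast
    have "frechet_derivative g (at (f x)) (w x)
        = frechet_derivative g (at (f x)) (\<Sum>b\<in>Basis. (w x \<bullet> b) *\<^sub>R b)"
      by (simp add: euclidean_representation)
    then show ?thesis
      by (simp add: linear_sum[OF lin] linear_cmul[OF lin])
  qed
  moreover have "continuous_on S (\<lambda>x. \<Sum>b\<in>Basis. (w x \<bullet> b) *\<^sub>R frechet_derivative g (at (f x)) b)"
  proof (intro continuous_intros assms)
    fix b
    show "continuous_on S (\<lambda>x. frechet_derivative g (at (f x)) b)"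
      by (rule continuous_on_compose2[OF C1_on_continuous_derivative]) (use assms in auto)
  qed
  ultimately show ?thesis
    by (simp cong: continuous_on_cong)
qed

lemma C1_on_compose:
  fixes g :: "'b::euclidean_space \<Rightarrow> 'c::real_normed_vector"
  assumes "C1_on S f" "C1_on T g" "f ` S \<subseteq> T"
  shows "C1_on S (\<lambda>x. g (f x))"
proof (rule C1_onI[where f' = "\<lambda>x v. frechet_derivative g (at (f x)) (frechet_derivative f (at x) v)"])
  show "((\<lambda>x. g (f x)) has_derivative
      (\<lambda>v. frechet_derivative g (at (f x)) (frechet_derivative f (at x) v))) (at x)" if "x \<in> S" for x
    using has_derivative_compose[OF C1_on_has_derivative[OF assms(1) that], of g]
      C1_on_has_derivative[OF assms(2)] assms(3) that by auto
  show "continuous_on S (\<lambda>x. frechet_derivative g (at (f x)) (frechet_derivative f (at x) v))" for v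
    by (intro C1_on_continuous_derivative_compose[OF assms(2)] C1_on_imp_continuous_on
        C1_on_continuous_derivative assms)
qed

section \<open>Symmetry of second derivatives\<close>

lemma has_real_derivative_along_line:
  fixes f :: "'b::real_normed_vector \<Rightarrow> real"
  assumes D: "(f has_derivative D) (at (x + s *\<^sub>R v))"
  shows "((\<lambda>s. f (x + s *\<^sub>R v)) has_real_derivative D v) (at s)"
proof -
  have "((\<lambda>s. f (x + s *\<^sub>R v)) has_derivative (\<lambda>a. D (a *\<^sub>R v))) (at s)"
    by (rule has_derivative_compose[of "\<lambda>s. x + s *\<^sub>R v", OF _ D]) (auto intro!: derivative_eq_intros)
  then show ?thesis
    by (simp add: has_field_derivative_def linear_cmul[OF has_derivative_linear[OF D]] mult_commute_abs)
qed

text \<open>The mean value theorem is applied twice: to the increment in direction \<open>v\<close>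
  as a function of the step along \<open>u\<close>, and then to the first derivative along
  \<open>v\<close>.\<close>

lemma mixed_differences:
  fixes f :: "'b::real_normed_vector \<Rightarrow> real"
  assumes B: "\<And>y. dist x y < r \<Longrightarrow> (f has_derivative f' y) (at y)"
      "\<And>y. dist x y < r \<Longrightarrow> ((\<lambda>z. f' z u) has_derivative f'' y) (at y)"
    and h: "0 < h" "h * (norm u + norm v) < r"
  obtains y where "dist x y \<le> h * (norm u + norm v)"
    "f (x + h *\<^sub>R u + h *\<^sub>R v) - f (x + h *\<^sub>R u) - f (x + h *\<^sub>R v) + f x = h^2 * f'' y v"
proof -
  have near: "dist x (x + t *\<^sub>R v + s *\<^sub>R u) \<le> h * (norm u + norm v)"
    if "0 \<le> s" "s \<le> h" "0 \<le> t" "t \<le> h" for s t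
  proof -
    have "dist x (x + t *\<^sub>R v + s *\<^sub>R u) = norm (t *\<^sub>R v + s *\<^sub>R u)"
      by (subst dist_commute) (simp add: dist_norm add.assoc)
    also have "\<dots> \<le> t * norm v + s * norm u"
      using norm_triangle_ineq[of "t *\<^sub>R v" "s *\<^sub>R u"] that by simp
    also have "\<dots> \<le> h * norm v + h * norm u"
      by (intro add_mono mult_right_mono that) auto
    finally show ?thesis by (simp add: algebra_simps)
  qed
  \<comment> \<open>The vacuous term \<open>0 *\<^sub>R v\<close> gives both points the form treated
    by \<open>near\<close>.\<close>
  define \<phi> where "\<phi> s = f (x + h *\<^sub>R v + s *\<^sub>R u) - f (x + 0 *\<^sub>R v + s *\<^sub>R u)" for s
  have "\<exists>s>0. s < h \<and> \<phi> h - \<phi> 0 = (h - 0) * (f' (x + h *\<^sub>R v + s *\<^sub>R u) u - f' (x + 0 *\<^sub>R v + s *\<^sub>R u) u)"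
    unfolding \<phi>_def
    by (rule MVT2[OF h(1)])
      (intro DERIV_diff has_real_derivative_along_line B(1) le_less_trans[OF near h(2)], use h in auto)
  then obtain s where s: "0 < s" "s < h"
    and e1: "\<phi> h - \<phi> 0 = h * (f' (x + h *\<^sub>R v + s *\<^sub>R u) u - f' (x + 0 *\<^sub>R v + s *\<^sub>R u) u)"
    by auto
  have swap: "x + s *\<^sub>R u + t *\<^sub>R v = x + t *\<^sub>R v + s *\<^sub>R u" for t by simp
  have "((\<lambda>t. f' (x + s *\<^sub>R u + t *\<^sub>R v) u) has_real_derivative f'' (x + s *\<^sub>R u + t *\<^sub>R v) v) (at t)"
    if "0 \<le> t" "t \<le> h" for t
    by (rule has_real_derivative_along_line[where f = "\<lambda>z. f' z u"], rule B(2), unfold swap)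
      (rule le_less_trans[OF near h(2)], use s that in auto)
  from MVT2[OF h(1) this] obtain t where t: "0 < t" "t < h"
    and e2: "f' (x + s *\<^sub>R u + h *\<^sub>R v) u - f' (x + s *\<^sub>R u + 0 *\<^sub>R v) u
      = (h - 0) * f'' (x + s *\<^sub>R u + t *\<^sub>R v) v"
    by blast
  show thesis
    by (rule that[of "x + t *\<^sub>R v + s *\<^sub>R u"])
      (use near[of s t] s t e1 e2 in \<open>auto simp: \<phi>_def power2_eq_square algebra_simps\<close>)
qed

text \<open>The second difference is symmetric in \<open>u\<close> and \<open>v\<close>. Computed in
  both orders, it yields points \<open>y k\<close> and \<open>z k\<close> tending to
  \<open>x\<close> at which the two mixed derivatives agree; continuity does the rest.\<close>

lemma symmetric_second_derivative:
  fixes f :: "'b::real_normed_vector \<Rightarrow> real"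
  assumes "open S" "x \<in> S"
    and f': "\<And>y. y \<in> S \<Longrightarrow> (f has_derivative f' y) (at y)"
    and f'': "\<And>y u. y \<in> S \<Longrightarrow> ((\<lambda>z. f' z u) has_derivative f'' y u) (at y)"
    and cont: "\<And>u v. continuous_on S (\<lambda>y. f'' y u v)"
  shows "f'' x u v = f'' x v u"
proof -
  obtain r where r: "r > 0" "\<And>y. dist x y < r \<Longrightarrow> y \<in> S"
    using assms(1,2) by (metis dist_commute open_dist)
  \<comment> \<open>The summand 1 keeps \<open>N\<close> positive for \<open>u = v = 0\<close> and
    makes the second inequality strict, so that all increments stay in the ball of radius
    \<open>r\<close>.\<close>
  define N where "N = norm u + norm v + 1"
  have N: "N > 0" "norm u + norm v < N" unfolding N_def by (auto simp: add_nonneg_pos)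
  define h where "h k = r / (N * real (Suc k))" for k
  have h: "h k > 0" "h k * (norm u + norm v) < r" "h k * (norm v + norm u) < r" for k
  proof -
    show "h k > 0" using r N by (auto simp: h_def)
    have "h k * (norm u + norm v) < h k * N" using N \<open>h k > 0\<close> by simp
    also have "h k * N = r / real (Suc k)" using N by (simp add: h_def)
    also have "\<dots> \<le> r / 1" using r by (intro divide_left_mono) auto
    also have "r / 1 = r" by simp
    finally show "h k * (norm u + norm v) < r" "h k * (norm v + norm u) < r"
      by (simp_all add: add.commute)
  qed
  have "\<exists>y z. dist x y \<le> h k * (norm u + norm v) \<and> dist x z \<le> h k * (norm u + norm v)
      \<and> f'' y u v = f'' z v u" for k
  proof -
    obtain y where y: "dist x y \<le> h k * (norm u + norm v)"
      "f (x + h k *\<^sub>R u + h k *\<^sub>R v) - f (x + h k *\<^sub>R u) - f (x + h k *\<^sub>R v) + f x = (h k)^2 * f'' y u v"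
      by (rule mixed_differences[of x r f f' u "\<lambda>y. f'' y u" "h k" v, OF f'[OF r(2)] f''[OF r(2)] h(1,2)])
    obtain z where z: "dist x z \<le> h k * (norm v + norm u)"
      "f (x + h k *\<^sub>R v + h k *\<^sub>R u) - f (x + h k *\<^sub>R v) - f (x + h k *\<^sub>R u) + f x = (h k)^2 * f'' z v u"
      by (rule mixed_differences[of x r f f' v "\<lambda>y. f'' y v" "h k" u, OF f'[OF r(2)] f''[OF r(2)] h(1,3)])
    have "(h k)^2 * f'' y u v = (h k)^2 * f'' z v u"
      unfolding y(2)[symmetric] z(2)[symmetric] by (simp add: algebra_simps)
    then show ?thesis using y z h(1)[of k] by (auto simp: add.commute)
  qed
  then obtain y z where yz: "\<And>k. dist x (y k) \<le> h k * (norm u + norm v)"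
      "\<And>k. dist x (z k) \<le> h k * (norm u + norm v)" "\<And>k. f'' (y k) u v = f'' (z k) v u"
    by metis
  have "h \<longlonglongrightarrow> 0"
    unfolding h_def using LIMSEQ_Suc[OF tendsto_divide_0[OF tendsto_const[of "r/N"] filterlim_at_top_imp_at_infinity[OF filterlim_real_sequentially]]]
    by simp
  then have lim: "(\<lambda>k. h k * (norm u + norm v)) \<longlonglongrightarrow> 0"
    by (rule tendsto_mult_left_zero)
  have *: "w \<longlonglongrightarrow> x" if "\<And>k. dist x (w k) \<le> h k * (norm u + norm v)" for w :: "nat \<Rightarrow> 'b"
    by (rule tendsto_dist_iff[THEN iffD2], rule tendsto_sandwich[OF _ _ tendsto_const lim])
      (use that in \<open>auto simp: dist_commute\<close>)
  have inS: "w k \<in> S" if "\<And>k. dist x (w k) \<le> h k * (norm u + norm v)" for w :: "nat \<Rightarrow> 'b" and k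
    using r(2) that[of k] h(2)[of k] by auto
  have "(\<lambda>k. f'' (y k) u v) \<longlonglongrightarrow> f'' x u v" "(\<lambda>k. f'' (z k) v u) \<longlonglongrightarrow> f'' x v u"
    by (intro continuous_on_tendsto_compose[OF cont] * yz assms(2) always_eventually allI inS)+
  then show ?thesis
    using yz(3) LIMSEQ_unique by simp
qed

subsection \<open>Jacobi's formula\<close>

section \<open>Jacobi's formula\<close>

text \<open>In the Leibniz sum, a permutation other than the identity moves some \<open>a\<close>
  and also \<open>p a\<close>. After one factor has been differentiated, another off-diagonal entry
  of the identity matrix is left, so only the identity permutation contributes.\<close>

lemma has_derivative_det_mat_1:
  fixes M :: "'b::real_normed_vector \<Rightarrow> real^'n^'n"
  assumes M: "(M has_derivative M') (at x)" and Mx: "M x = mat 1"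
  shows "((\<lambda>y. det (M y)) has_derivative (\<lambda>v. trace (M' v))) (at x)"
proof -
  have c: "((\<lambda>y. M y $ i $ j) has_derivative (\<lambda>v. M' v $ i $ j)) (at x)" for i j
    by (intro bounded_linear.has_derivative[OF bounded_linear_vec_nth] M)
  have D: "((\<lambda>y. det (M y)) has_derivative (\<lambda>v. \<Sum>p\<in>{p. p permutes (UNIV::'n set)}.
     of_int (sign p) * (\<Sum>i\<in>UNIV. M' v $ i $ p i * (\<Prod>j\<in>UNIV-{i}. M x $ j $ p j)))) (at x)"
    unfolding det_def
    by (intro has_derivative_sum has_derivative_mult_right has_derivative_prod c)
  have "(\<Sum>p\<in>{p. p permutes (UNIV::'n set)}.
     of_int (sign p) * (\<Sum>i\<in>UNIV. M' v $ i $ p i * (\<Prod>j\<in>UNIV-{i}. M x $ j $ p j)))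
     = (\<Sum>p\<in>{p. p permutes (UNIV::'n set)}. if p = id then trace (M' v) else 0)" for v
  proof (rule sum.cong[OF refl])
    fix p assume p: "p \<in> {p. p permutes (UNIV::'n set)}"
    show "of_int (sign p) * (\<Sum>i\<in>UNIV. M' v $ i $ p i * (\<Prod>j\<in>UNIV-{i}. M x $ j $ p j))
      = (if p = id then trace (M' v) else 0)"
    proof (cases "p = id")
      case True
      then show ?thesis by (simp add: Mx mat_def trace_def sign_id)
    next
      case False
      then obtain a where a: "p a \<noteq> a" by (auto simp: fun_eq_iff)
      then have pa: "p (p a) \<noteq> p a" using p permutes_inj by (metis injD mem_Collect_eq)
      have "(\<Prod>j\<in>UNIV-{i}. M x $ j $ p j) = 0" for i
      proof (cases "i = a")
        case True
        then show ?thesis using a pa by (intro prod_zero bexI[of _ "p a"]) (auto simp: Mx mat_def)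
      next
        case False
        then show ?thesis using a by (intro prod_zero bexI[of _ a]) (auto simp: Mx mat_def)
      qed
      then show ?thesis using False by (simp del: prod_zero_iff)
    qed
  qed
  also have "(\<Sum>p\<in>{p. p permutes (UNIV::'n set)}. if p = id then trace (M' v) else 0) = trace (M' v)" for v
    using permutes_id by (subst sum.delta) auto
  finally show ?thesis using D by simp
qed

lemma bounded_linear_matrix_mul: "bounded_linear (\<lambda>M::real^'n^'m. (B::real^'m^'k) ** M)"
  by (intro linear_conv_bounded_linear[THEN iffD1] linearI)
    (simp_all add: matrix_add_ldistrib matrix_scalar_ac scalar_matrix_assoc)

lemma matrix_inv_mult:
  fixes A :: "real^'n^'n"
  assumes "det A \<noteq> 0"
  shows "matrix_inv A ** A = mat 1" "A ** matrix_inv A = mat 1"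
proof -
  have "\<exists>B. A ** B = mat 1 \<and> B ** A = mat 1"
    using assms by (simp add: invertible_det_nz[symmetric] invertible_def)
  from someI_ex[OF this] show "matrix_inv A ** A = mat 1" "A ** matrix_inv A = mat 1"
    by (simp_all add: matrix_inv_def)
qed

text \<open>Multiplication by the constant matrix \<open>matrix_inv (M x)\<close> reduces to the
  derivative at the identity; the factor \<open>det (M x)\<close> undoes the scaling.\<close>

lemma has_derivative_det:
  fixes M :: "'b::real_normed_vector \<Rightarrow> real^'n^'n"
  assumes M: "(M has_derivative M') (at x)" and nz: "det (M x) \<noteq> 0"
  shows "((\<lambda>y. det (M y)) has_derivative
      (\<lambda>v. det (M x) * trace (matrix_inv (M x) ** M' v))) (at x)"
proof -
  have "((\<lambda>y. det (matrix_inv (M x) ** M y)) has_derivative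
      (\<lambda>v. trace (matrix_inv (M x) ** M' v))) (at x)"
    by (rule has_derivative_det_mat_1)
      (simp_all add: bounded_linear.has_derivative[OF bounded_linear_matrix_mul] M nz matrix_inv_mult)
  from has_derivative_mult_right[OF this, of "det (M x)"]
  have "((\<lambda>y. det (M x) * (det (matrix_inv (M x)) * det (M y))) has_derivative
      (\<lambda>v. det (M x) * trace (matrix_inv (M x) ** M' v))) (at x)"
    by (simp add: det_mul)
  moreover have "det (M x) * det (matrix_inv (M x)) = 1"
    using matrix_inv_mult(2)[OF nz] by (metis det_I det_mul)
  ultimately show ?thesis by (simp add: mult.assoc[symmetric])
qed

lemma C1_on_vec_nth: "C1_on S f \<Longrightarrow> C1_on S (\<lambda>x. f x $ i)"
  by (rule C1_on_bounded_linear[OF bounded_linear_vec_nth])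

lemma C1_on_det:
  fixes M :: "'b::real_normed_vector \<Rightarrow> real^'n^'n"
  assumes "C1_on S M"
  shows "C1_on S (\<lambda>x. det (M x))"
  unfolding det_def
  by (intro C1_on_sum C1_on_mult C1_on_prod C1_on_const C1_on_vec_nth assms finite_permutations)
    auto

lemma C1_on_sqrt:
  fixes f :: "'b::real_normed_vector \<Rightarrow> real"
  assumes f: "C1_on S f" and pos: "\<And>x. x \<in> S \<Longrightarrow> f x > 0"
  shows "C1_on S (\<lambda>x. sqrt (f x))"
proof (rule C1_onI[where f' = "\<lambda>x v. frechet_derivative f (at x) v * (inverse (sqrt (f x)) / 2)"])
  show "((\<lambda>x. sqrt (f x)) has_derivative
      (\<lambda>v. frechet_derivative f (at x) v * (inverse (sqrt (f x)) / 2))) (at x)" if "x \<in> S" for x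
    using has_derivative_compose[OF C1_on_has_derivative[OF f that]
        DERIV_real_sqrt[OF pos[OF that], unfolded has_field_derivative_def]]
    by (simp add: mult.commute)
  show "continuous_on S (\<lambda>x. frechet_derivative f (at x) v * (inverse (sqrt (f x)) / 2))" for v
    using pos C1_on_imp_continuous_on[OF f]
    by (intro continuous_intros C1_on_continuous_derivative f) (auto simp: less_imp_neq[THEN not_sym])
qed

section \<open>Charts, volume density and divergence\<close>

text \<open>Every matrix on the segment from the identity to \<open>G\<close> has a positive form
  and hence trivial kernel. The determinant starts at 1 and never vanishes on the way, so it cannot
  change sign.\<close>

lemma pos_def_imp_det_pos:
  fixes G :: "real^'n^'n"
  assumes pos: "\<And>v. v \<noteq> 0 \<Longrightarrow> v \<bullet> (G *v v) > 0"
  shows "det G > 0"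
proof (rule ccontr)
  define M where "M t = (1 - t) *\<^sub>R mat 1 + t *\<^sub>R G" for t :: real
  assume "\<not> det G > 0"
  moreover have "continuous_on {0..1} (\<lambda>t. det (M t))"
    unfolding det_def M_def by (intro continuous_intros)
  ultimately obtain t where t: "0 \<le> t" "t \<le> 1" "det (M t) = 0"
    using IVT2'[of "\<lambda>t. det (M t)" 1 0 0] by (auto simp: M_def)
  then obtain v where v: "v \<noteq> 0" "M t *v v = 0"
    using invertible_det_nz matrix_left_invertible_ker[of "M t"]
    by (metis invertible_left_inverse)
  have "v \<bullet> (M t *v v) = (1 - t) * (v \<bullet> v) + t * (v \<bullet> (G *v v))"
    by (simp add: M_def matrix_vector_mult_add_rdistrib scaleR_matrix_vector_assoc[symmetric] inner_add_right)
  also have "\<dots> > 0"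
  proof (cases "t = 1")
    case False
    then have "0 < (1 - t) * (v \<bullet> v)" "0 \<le> t * (v \<bullet> (G *v v))"
      using t v pos[OF v(1)] by auto
    then show ?thesis by linarith
  qed (use pos[OF v(1)] in simp)
  finally show False using v by simp
qed

definition vol_density :: "('a, 'n::finite) tensor2 \<Rightarrow> ('a, 'n) scalar" where
  "vol_density g c x = sqrt (det (g c x))"

text \<open>With \<open>\<rho> = sqrt (det g)\<close> this is \<open>\<rho>\<inverse> \<partial>\<^sub>i (\<rho> X\<^sup>i)\<close>, expanded by the product rule.\<close>

definition divergence :: "('a, 'n::finite) tensor2 \<Rightarrow> ('a, 'n) vfield \<Rightarrow> ('a, 'n) scalar" where
  "divergence g X c x = trace (matrix (frechet_derivative (X c) (at x)))
     + frechet_derivative (vol_density g c) (at x) (X c x) / vol_density g c x"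

lemma bounded_bilinear_matrix_vector_mult:
  "bounded_bilinear ((*v) :: real^'n^'m \<Rightarrow> real^'n \<Rightarrow> real^'m)"
  unfolding bilinear_conv_bounded_bilinear[symmetric] bilinear_def
  by (intro allI conjI linearI) (simp_all add: matrix_vector_right_distrib matrix_vector_mult_scaleR
      matrix_vector_mult_add_rdistrib scaleR_matrix_vector_assoc)

locale riemannian_manifold =
  fixes A :: "('a::{t2_space, second_countable_topology}, 'n::finite) chart set"
    and g :: "('a, 'n) tensor2"
  assumes atlas: "oriented_smooth_atlas A"
    and metric: "riemannian_metric A g"
    and connected_manifold: "connected (UNIV :: 'a set)"
begin

lemma
  assumes "c \<in> A"
  shows open_chart_dom: "open (chart_dom c)"
    and open_chart_img: "open (chart_img c)"
    and chart_homeomorphism: "homeomorphism (chart_dom c) (chart_img c) (coord c) (param c)"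
  using atlas assms by (auto simp: oriented_smooth_atlas_def smooth_atlas_def is_chart_def)

lemma param_coord [simp]: "c \<in> A \<Longrightarrow> p \<in> chart_dom c \<Longrightarrow> param c (coord c p) = p"
  using chart_homeomorphism by (metis homeomorphism_apply1)

lemma coord_param [simp]: "c \<in> A \<Longrightarrow> x \<in> chart_img c \<Longrightarrow> coord c (param c x) = x"
  using chart_homeomorphism by (metis homeomorphism_apply2)

lemma param_in_dom: "c \<in> A \<Longrightarrow> x \<in> chart_img c \<Longrightarrow> param c x \<in> chart_dom c"
  by auto

lemma continuous_on_coord: "c \<in> A \<Longrightarrow> continuous_on (chart_dom c) (coord c)"
  using chart_homeomorphism homeomorphism_cont1 by blast

lemma continuous_on_param: "c \<in> A \<Longrightarrow> continuous_on (chart_img c) (param c)"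
  using chart_homeomorphism homeomorphism_cont2 by blast

lemma chart_at: "chart_at A p \<in> A" "p \<in> chart_dom (chart_at A p)"
proof -
  have "\<exists>c. c \<in> A \<and> p \<in> chart_dom c"
    using atlas unfolding oriented_smooth_atlas_def smooth_atlas_def by (metis UN_iff UNIV_I)
  from someI_ex[OF this] show "chart_at A p \<in> A" "p \<in> chart_dom (chart_at A p)"
    by (auto simp: chart_at_def)
qed

lemma chart_around:
  obtains c where "c \<in> A" "p \<in> chart_dom c" "coord c p \<in> chart_img c"
  using chart_at that by blast

lemma open_coord_vimage: "c \<in> A \<Longrightarrow> open B \<Longrightarrow> open (chart_dom c \<inter> coord c -` B)"
  by (simp add: continuous_open_preimage continuous_on_coord open_chart_dom)

lemma open_param_vimage: "c \<in> A \<Longrightarrow> open U \<Longrightarrow> open (chart_img c \<inter> param c -` U)"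
  by (simp add: continuous_open_preimage continuous_on_param open_chart_img)

text \<open>\<open>at_point\<close> evaluates in a chart picked by choice; for invariant scalars
  every chart around \<open>p\<close> may be used instead.\<close>

lemma at_point_eq:
  assumes "\<And>c d. c \<in> A \<Longrightarrow> d \<in> A \<Longrightarrow> p \<in> chart_dom c \<Longrightarrow> p \<in> chart_dom d \<Longrightarrow>
      f c (coord c p) = f d (coord d p)"
    and "c \<in> A" "p \<in> chart_dom c"
  shows "at_point A f p = f c (coord c p)"
  unfolding at_point_def using assms chart_at by metis

lemma overlap_eq: "c \<in> A \<Longrightarrow> overlap c d = chart_img c \<inter> param c -` chart_dom d"
proof (intro set_eqI iffI)
  fix x assume c: "c \<in> A" and "x \<in> chart_img c \<inter> param c -` chart_dom d"
  then have "x = coord c (param c x)" "param c x \<in> chart_dom c \<inter> chart_dom d"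
    using param_in_dom by auto
  then show "x \<in> overlap c d" unfolding overlap_def by (rule image_eqI)
qed (auto simp: overlap_def)

lemma open_overlap: "c \<in> A \<Longrightarrow> d \<in> A \<Longrightarrow> open (overlap c d)"
  by (simp add: overlap_eq open_param_vimage open_chart_dom)

lemma coord_in_overlap: "p \<in> chart_dom c \<Longrightarrow> p \<in> chart_dom d \<Longrightarrow> coord c p \<in> overlap c d"
  by (auto simp: overlap_def)

lemma transition_coord: "c \<in> A \<Longrightarrow> p \<in> chart_dom c \<Longrightarrow> transition c d (coord c p) = coord d p"
  by (simp add: transition_def)

lemma transition_in_img: "c \<in> A \<Longrightarrow> x \<in> overlap c d \<Longrightarrow> transition c d x \<in> chart_img d"
  by (auto simp: transition_def overlap_eq)

lemma smooth_on_transition: "c \<in> A \<Longrightarrow> d \<in> A \<Longrightarrow> smooth_on (overlap c d) (transition c d)"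
  using atlas by (auto simp: oriented_smooth_atlas_def smooth_atlas_def)

definition jac where "jac c d x = matrix (frechet_derivative (transition c d) (at x))"

lemma transition_has_derivative:
  assumes "c \<in> A" "d \<in> A" "x \<in> overlap c d"
  shows "(transition c d has_derivative (\<lambda>v. jac c d x *v v)) (at x)"
proof -
  have D: "(transition c d has_derivative frechet_derivative (transition c d) (at x)) (at x)"
    by (rule C1_on_has_derivative[OF smooth_on_imp_C1_on[OF smooth_on_transition[OF assms(1,2)]] assms(3)])
  have "jac c d x *v v = frechet_derivative (transition c d) (at x) v" for v
    unfolding jac_def by (rule matrix_works) (simp add: linear_matrix_vector_mul_eq has_derivative_linear[OF D])
  with D show ?thesis by presburger
qed

lemma frechet_transition:
  "c \<in> A \<Longrightarrow> d \<in> A \<Longrightarrow> x \<in> overlap c d \<Longrightarrow>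
    frechet_derivative (transition c d) (at x) v = jac c d x *v v"
  using transition_has_derivative frechet_derivative_at by metis

lemma det_jac_pos: "c \<in> A \<Longrightarrow> d \<in> A \<Longrightarrow> x \<in> overlap c d \<Longrightarrow> det (jac c d x) > 0"
  using atlas by (auto simp: oriented_smooth_atlas_def jac_def)

lemma
  assumes "c \<in> A"
  shows smooth_on_metric: "smooth_on (chart_img c) (g c)"
    and metric_sym: "x \<in> chart_img c \<Longrightarrow> g c x $ i $ j = g c x $ j $ i"
    and metric_pos: "x \<in> chart_img c \<Longrightarrow> v \<noteq> 0 \<Longrightarrow> v \<bullet> (g c x *v v) > 0"
proof -
  show "smooth_on (chart_img c) (g c)" "x \<in> chart_img c \<Longrightarrow> v \<noteq> 0 \<Longrightarrow> v \<bullet> (g c x *v v) > 0"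
    using metric assms by (auto simp: riemannian_metric_def)
  assume "x \<in> chart_img c"
  then have "transpose (g c x) = g c x" using metric assms by (auto simp: riemannian_metric_def)
  then have "transpose (g c x) $ j $ i = g c x $ j $ i" by simp
  then show "g c x $ i $ j = g c x $ j $ i" by (simp add: transpose_def)
qed

lemma metric_nonneg: "c \<in> A \<Longrightarrow> x \<in> chart_img c \<Longrightarrow> v \<bullet> (g c x *v v) \<ge> 0"
  using metric_pos[of c x v] by (cases "v = 0") auto

lemma metric_transform:
  assumes "c \<in> A" "d \<in> A" "x \<in> overlap c d"
  shows "u \<bullet> (g c x *v v) = (jac c d x *v u) \<bullet> (g d (transition c d x) *v (jac c d x *v v))"
  using metric assms frechet_transition[OF assms] by (auto simp: riemannian_metric_def)

lemma det_metric_pos: "c \<in> A \<Longrightarrow> x \<in> chart_img c \<Longrightarrow> det (g c x) > 0"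
  by (rule pos_def_imp_det_pos) (rule metric_pos)

lemma vol_density_pos: "c \<in> A \<Longrightarrow> x \<in> chart_img c \<Longrightarrow> vol_density g c x > 0"
  by (simp add: vol_density_def det_metric_pos)

lemma C1_on_vol_density: "c \<in> A \<Longrightarrow> C1_on (chart_img c) (vol_density g c)"
  unfolding vol_density_def
  by (intro C1_on_sqrt C1_on_det smooth_on_imp_C1_on smooth_on_metric det_metric_pos)

text \<open>The metric changes by \<open>transpose ?J ** ?G ** ?J\<close>, so its determinant
  acquires the square of the Jacobian determinant. The orientation makes the latter positive, and
  the square root needs no absolute value.\<close>

lemma vol_density_transform:
  assumes "c \<in> A" "d \<in> A" "x \<in> overlap c d"
  shows "vol_density g c x = vol_density g d (transition c d x) * det (jac c d x)"
proof -
  let ?J = "jac c d x" and ?G = "g d (transition c d x)"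
  have "u \<bullet> (g c x *v v) = u \<bullet> ((transpose ?J ** ?G ** ?J) *v v)" for u v
    by (simp add: metric_transform[OF assms] matrix_vector_mul_assoc[symmetric]
        transpose_matrix_vector dot_lmul_matrix inner_commute[of u] inner_commute[of "?J *v u"])
  then have "g c x = transpose ?J ** ?G ** ?J"
    by (metis matrix_eq vector_eq_ldot)
  then have "det (g c x) = det ?G * (det ?J)^2"
    by (simp add: det_mul power2_eq_square)
  then show ?thesis
    using det_jac_pos[OF assms] by (simp add: vol_density_def real_sqrt_mult)
qed

lemma vol_density_has_derivative:
  assumes "c \<in> A" "x \<in> chart_img c"
  shows "(vol_density g c has_derivative (\<lambda>v. vol_density g c x / 2 *
     trace (matrix_inv (g c x) ** frechet_derivative (g c) (at x) v))) (at x)"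
proof -
  have pos: "det (g c x) > 0" using det_metric_pos assms by blast
  have "(g c has_derivative frechet_derivative (g c) (at x)) (at x)"
    by (rule C1_on_has_derivative[OF smooth_on_imp_C1_on[OF smooth_on_metric[OF assms(1)]] assms(2)])
  from has_derivative_det[OF this] pos
  have D: "((\<lambda>y. det (g c y)) has_derivative (\<lambda>v. det (g c x) *
      trace (matrix_inv (g c x) ** frechet_derivative (g c) (at x) v))) (at x)" by simp
  have "det (g c x) = sqrt (det (g c x)) * sqrt (det (g c x))" using pos by simp
  then have e: "inverse (sqrt (det (g c x))) * (det (g c x) * a) = sqrt (det (g c x)) * a" for a
    using pos by (simp add: field_simps)
  from has_derivative_compose[OF D DERIV_real_sqrt[OF pos, unfolded has_field_derivative_def]]
  show ?thesis
    unfolding vol_density_def by (simp add: e)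
qed

end

section \<open>Vector fields: the traced equation and invariance of the divergence\<close>

locale riemannian_manifold_with_field = riemannian_manifold A g
  for A :: "('a::{t2_space, second_countable_topology}, 'n::finite) chart set" and g +
  fixes X :: "('a, 'n) vfield"
  assumes field: "smooth_vector_field A X"
begin

lemma smooth_on_field: "c \<in> A \<Longrightarrow> smooth_on (chart_img c) (X c)"
  using field by (auto simp: smooth_vector_field_def)

lemma field_has_derivative:
  "c \<in> A \<Longrightarrow> x \<in> chart_img c \<Longrightarrow> (X c has_derivative frechet_derivative (X c) (at x)) (at x)"
  by (rule C1_on_has_derivative[OF smooth_on_imp_C1_on[OF smooth_on_field]])

lemma field_transform:
  "c \<in> A \<Longrightarrow> d \<in> A \<Longrightarrow> x \<in> overlap c d \<Longrightarrow> X d (transition c d x) = jac c d x *v X c x"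
  using field frechet_transition by (auto simp: smooth_vector_field_def)

lemma norm_sq_invariant:
  assumes "c \<in> A" "d \<in> A" "p \<in> chart_dom c" "p \<in> chart_dom d"
  shows "norm_sq g X c (coord c p) = norm_sq g X d (coord d p)"
  using metric_transform[OF assms(1,2) coord_in_overlap[OF assms(3,4)]]
    field_transform[OF assms(1,2) coord_in_overlap[OF assms(3,4)]] transition_coord[OF assms(1,3)]
  by (simp add: norm_sq_def)

text \<open>The Lie derivative consists of the derivative of \<open>g\<close> along \<open>X\<close>
  and two terms with the Jacobian of \<open>X\<close>. Contracted with the inverse metric, the first
  becomes twice the logarithmic derivative of the density along \<open>X\<close>, by Jacobi's
  formula, and each of the others becomes the trace of the Jacobian.\<close>

lemma trace_lie_derivative:
  assumes c: "c \<in> A" "x \<in> chart_img c"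
  shows "(\<Sum>i\<in>UNIV. \<Sum>j\<in>UNIV. matrix_inv (g c x) $ i $ j * ((1/2) * lie_derivative X g c x $ i $ j))
    = divergence g X c x"
proof -
  let ?I = "matrix_inv (g c x)" and ?G = "g c x"
  define DG where "DG = frechet_derivative (g c) (at x)"
  define DX where "DX = frechet_derivative (X c) (at x)"
  have G: "(g c has_derivative DG) (at x)"
    unfolding DG_def
    by (rule C1_on_has_derivative[OF smooth_on_imp_C1_on[OF smooth_on_metric[OF assms(1)]] assms(2)])
  have G_nth: "((\<lambda>y. g c y $ i $ j) has_derivative (\<lambda>v. DG v $ i $ j)) (at x)" for i j
    by (intro bounded_linear.has_derivative[OF bounded_linear_vec_nth] G)
  have X: "(X c has_derivative DX) (at x)" unfolding DX_def by (rule field_has_derivative[OF c])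
  have pG: "partial k (\<lambda>y. g c y $ i $ j) x = DG (axis k 1) $ i $ j" for i j k
    unfolding partial_def using frechet_derivative_at[OF G_nth] by metis
  have pX: "partial k (\<lambda>y. X c y $ i) x = matrix DX $ i $ k" for i k
    unfolding partial_def matrix_def
    using frechet_derivative_at[OF bounded_linear.has_derivative[OF bounded_linear_vec_nth X]]
    by (metis vec_lambda_beta)
  have linG: "linear DG" using G has_derivative_linear by blast
  have expG: "(\<Sum>k\<in>UNIV. X c x $ k * DG (axis k 1) $ i $ j) = DG (X c x) $ i $ j" for i j
  proof -
    have "DG (X c x) = DG (\<Sum>k\<in>UNIV. X c x $ k *\<^sub>R axis k 1)"
      using basis_expansion[of "X c x"] by (simp add: scalar_mult_eq_scaleR)
    then show ?thesis
      by (simp add: linear_sum[OF linG] linear_cmul[OF linG])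
  qed
  have symDG: "DG v $ i $ j = DG v $ j $ i" for v i j
  proof -
    have "((\<lambda>y. g c y $ i $ j) has_derivative (\<lambda>v. DG v $ j $ i)) (at x)"
      by (rule has_derivative_transform_within_open[OF G_nth[of j i] open_chart_img[OF c(1)] c(2)])
        (use metric_sym c in auto)
    from fun_cong[OF has_derivative_unique[OF this G_nth]] show ?thesis by simp
  qed
  \<comment> \<open>By symmetry the indices may be exchanged on the right; in this order the
    contraction with the inverse metric is the trace of a matrix product.\<close>
  have L: "lie_derivative X g c x $ i $ j
      = (DG (X c x) + ?G ** matrix DX + transpose (matrix DX) ** ?G) $ j $ i" for i j
    using metric_sym[OF c] symDG[of "X c x" i j]
    by (simp add: lie_derivative_def pG pX sum.distrib expG matrix_matrix_mult_def transpose_def mult.commute)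
  have "(\<Sum>i\<in>UNIV. \<Sum>j\<in>UNIV. ?I $ i $ j * lie_derivative X g c x $ i $ j)
      = trace (?I ** (DG (X c x) + ?G ** matrix DX + transpose (matrix DX) ** ?G))"
    unfolding L by (simp add: trace_def matrix_matrix_mult_def)
  also have "\<dots> = trace (?I ** DG (X c x)) + trace (?I ** ?G ** matrix DX) + trace (transpose (matrix DX) ** (?G ** ?I))"
    by (simp add: matrix_add_ldistrib trace_add matrix_mul_assoc trace_mul_sym[of _ ?I])
  also have "\<dots> = trace (?I ** DG (X c x)) + 2 * trace (matrix DX)"
    using matrix_inv_mult[of ?G] det_metric_pos[OF c] by (simp add: trace_def transpose_def)
  finally have S: "(\<Sum>i\<in>UNIV. \<Sum>j\<in>UNIV. ?I $ i $ j * lie_derivative X g c x $ i $ j)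
      = trace (?I ** DG (X c x)) + 2 * trace (matrix DX)" .
  have "frechet_derivative (vol_density g c) (at x) (X c x) / vol_density g c x
      = trace (?I ** DG (X c x)) / 2"
    using frechet_derivative_at[OF vol_density_has_derivative[OF c], symmetric] vol_density_pos[OF c]
    by (simp add: DG_def)
  then have "divergence g X c x = (1/2) * (\<Sum>i\<in>UNIV. \<Sum>j\<in>UNIV. ?I $ i $ j * lie_derivative X g c x $ i $ j)"
    unfolding S by (simp add: divergence_def DX_def)
  then show ?thesis by (simp add: sum_distrib_left mult_ac)
qed

text \<open>The contraction sends \<open>g\<close> to the dimension, the square of the dual 1-form
  to \<open>norm_sq\<close>, and the Lie term to the divergence. The coefficient
  \<open>real_of_ereal (1 / m)\<close> is a mere constant here, which treats finite and infinite
  \<open>m\<close> alike.\<close>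

lemma scalar_curvature_quasi_einstein:
  assumes qE: "quasi_einstein A g X m lam" and c: "c \<in> A" "x \<in> chart_img c"
  shows "scalar_curvature g c x
    = lam * real CARD('n) + real_of_ereal (1 / m) * norm_sq g X c x - divergence g X c x"
proof -
  let ?I = "matrix_inv (g c x)" and ?G = "g c x"
  have I: "?I ** ?G = mat 1" using matrix_inv_mult[of ?G] det_metric_pos[OF c] by simp
  have ric: "ricci g c x $ i $ j = lam * ?G $ i $ j
      + real_of_ereal (1 / m) * (flat g X c x $ i * flat g X c x $ j) - (1/2) * lie_derivative X g c x $ i $ j" for i j
    using qE c unfolding quasi_einstein_def by (smt (verit))
  have "(\<Sum>i\<in>UNIV. \<Sum>j\<in>UNIV. ?I $ i $ j * ?G $ i $ j) = trace (?I ** ?G)"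
    unfolding trace_def matrix_matrix_mult_def vec_lambda_beta
    by (intro sum.cong refl) (metis metric_sym[OF c])
  then have s1: "(\<Sum>i\<in>UNIV. \<Sum>j\<in>UNIV. ?I $ i $ j * ?G $ i $ j) = real CARD('n)"
    by (simp add: I trace_I)
  have "?I *v (?G *v X c x) = X c x" by (simp add: matrix_vector_mul_assoc I)
  then have "norm_sq g X c x = (\<Sum>i\<in>UNIV. (?I *v (?G *v X c x)) $ i * (?G *v X c x) $ i)"
    by (simp add: norm_sq_def inner_vec_def)
  then have s2: "(\<Sum>i\<in>UNIV. \<Sum>j\<in>UNIV. ?I $ i $ j * (flat g X c x $ i * flat g X c x $ j)) = norm_sq g X c x"
    by (simp add: flat_def matrix_vector_mult_def[of ?I] sum_distrib_right sum_distrib_left mult_ac)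
  have "scalar_curvature g c x = lam * (\<Sum>i\<in>UNIV. \<Sum>j\<in>UNIV. ?I $ i $ j * ?G $ i $ j)
     + real_of_ereal (1 / m) * (\<Sum>i\<in>UNIV. \<Sum>j\<in>UNIV. ?I $ i $ j * (flat g X c x $ i * flat g X c x $ j))
     - (\<Sum>i\<in>UNIV. \<Sum>j\<in>UNIV. ?I $ i $ j * ((1/2) * lie_derivative X g c x $ i $ j))"
    unfolding scalar_curvature_def ric
    by (simp only: distrib_left right_diff_distrib sum.distrib sum_subtractf sum_distrib_left mult.left_commute)
  then show ?thesis unfolding s1 s2 trace_lie_derivative[OF c] .
qed

text \<open>In a change of charts \<open>T\<close> with Jacobian \<open>J\<close>, the derivative of \<open>det J\<close> in the density cancels
  the second derivatives of \<open>T\<close> in the trace, because these are symmetric.\<close>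

lemma divergence_invariant:
  assumes c: "c \<in> A" and d: "d \<in> A" and p: "p \<in> chart_dom c" "p \<in> chart_dom d"
  shows "divergence g X c (coord c p) = divergence g X d (coord d p)"
proof -
  define x where "x = coord c p"
  define T where "T = transition c d"
  define Ov where "Ov = overlap c d"
  define J where "J = jac c d"
  define F where "F u y = frechet_derivative T (at y) u" for u y
  define H where "H u y = frechet_derivative (F u) (at y)" for u y
  define J' where "J' v = (\<chi> a k. H (axis k 1) x v $ a)" for v
  have x: "x \<in> Ov" "x \<in> chart_img c" "T x \<in> chart_img d" "T x = coord d p"
    using coord_in_overlap[OF p] transition_coord[OF c p(1)] p by (auto simp: x_def Ov_def T_def)
  have opn: "open Ov" unfolding Ov_def by (rule open_overlap[OF c d])
  have T: "(T has_derivative (\<lambda>v. F v y)) (at y)" "F v y = J y *v v" if "y \<in> Ov" for y v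
    using transition_has_derivative[OF c d] frechet_transition[OF c d] that
    by (simp_all add: F_def T_def Ov_def J_def)
  have smF: "smooth_on Ov (F u)" for u
    unfolding F_def Ov_def T_def by (rule smooth_on_frechet_derivative[OF smooth_on_transition[OF c d]])
  have dF: "(F u has_derivative H u y) (at y)" if "y \<in> Ov" for u y
    unfolding H_def by (rule C1_on_has_derivative[OF smooth_on_imp_C1_on[OF smF] that])
  have contH: "continuous_on Ov (\<lambda>y. H u y v)" for u v
    unfolding H_def by (rule C1_on_continuous_derivative[OF smooth_on_imp_C1_on[OF smF]])
  have sym: "H u x v = H v x u" for u v
  proof (rule vec_eq_iff[THEN iffD2], rule allI)
    fix a
    show "H u x v $ a = H v x u $ a"
      by (rule symmetric_second_derivative[OF opn x(1), of "\<lambda>y. T y $ a" "\<lambda>y u. F u y $ a" "\<lambda>y u v. H u y v $ a"])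
        (auto intro!: bounded_linear.has_derivative[OF bounded_linear_vec_nth] T dF
          bounded_linear.continuous_on[OF bounded_linear_vec_nth] contH)
  qed
  have J: "(J has_derivative J') (at x)"
  proof (subst has_derivative_componentwise_within, safe)
    fix i :: "real^'n^'n" assume "i \<in> Basis"
    then obtain a k where i: "i = axis a (axis k 1)" by (auto simp: Basis_vec_def)
    have "((\<lambda>y. F (axis k 1) y $ a) has_derivative (\<lambda>v. H (axis k 1) x v $ a)) (at x)"
      by (intro bounded_linear.has_derivative[OF bounded_linear_vec_nth] dF x)
    then have "((\<lambda>y. J y $ a $ k) has_derivative (\<lambda>v. H (axis k 1) x v $ a)) (at x)"
      by (rule has_derivative_transform_within_open[OF _ opn x(1)])
        (simp add: T matrix_vector_mul_component inner_axis)
    then show "((\<lambda>y. J y \<bullet> i) has_derivative (\<lambda>y. J' y \<bullet> i)) (at x)"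
      by (simp add: i inner_axis J'_def)
  qed
  have J'H: "J' v *v w = H w x v" for v w
  proof -
    have "((\<lambda>y. J y *v w) has_derivative (\<lambda>v. J' v *v w)) (at x)"
      by (rule bounded_linear.has_derivative[OF _ J])
        (intro linear_conv_bounded_linear[THEN iffD1] linearI,
          simp_all add: matrix_vector_mult_add_rdistrib scaleR_matrix_vector_assoc)
    then have "(F w has_derivative (\<lambda>v. J' v *v w)) (at x)"
      by (rule has_derivative_transform_within_open[OF _ opn x(1)]) (simp add: T)
    from fun_cong[OF has_derivative_unique[OF this dF[OF x(1)]]] show ?thesis .
  qed
  have dJ: "det (J x) > 0" using det_jac_pos[OF c d] x(1) by (simp add: J_def Ov_def)
  have inv: "matrix_inv (J x) ** J x = mat 1" "J x ** matrix_inv (J x) = mat 1"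
    using matrix_inv_mult[of "J x"] dJ by auto
  define DXc where "DXc = frechet_derivative (X c) (at x)"
  define DXd where "DXd = frechet_derivative (X d) (at (T x))"
  have DXc: "(X c has_derivative DXc) (at x)" and DXd: "(X d has_derivative DXd) (at (T x))"
    unfolding DXc_def DXd_def using field_has_derivative c d x by blast+
  note lin = has_derivative_linear[OF DXc] has_derivative_linear[OF DXd]
  have mat: "matrix DXc *v v = DXc v" "matrix DXd *v v = DXd v" for v
    by (rule matrix_works, simp add: linear_matrix_vector_mul_eq lin)+
  have Tx: "(T has_derivative (\<lambda>v. J x *v v)) (at x)"
    using T[OF x(1)] by simp
  \<comment> \<open>Both sides of \<open>X d (T y) = J y *v X c y\<close> are differentiated. Below,
    \<open>sym\<close> exchanges the direction of differentiation with the field inside the second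
    derivative of \<open>T\<close>.\<close>
  have "((\<lambda>y. J y *v X c y) has_derivative (\<lambda>v. J x *v DXc v + J' v *v X c x)) (at x)"
    by (rule bounded_bilinear.FDERIV[OF bounded_bilinear_matrix_vector_mult J DXc])
  then have "((\<lambda>y. X d (T y)) has_derivative (\<lambda>v. J x *v DXc v + J' v *v X c x)) (at x)"
    by (rule has_derivative_transform_within_open[OF _ opn x(1)])
      (simp add: field_transform[OF c d] J_def T_def Ov_def)
  from fun_cong[OF has_derivative_unique[OF this has_derivative_compose[OF Tx DXd]]]
  have "J x *v DXc v + J' (X c x) *v v = DXd (J x *v v)" for v
    using sym[of v "X c x"] by (simp add: J'H)
  then have "(J x ** matrix DXc + J' (X c x)) *v v = (matrix DXd ** J x) *v v" for v
    by (simp add: matrix_vector_mult_add_rdistrib matrix_vector_mul_assoc[symmetric] mat)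
  then have "J x ** matrix DXc + J' (X c x) = matrix DXd ** J x"
    by (simp add: matrix_eq)
  then have "matrix_inv (J x) ** (matrix DXd ** J x)
      = matrix_inv (J x) ** (J x ** matrix DXc) + matrix_inv (J x) ** J' (X c x)"
    by (metis matrix_add_ldistrib)
  then have "trace (matrix_inv (J x) ** (matrix DXd ** J x)) = trace (matrix DXc) + trace (matrix_inv (J x) ** J' (X c x))"
    by (simp add: trace_add matrix_mul_assoc inv)
  moreover have "trace (matrix_inv (J x) ** (matrix DXd ** J x)) = trace (matrix DXd)"
    by (subst trace_mul_sym) (simp add: matrix_mul_assoc[symmetric] inv)
  ultimately have tr: "trace (matrix DXd) = trace (matrix DXc) + trace (matrix_inv (J x) ** J' (X c x))"
    by simp
  define Rc where "Rc = frechet_derivative (vol_density g c) (at x)"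
  define Rd where "Rd = frechet_derivative (vol_density g d) (at (T x))"
  have Rc: "(vol_density g c has_derivative Rc) (at x)"
    unfolding Rc_def by (rule C1_on_has_derivative[OF C1_on_vol_density[OF c] x(2)])
  have Rd: "(vol_density g d has_derivative Rd) (at (T x))"
    unfolding Rd_def by (rule C1_on_has_derivative[OF C1_on_vol_density[OF d] x(3)])
  \<comment> \<open>The logarithmic derivative of \<open>det (J y)\<close> along the field is the
    very trace by which the two Jacobians of the field differ in \<open>tr\<close>, so the two
    contributions cancel.\<close>
  have "det (J x) \<noteq> 0" using dJ by simp
  from has_derivative_mult[OF has_derivative_compose[OF Tx Rd] has_derivative_det[OF J this]]
  have "(vol_density g c has_derivative (\<lambda>v. vol_density g d (T x) * (det (J x) * trace (matrix_inv (J x) ** J' v))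
      + Rd (J x *v v) * det (J x))) (at x)"
    by (rule has_derivative_transform_within_open[OF _ opn x(1)])
      (simp add: vol_density_transform[OF c d] J_def T_def Ov_def)
  from fun_cong[OF has_derivative_unique[OF this Rc], of "X c x"]
  have "Rc (X c x) = vol_density g d (T x) * (det (J x) * trace (matrix_inv (J x) ** J' (X c x)))
      + Rd (J x *v X c x) * det (J x)"
    by simp
  moreover have "vol_density g c x = vol_density g d (T x) * det (J x)"
    using vol_density_transform[OF c d] x(1) by (simp add: J_def T_def Ov_def)
  moreover have "vol_density g d (T x) > 0" using vol_density_pos[OF d x(3)] .
  moreover have "X d (T x) = J x *v X c x"
    using field_transform[OF c d] x(1) by (simp add: J_def T_def Ov_def)
  ultimately have "Rc (X c x) / vol_density g c x
      = trace (matrix_inv (J x) ** J' (X c x)) + Rd (X d (T x)) / vol_density g d (T x)"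
    using dJ by (simp add: add_divide_distrib)
  with tr show ?thesis
    by (simp add: divergence_def x(4)[symmetric] x_def[symmetric] DXc_def DXd_def Rc_def Rd_def)
qed

lemma at_point_divergence:
  "c \<in> A \<Longrightarrow> p \<in> chart_dom c \<Longrightarrow> at_point A (divergence g X) p = divergence g X c (coord c p)"
  by (rule at_point_eq[where f = "divergence g X", OF divergence_invariant])

lemma at_point_norm_sq:
  "c \<in> A \<Longrightarrow> p \<in> chart_dom c \<Longrightarrow> at_point A (norm_sq g X) p = norm_sq g X c (coord c p)"
  by (rule at_point_eq[where f = "norm_sq g X", OF norm_sq_invariant])

end

section \<open>Speed of curves\<close>

text \<open>The derivatives are two-sided, while \<open>f\<close> and \<open>h\<close> agree on the
  closed interval only. The end points are therefore added to the exceptional set.\<close>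

lemma piecewise_C1_differentiable_on_cong:
  assumes f: "f piecewise_C1_differentiable_on {a..b::real}"
    and eq: "\<And>x. x \<in> {a..b} \<Longrightarrow> f x = h x"
  shows "h piecewise_C1_differentiable_on {a..b}"
proof -
  obtain S D where S: "finite S" "\<And>x. x \<in> {a..b} - S \<Longrightarrow> (f has_vector_derivative D x) (at x)"
    "continuous_on ({a..b} - S) D" and cf: "continuous_on {a..b} f"
    using f unfolding piecewise_C1_differentiable_on_def C1_differentiable_on_def by blast
  have "h C1_differentiable_on ({a..b} - (S \<union> {a, b}))"
    unfolding C1_differentiable_on_def
  proof (intro exI[of _ D] conjI ballI)
    fix x assume x: "x \<in> {a..b} - (S \<union> {a, b})"
    show "(h has_vector_derivative D x) (at x)"
      by (rule has_vector_derivative_transform_within_open[where f = f and S = "{a<..<b}"])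
        (use x S(2)[of x] eq in auto)
  qed (rule continuous_on_subset[OF S(3)], auto)
  then show ?thesis
    unfolding piecewise_C1_differentiable_on_def
    using S(1) continuous_on_eq[OF cf eq] by (intro conjI exI[of _ "S \<union> {a, b}"]) auto
qed

text \<open>Near the break points the derivative may fail to be integrable. If its norm has infinite
  integral, nothing is to be shown; otherwise the fundamental theorem with finitely many exceptional
  points applies. The function \<open>h\<close> puts the derivative to 0 at the exceptional points
  and outside the interval, which makes it Borel.\<close>

lemma norm_increment_le_nn_integral:
  fixes f :: "real \<Rightarrow> 'b::euclidean_space"
  assumes f: "f piecewise_C1_differentiable_on {a..b}" and ab: "a \<le> b"
    and \<delta>: "0 \<le> \<delta>"
  shows "ennreal (\<delta> * norm (f b - f a))
    \<le> (\<integral>\<^sup>+ t\<in>{a..b}. ennreal (\<delta> * norm (vector_derivative f (at t))) \<partial>lborel)"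
proof -
  obtain S where S: "finite S" "f C1_differentiable_on ({a..b} - S)" and cf: "continuous_on {a..b} f"
    using f unfolding piecewise_C1_differentiable_on_def by blast
  define V where "V = {a<..<b} - S"
  have V: "open V" unfolding V_def using S(1) by (intro open_Diff finite_imp_closed) auto
  define h where "h t = indicator V t *\<^sub>R vector_derivative f (at t)" for t
  have "continuous_on V (\<lambda>t. vector_derivative f (at t))"
    using S(2) by (auto simp: C1_differentiable_on_eq V_def intro: continuous_on_subset)
  then have "h \<in> borel_measurable borel"
    unfolding h_def by (rule borel_measurable_continuous_on_indicator[OF borel_open[OF V]])
  then have hm: "h \<in> borel_measurable lborel" by simp
  have base: "ennreal (norm (f b - f a)) \<le> (\<integral>\<^sup>+ t. ennreal (norm (h t)) \<partial>lborel)"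
  proof (cases "(\<integral>\<^sup>+ t. ennreal (norm (h t)) \<partial>lborel) < \<infinity>")
    case True
    then have hi: "integrable lborel h" using hm by (intro integrableI_bounded) auto
    have "(h has_integral (f b - f a)) {a..b}"
    proof (rule fundamental_theorem_of_calculus_interior_strong[OF S(1) ab _ cf])
      fix x assume x: "x \<in> {a<..<b} - S"
      then have "(f has_vector_derivative vector_derivative f (at x)) (at x)"
        using S(2) by (auto simp: C1_differentiable_on_eq vector_derivative_works[symmetric])
      then show "(f has_vector_derivative h x) (at x)"
        using x by (simp add: h_def V_def)
    qed
    moreover have "(h has_integral (integral\<^sup>L lborel h)) {a..b}"
    proof -
      have "(\<lambda>x. if x \<in> {a..b} then h x else 0) = h"
        by (rule ext) (auto simp: h_def V_def indicator_def)
      then show ?thesis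
        using has_integral_integral_lborel[OF hi] has_integral_restrict_UNIV[of "{a..b}" h] by simp
    qed
    ultimately have "f b - f a = integral\<^sup>L lborel h" using has_integral_unique by blast
    then have "ennreal (norm (f b - f a)) \<le> ennreal (\<integral>t. norm (h t) \<partial>lborel)"
      by (simp add: integral_norm_bound)
    also have "\<dots> = (\<integral>\<^sup>+ t. ennreal (norm (h t)) \<partial>lborel)"
      by (rule nn_integral_eq_integral[symmetric]) (use hi in auto)
    finally show ?thesis .
  qed (simp add: less_top[symmetric])
  have "ennreal (\<delta> * norm (f b - f a)) \<le> ennreal \<delta> * (\<integral>\<^sup>+ t. ennreal (norm (h t)) \<partial>lborel)"
    using base \<delta> by (simp add: ennreal_mult mult_left_mono)
  also have "\<dots> = (\<integral>\<^sup>+ t. ennreal (\<delta> * norm (h t)) \<partial>lborel)"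
    using hm \<delta> by (simp add: ennreal_mult nn_integral_cmult)
  also have "\<dots> \<le> (\<integral>\<^sup>+ t\<in>{a..b}. ennreal (\<delta> * norm (vector_derivative f (at t))) \<partial>lborel)"
    by (rule nn_integral_mono) (auto simp: h_def V_def indicator_def)
  finally show ?thesis .
qed

context riemannian_manifold
begin

definition gnorm where "gnorm c x v = sqrt (v \<bullet> (g c x *v v))"

lemma gnorm_nonneg: "c \<in> A \<Longrightarrow> x \<in> chart_img c \<Longrightarrow> gnorm c x v \<ge> 0"
  by (simp add: gnorm_def metric_nonneg)

lemma gnorm_scaleR: "gnorm c x (a *\<^sub>R v) = \<bar>a\<bar> * gnorm c x v"
  by (simp add: gnorm_def matrix_vector_mult_scaleR real_sqrt_mult mult.assoc[symmetric])

lemma continuous_on_gnorm: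
  assumes "c \<in> A" "continuous_on S f" "f ` S \<subseteq> chart_img c" "continuous_on S w"
  shows "continuous_on S (\<lambda>x. gnorm c (f x) (w x))"
proof -
  have "continuous_on S (\<lambda>x. g c (f x))"
    using C1_on_imp_continuous_on[OF smooth_on_imp_C1_on[OF smooth_on_metric[OF assms(1)]]]
    by (rule continuous_on_compose2) (use assms in auto)
  then show ?thesis
    unfolding gnorm_def
    by (intro continuous_intros assms(4)
        bounded_bilinear.continuous_on[OF bounded_bilinear_matrix_vector_mult])
qed

text \<open>By homogeneity only the Euclidean unit sphere matters, and on this compact set the
  continuous length attains positive extrema.\<close>

lemma gnorm_bounds_at:
  assumes c: "c \<in> A" and x0: "x0 \<in> chart_img c"
  obtains \<delta> M where "\<delta> > 0" "M > 0"
    "\<And>v. \<delta> * norm v \<le> gnorm c x0 v" "\<And>v. gnorm c x0 v \<le> M * norm v"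
proof -
  have cont: "continuous_on (sphere 0 1) (gnorm c x0)"
    using continuous_on_gnorm[OF c, of "sphere 0 1" "\<lambda>_. x0" "\<lambda>v. v"] x0 by auto
  have ne: "sphere (0::real^'n) 1 \<noteq> {}" by simp
  obtain a where a: "a \<in> sphere 0 1" "\<And>v. v \<in> sphere 0 1 \<Longrightarrow> gnorm c x0 a \<le> gnorm c x0 v"
    using continuous_attains_inf[OF compact_sphere ne cont] by blast
  obtain b where b: "b \<in> sphere 0 1" "\<And>v. v \<in> sphere 0 1 \<Longrightarrow> gnorm c x0 v \<le> gnorm c x0 b"
    using continuous_attains_sup[OF compact_sphere ne cont] by blast
  have "a \<noteq> 0" "b \<noteq> 0" using a(1) b(1) by auto
  then have pos: "gnorm c x0 a > 0" "gnorm c x0 b > 0"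
    using metric_pos[OF c x0, of a] metric_pos[OF c x0, of b] by (auto simp: gnorm_def)
  have ab: "gnorm c x0 a * norm v \<le> gnorm c x0 v" "gnorm c x0 v \<le> gnorm c x0 b * norm v" for v
  proof (atomize (full), cases "v = 0")
    case False
    have "gnorm c x0 (v /\<^sub>R norm v) = gnorm c x0 v / norm v"
      by (simp add: gnorm_scaleR divide_inverse)
    moreover have "v /\<^sub>R norm v \<in> sphere 0 1" using False by simp
    ultimately have "gnorm c x0 a \<le> gnorm c x0 v / norm v" "gnorm c x0 v / norm v \<le> gnorm c x0 b"
      using a(2) b(2) by metis+
    then show "gnorm c x0 a * norm v \<le> gnorm c x0 v \<and> gnorm c x0 v \<le> gnorm c x0 b * norm v"
      using False by (simp add: field_simps)
  qed (simp add: gnorm_def)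
  show thesis by (rule that[OF pos ab])
qed

text \<open>The factor 2 depends neither on the chart nor on the point, only the radius does; this
  is what makes the final constant uniform. Near \<open>x0\<close> the squared length changes by at
  most half of its value at \<open>x0\<close>, so squared lengths are comparable with factor
  4.\<close>

lemma gnorm_comparable:
  assumes c: "c \<in> A" and x0: "x0 \<in> chart_img c"
  obtains r where "r > 0" "cball x0 r \<subseteq> chart_img c"
    "\<And>x v. x \<in> cball x0 r \<Longrightarrow> gnorm c x v \<le> 2 * gnorm c x0 v"
    "\<And>x v. x \<in> cball x0 r \<Longrightarrow> gnorm c x0 v \<le> 2 * gnorm c x v"
proof -
  define Q where "Q x v = v \<bullet> (g c x *v v)" for x v
  obtain \<delta> M where \<delta>: "\<delta> > 0" "M > 0" "\<And>v. \<delta> * norm v \<le> gnorm c x0 v" "\<And>v. gnorm c x0 v \<le> M * norm v"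
    by (rule gnorm_bounds_at[OF c x0]) (rule that)
  have pos: "Q x0 v \<ge> 0" for v unfolding Q_def by (rule metric_nonneg[OF c x0])
  have Q0: "\<delta>\<^sup>2 * (norm v)\<^sup>2 \<le> Q x0 v" for v
    using power_mono[OF \<delta>(3)[of v], of 2] \<delta>(1) pos[of v] by (simp add: gnorm_def Q_def power_mult_distrib)
  obtain K where K: "K > 0" "\<And>(B::real^'n^'n) v. norm (B *v v) \<le> norm B * norm v * K"
    using bounded_bilinear.pos_bounded[OF bounded_bilinear_matrix_vector_mult] by blast
  have "isCont (g c) x0"
    using C1_on_imp_continuous_on[OF smooth_on_imp_C1_on[OF smooth_on_metric[OF c]]]
      open_chart_img[OF c] x0 continuous_on_eq_continuous_at by blast
  \<comment> \<open>\<open>K\<close> bounds the product of matrix and vector, and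
    \<open>\<delta>\<^sup>2\<close> bounds the form at \<open>x0\<close> from below on unit vectors;
    a perturbation of this size changes the form by at most half.\<close>
  moreover have "\<delta>\<^sup>2 / (2 * K) > 0" using \<delta> K by simp
  ultimately obtain r1 where r1: "r1 > 0" "\<And>x. dist x x0 < r1 \<Longrightarrow> dist (g c x) (g c x0) < \<delta>\<^sup>2 / (2 * K)"
    unfolding continuous_at_eps_delta by blast
  obtain r2 where r2: "r2 > 0" "cball x0 r2 \<subseteq> chart_img c"
    using open_chart_img[OF c] x0 open_contains_cball by blast
  define r where "r = min (r1 / 2) r2"
  have close: "\<bar>Q x v - Q x0 v\<bar> \<le> Q x0 v / 2" if "x \<in> cball x0 r" for x v
  proof -
    have d: "norm (g c x - g c x0) \<le> \<delta>\<^sup>2 / (2 * K)"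
      using r1(2)[of x] r1(1) that by (simp add: r_def dist_norm norm_minus_commute)
    have "\<bar>Q x v - Q x0 v\<bar> = \<bar>v \<bullet> ((g c x - g c x0) *v v)\<bar>"
      by (simp add: Q_def matrix_vector_mult_diff_rdistrib inner_diff_right)
    also have "\<dots> \<le> norm v * norm ((g c x - g c x0) *v v)"
      by (rule Cauchy_Schwarz_ineq2)
    also have "\<dots> \<le> norm v * (norm (g c x - g c x0) * norm v * K)"
      by (intro mult_left_mono K) auto
    also have "\<dots> = norm (g c x - g c x0) * ((norm v)^2 * K)" by (simp add: power2_eq_square)
    also have "\<dots> \<le> \<delta>\<^sup>2 / (2 * K) * ((norm v)^2 * K)"
      using K by (intro mult_right_mono d) auto
    also have "\<dots> = \<delta>\<^sup>2 * (norm v)^2 / 2" using K by simp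
    also have "\<dots> \<le> Q x0 v / 2" using Q0[of v] by simp
    finally show ?thesis .
  qed
  have two: "2 * sqrt a = sqrt (4 * a)" for a :: real by (simp add: real_sqrt_mult)
  show thesis
  proof (rule that[of r])
    show "r > 0" using r1 r2 by (simp add: r_def)
    have "cball x0 r \<subseteq> cball x0 r2" by (auto simp: r_def)
    then show "cball x0 r \<subseteq> chart_img c" using r2 by blast
    show "gnorm c x v \<le> 2 * gnorm c x0 v" "gnorm c x0 v \<le> 2 * gnorm c x v" if "x \<in> cball x0 r" for x v
      using close[OF that, of v] pos[of v]
      unfolding gnorm_def two Q_def[symmetric] real_sqrt_le_iff by linarith+
  qed
qed

lemma gnorm_bounds:
  assumes c: "c \<in> A" and x0: "x0 \<in> chart_img c"
  obtains r \<delta> M where "r > 0" "\<delta> > 0" "M > 0" "cball x0 r \<subseteq> chart_img c"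
    "\<And>x v. x \<in> cball x0 r \<Longrightarrow> \<delta> * norm v \<le> gnorm c x v"
    "\<And>x v. x \<in> cball x0 r \<Longrightarrow> gnorm c x v \<le> M * norm v"
proof -
  obtain r where r: "r > 0" "cball x0 r \<subseteq> chart_img c"
    "\<And>x v. x \<in> cball x0 r \<Longrightarrow> gnorm c x v \<le> 2 * gnorm c x0 v"
    "\<And>x v. x \<in> cball x0 r \<Longrightarrow> gnorm c x0 v \<le> 2 * gnorm c x v"
    using gnorm_comparable[OF c x0] by blast
  obtain \<delta> M where \<delta>: "\<delta> > 0" "M > 0" "\<And>v. \<delta> * norm v \<le> gnorm c x0 v" "\<And>v. gnorm c x0 v \<le> M * norm v"
    by (rule gnorm_bounds_at[OF c x0]) (rule that)
  show thesis
  proof (rule that[OF r(1) _ _ r(2)])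
    show "\<delta> / 2 > 0" "2 * M > 0" using \<delta> by auto
    show "\<delta> / 2 * norm v \<le> gnorm c x v" "gnorm c x v \<le> 2 * M * norm v" if "x \<in> cball x0 r" for x v
      using r(3,4)[OF that, of v] \<delta>(3,4)[of v] by linarith+
  qed
qed

lemma coord_curve_has_vector_derivative:
  assumes c: "c \<in> A" "\<gamma> t \<in> chart_dom c" and d: "d \<in> A" "\<gamma> t \<in> chart_dom d"
    and cont: "isCont \<gamma> t" and v: "((coord c \<circ> \<gamma>) has_vector_derivative v) (at t)"
  shows "((coord d \<circ> \<gamma>) has_vector_derivative (jac c d (coord c (\<gamma> t)) *v v)) (at t)"
proof -
  have ov: "coord c (\<gamma> t) \<in> overlap c d" by (rule coord_in_overlap[OF c(2) d(2)])
  obtain W where W: "open W" "t \<in> W" "\<And>s. s \<in> W \<Longrightarrow> \<gamma> s \<in> chart_dom c"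
    using cont[unfolded continuous_at_open, rule_format, OF conjI[OF open_chart_dom[OF c(1)] c(2)]] by blast
  have T: "(transition c d has_derivative (\<lambda>v. jac c d (coord c (\<gamma> t)) *v v)) (at ((coord c \<circ> \<gamma>) t))"
    using transition_has_derivative[OF c(1) d(1) ov] by simp
  have "((\<lambda>s. transition c d ((coord c \<circ> \<gamma>) s)) has_derivative
      (\<lambda>s. jac c d (coord c (\<gamma> t)) *v (s *\<^sub>R v))) (at t)"
    by (rule has_derivative_compose[OF v[unfolded has_vector_derivative_def] T])
  then have "((coord d \<circ> \<gamma>) has_derivative (\<lambda>s. jac c d (coord c (\<gamma> t)) *v (s *\<^sub>R v))) (at t)"
    by (rule has_derivative_transform_within_open[OF _ W(1,2)])
      (simp add: W(3) transition_coord[OF c(1)])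
  then show ?thesis
    by (simp add: has_vector_derivative_def matrix_vector_mult_scaleR)
qed

text \<open>\<open>speed\<close> uses a chosen chart that may vary along the curve; the
  transformation law of the metric gives the same length in every other chart. Continuity at
  \<open>t\<close> keeps the nearby part of the curve in the chart.\<close>

lemma speed_eq:
  assumes c: "c \<in> A" "\<gamma> t \<in> chart_dom c"
    and cont: "isCont \<gamma> t" and v: "((coord c \<circ> \<gamma>) has_vector_derivative v) (at t)"
  shows "speed A g \<gamma> t = gnorm c (coord c (\<gamma> t)) v"
proof -
  let ?d = "chart_at A (\<gamma> t)" and ?x = "coord c (\<gamma> t)"
  have ov: "?x \<in> overlap c ?d" by (rule coord_in_overlap[OF c(2) chart_at(2)])
  have "vector_derivative (coord ?d \<circ> \<gamma>) (at t) = jac c ?d ?x *v v"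
    by (rule vector_derivative_at[OF coord_curve_has_vector_derivative[OF c chart_at cont v]])
  then show ?thesis
    using metric_transform[OF c(1) chart_at(1) ov, of v v] transition_coord[OF c]
    by (simp add: speed_def Let_def gnorm_def)
qed

text \<open>Elsewhere \<open>vector_derivative\<close> need not be an actual derivative, so formulas
  for \<open>speed\<close> are proved at these points only.\<close>

definition regular_at where
  "regular_at \<gamma> t \<longleftrightarrow> isCont \<gamma> t \<and>
    (\<exists>c\<in>A. \<gamma> t \<in> chart_dom c \<and> (coord c \<circ> \<gamma>) differentiable (at t))"

lemma speed_affine:
  assumes reg: "regular_at \<gamma> (m * t + k)"
  shows "speed A g (\<lambda>s. \<gamma> (m * s + k)) t = \<bar>m\<bar> * speed A g \<gamma> (m * t + k)"
proof -
  obtain c where c: "c \<in> A" "\<gamma> (m * t + k) \<in> chart_dom c"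
    "(coord c \<circ> \<gamma>) differentiable (at (m * t + k))" and cont: "isCont \<gamma> (m * t + k)"
    using reg by (auto simp: regular_at_def)
  define v where "v = vector_derivative (coord c \<circ> \<gamma>) (at (m * t + k))"
  have v: "((coord c \<circ> \<gamma>) has_vector_derivative v) (at (m * t + k))"
    unfolding v_def by (rule vector_derivative_works[THEN iffD1, OF c(3)])
  have "((\<lambda>s. m * s + k) has_real_derivative m) (at t)"
    by (auto intro!: derivative_eq_intros)
  then have lin: "((\<lambda>s. m * s + k) has_vector_derivative m) (at t)"
    by (simp add: has_real_derivative_iff_has_vector_derivative)
  have "((coord c \<circ> (\<lambda>s. \<gamma> (m * s + k))) has_vector_derivative m *\<^sub>R v) (at t)"
    using vector_diff_chain_at[OF lin v] by (simp add: o_def)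
  moreover have "isCont (\<lambda>s. \<gamma> (m * s + k)) t"
    by (rule isCont_o2[where g = \<gamma> and f = "\<lambda>s. m * s + k" and a = t, OF _ cont]) (intro continuous_intros)
  ultimately have "speed A g (\<lambda>s. \<gamma> (m * s + k)) t = gnorm c (coord c (\<gamma> (m * t + k))) (m *\<^sub>R v)"
    by (intro speed_eq[OF c(1)]) (use c(2) in auto)
  then show ?thesis
    using speed_eq[OF c(1,2) cont v] by (simp add: gnorm_scaleR)
qed

text \<open>\<open>pw_C1_curve\<close> provides a finite exceptional set only for arcs inside one
  chart. By compactness the unit interval is covered by finitely many such arcs.\<close>

lemma curve_regular:
  assumes \<gamma>: "pw_C1_curve A \<gamma>"
  obtains S where "finite S" "\<And>t. t \<in> {0<..<1} - S \<Longrightarrow> regular_at \<gamma> t"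
    "continuous_on ({0<..<1} - S) (speed A g \<gamma>)"
proof -
  have cont: "continuous_on {0..1} \<gamma>" using \<gamma> by (simp add: pw_C1_curve_def)
  have loc: "\<exists>e>0. \<exists>S. finite S \<and> (\<forall>t\<in>ball t0 e \<inter> {0<..<1} - S. regular_at \<gamma> t \<and> isCont (speed A g \<gamma>) t)"
    if t0: "t0 \<in> {0..1}" for t0
  proof -
    define c where "c = chart_at A (\<gamma> t0)"
    have c: "c \<in> A" "\<gamma> t0 \<in> chart_dom c" using chart_at by (auto simp: c_def)
    obtain W where W: "open W" "W \<inter> {0..1} = \<gamma> -` chart_dom c \<inter> {0..1}"
      using cont open_chart_dom[OF c(1)] unfolding continuous_on_open_invariant by metis
    then have "t0 \<in> W" using t0 c by blast
    then obtain e where e: "e > 0" "cball t0 e \<subseteq> W" using W(1) open_contains_cball by blast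
    define a b where "a = max 0 (t0 - e)" and "b = min 1 (t0 + e)"
    have ab: "0 \<le> a" "a < b" "b \<le> 1" using t0 e(1) by (auto simp: a_def b_def)
    have "{a..b} \<subseteq> cball t0 e" by (auto simp: a_def b_def dist_real_def)
    then have im: "\<gamma> ` {a..b} \<subseteq> chart_dom c"
      using W(2) e(2) ab by fastforce
    then obtain S D where S: "finite S" "\<And>x. x \<in> {a..b} - S \<Longrightarrow> ((coord c \<circ> \<gamma>) has_vector_derivative D x) (at x)"
      "continuous_on ({a..b} - S) D"
      using \<gamma> ab c unfolding pw_C1_curve_def piecewise_C1_differentiable_on_def C1_differentiable_on_def
      by metis
    define V where "V = {a<..<b} - S"
    have V: "open V" unfolding V_def using S(1) by (intro open_Diff finite_imp_closed) auto
    have ctV: "isCont \<gamma> t" if "t \<in> V" for t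
      using cont that ab unfolding V_def
      by (intro continuous_on_interior[of "{0..1}"]) (auto simp: interior_atLeastAtMost_real)
    have sp: "speed A g \<gamma> t = gnorm c (coord c (\<gamma> t)) (D t)" if "t \<in> V" for t
      using that im S(2)[of t] by (intro speed_eq[OF c(1)] ctV) (auto simp: V_def)
    have cV: "continuous_on V (coord c \<circ> \<gamma>)"
    proof (rule continuous_on_compose)
      show "continuous_on V \<gamma>" using ctV by (simp add: continuous_at_imp_continuous_on)
      show "continuous_on (\<gamma> ` V) (coord c)"
        by (rule continuous_on_subset[OF continuous_on_coord[OF c(1)]]) (use im in \<open>auto simp: V_def\<close>)
    qed
    have "continuous_on V (\<lambda>t. gnorm c (coord c (\<gamma> t)) (D t))"
    proof (intro continuous_on_gnorm[OF c(1)] continuous_on_subset[OF S(3)])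
      show "(\<lambda>t. coord c (\<gamma> t)) ` V \<subseteq> chart_img c"
        using im by (fastforce simp: V_def)
    qed (use cV in \<open>auto simp: V_def o_def\<close>)
    then have "continuous_on V (speed A g \<gamma>)" using sp by (simp cong: continuous_on_cong)
    then have "isCont (speed A g \<gamma>) t" if "t \<in> V" for t
      using V that continuous_on_eq_continuous_at by blast
    moreover have "regular_at \<gamma> t" if "t \<in> V" for t
      unfolding regular_at_def using ctV[OF that] im that S(2)[of t] c(1)
      by (intro conjI bexI[of _ c]) (auto simp: V_def differentiableI_vector)
    moreover have "ball t0 e \<inter> {0<..<1} - S \<subseteq> V"
      by (auto simp: V_def a_def b_def dist_real_def)
    ultimately show ?thesis using e(1) S(1) by blast
  qed
  then obtain e F where eF: "\<And>t0. t0 \<in> {0..1} \<Longrightarrow> e t0 > 0" "\<And>t0. t0 \<in> {0..1} \<Longrightarrow> finite (F t0)"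
    "\<And>t0 t. t0 \<in> {0..1} \<Longrightarrow> t \<in> ball t0 (e t0) \<inter> {0<..<1} - F t0 \<Longrightarrow> regular_at \<gamma> t \<and> isCont (speed A g \<gamma>) t"
    by metis
  have "{0..1} \<subseteq> (\<Union>t0\<in>{0..1}. ball t0 (e t0))" using eF(1) by force
  then obtain C where C: "C \<subseteq> {0..1}" "finite C" "{0..1} \<subseteq> (\<Union>t0\<in>C. ball t0 (e t0))"
    by (rule compactE_image[OF compact_Icc, rotated 1]) auto
  show thesis
  proof (rule that[of "\<Union> (F ` C)"])
    show "finite (\<Union> (F ` C))" using C eF(2) by auto
    have *: "regular_at \<gamma> t \<and> isCont (speed A g \<gamma>) t" if t: "t \<in> {0<..<1} - \<Union> (F ` C)" for t
    proof -
      have "t \<in> {0..1}" using t by auto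
      then obtain t0 where "t0 \<in> C" "t \<in> ball t0 (e t0)" using C(3) by blast
      then show ?thesis using eF(3)[of t0 t] C(1) t by blast
    qed
    then show "regular_at \<gamma> t" if "t \<in> {0<..<1} - \<Union> (F ` C)" for t using that by blast
    show "continuous_on ({0<..<1} - \<Union> (F ` C)) (speed A g \<gamma>)"
      using * by (simp add: continuous_at_imp_continuous_on)
  qed
qed

end

section \<open>Length of curves\<close>

context riemannian_manifold
begin

definition length_on :: "(real \<Rightarrow> 'a) \<Rightarrow> real \<Rightarrow> real \<Rightarrow> ennreal" where
  "length_on \<gamma> a b = (\<integral>\<^sup>+ t\<in>{a..b}. ennreal (speed A g \<gamma> t) \<partial>lborel)"

lemma curve_length_eq: "curve_length A g \<gamma> = length_on \<gamma> 0 1"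
  by (simp add: curve_length_def length_on_def)

text \<open>The speed is uncontrolled at the exceptional points. Cutting out this null set leaves
  the integral unchanged and leads to an integrand that \<open>regular_speed_measurable\<close> can
  treat.\<close>

lemma length_on_restrict:
  assumes S: "finite S" and ab: "0 \<le> a" "b \<le> 1"
  shows "length_on \<gamma> a b
    = (\<integral>\<^sup>+ t. ennreal (indicator ({0<..<1} - S) t * speed A g \<gamma> t) * indicator {a..b} t \<partial>lborel)"
  unfolding length_on_def
proof (rule nn_integral_cong_AE)
  have "S \<union> {0, 1} \<in> null_sets lborel"
    using S by (intro finite_imp_null_set_lborel) auto
  then have "AE t in lborel. t \<notin> S \<union> {0, 1}" by (rule AE_not_in)
  then show "AE t in lborel. ennreal (speed A g \<gamma> t) * indicator {a..b} t
      = ennreal (indicator ({0<..<1} - S) t * speed A g \<gamma> t) * indicator {a..b} t"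
    by eventually_elim (use ab in \<open>auto simp: indicator_def\<close>)
qed

lemma regular_speed_measurable:
  assumes "finite S" "continuous_on ({0<..<1} - S) (speed A g \<gamma>)"
  shows "(\<lambda>t. indicator ({0<..<1} - S) t * speed A g \<gamma> t) \<in> borel_measurable borel"
proof -
  have "open ({0<..<1} - S)" using assms(1) by (intro open_Diff finite_imp_closed) auto
  then show ?thesis
    using borel_measurable_continuous_on_indicator[OF borel_open assms(2)] by simp
qed

lemma length_on_add:
  assumes \<gamma>: "pw_C1_curve A \<gamma>" and abc: "0 \<le> a" "a \<le> b" "b \<le> c" "c \<le> 1"
  shows "length_on \<gamma> a c = length_on \<gamma> a b + length_on \<gamma> b c"
proof -
  obtain S where S: "finite S" "\<And>t. t \<in> {0<..<1} - S \<Longrightarrow> regular_at \<gamma> t"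
    "continuous_on ({0<..<1} - S) (speed A g \<gamma>)"
    by (rule curve_regular[OF \<gamma>]) (rule that)
  \<comment> \<open>Without the common end point \<open>b\<close> the integrands over the two
    intervals add up exactly.\<close>
  let ?f = "\<lambda>t. ennreal (indicator ({0<..<1} - insert b S) t * speed A g \<gamma> t)"
  have "continuous_on ({0<..<1} - insert b S) (speed A g \<gamma>)"
    by (rule continuous_on_subset[OF S(3)]) auto
  then have "(\<lambda>t. indicator ({0<..<1} - insert b S) t * speed A g \<gamma> t) \<in> borel_measurable borel"
    by (rule regular_speed_measurable[rotated]) (use S in simp)
  then have m: "?f \<in> borel_measurable lborel" by simp
  have "length_on \<gamma> a c = (\<integral>\<^sup>+ t. ?f t * indicator {a..c} t \<partial>lborel)"
    by (rule length_on_restrict) (use S abc in auto)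
  also have "\<dots> = (\<integral>\<^sup>+ t. ?f t * indicator {a..b} t + ?f t * indicator {b..c} t \<partial>lborel)"
    using abc by (intro nn_integral_cong) (auto simp: indicator_def)
  also have "\<dots> = (\<integral>\<^sup>+ t. ?f t * indicator {a..b} t \<partial>lborel) + (\<integral>\<^sup>+ t. ?f t * indicator {b..c} t \<partial>lborel)"
    by (intro nn_integral_add) (use m in measurable)
  also have "\<dots> = length_on \<gamma> a b + length_on \<gamma> b c"
    by (subst (1 2) length_on_restrict[of "insert b S"]) (use S abc in auto)
  finally show ?thesis .
qed

lemma pw_C1_curveD:
  "pw_C1_curve A \<gamma> \<Longrightarrow> c \<in> A \<Longrightarrow> 0 \<le> a \<Longrightarrow> a < b \<Longrightarrow> b \<le> 1 \<Longrightarrow> \<gamma> ` {a..b} \<subseteq> chart_dom c \<Longrightarrow>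
    (coord c \<circ> \<gamma>) piecewise_C1_differentiable_on {a..b}"
  by (auto simp: pw_C1_curve_def)

lemma piecewise_C1_affine_piece:
  assumes \<gamma>: "pw_C1_curve A \<gamma>" and c: "c \<in> A" and m: "m \<noteq> 0" and ab: "a < b"
    and h: "\<And>t. t \<in> {a..b} \<Longrightarrow> m * t + k \<in> {0..1}"
    and eq: "\<And>t. t \<in> {a..b} \<Longrightarrow> \<gamma>' t = \<gamma> (m * t + k)"
    and dom: "\<gamma>' ` {a..b} \<subseteq> chart_dom c"
  shows "(coord c \<circ> \<gamma>') piecewise_C1_differentiable_on {a..b}"
proof -
  \<comment> \<open>For negative \<open>m\<close> the affine map reverses the interval, so the
    images of the end points have to be exchanged.\<close>
  define a' b' where "a' = (if m > 0 then m * a + k else m * b + k)"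
    and "b' = (if m > 0 then m * b + k else m * a + k)"
  have im: "(\<lambda>t. m * t + k) ` {a..b} = {a'..b'}"
    using image_affinity_atLeastAtMost[of m k a b] ab m by (auto simp: a'_def b'_def)
  have "a' < b'" using ab m by (auto simp: a'_def b'_def)
  moreover have "0 \<le> a'" "b' \<le> 1" using h[of a] h[of b] ab by (auto simp: a'_def b'_def)
  moreover have "\<gamma> ` {a'..b'} \<subseteq> chart_dom c"
    unfolding im[symmetric] image_image using dom eq by (auto simp: image_subset_iff)
  ultimately have "(coord c \<circ> \<gamma>) piecewise_C1_differentiable_on (\<lambda>t. m * t + k) ` {a..b}"
    unfolding im using \<gamma> c by (auto simp: pw_C1_curve_def)
  from piecewise_C1_differentiable_affine[OF this] show ?thesis
    by (rule piecewise_C1_differentiable_on_cong) (simp add: eq)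
qed

lemma pw_C1_curve_affine:
  assumes \<gamma>: "pw_C1_curve A \<gamma>" and m: "m \<noteq> 0" and h: "\<And>t. t \<in> {0..1} \<Longrightarrow> m * t + k \<in> {0..1}"
  shows "pw_C1_curve A (\<lambda>t. \<gamma> (m * t + k))"
  unfolding pw_C1_curve_def
proof (intro conjI ballI allI impI)
  have "continuous_on {0..1} \<gamma>" using \<gamma> by (simp add: pw_C1_curve_def)
  then show "continuous_on {0..1} (\<lambda>t. \<gamma> (m * t + k))"
  proof (rule continuous_on_compose2)
    show "continuous_on {0..1} (\<lambda>t. m * t + k)" by (intro continuous_intros)
    show "(\<lambda>t. m * t + k) ` {0..1} \<subseteq> {0..1}" using h by (rule image_subsetI)
  qed
  fix c a b assume "c \<in> A"
    and ab: "0 \<le> a \<and> a < b \<and> b \<le> 1 \<and> (\<lambda>t. \<gamma> (m * t + k)) ` {a..b} \<subseteq> chart_dom c"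
  have h': "m * t + k \<in> {0..1}" if "t \<in> {a..b}" for t by (rule h) (use ab that in auto)
  show "(coord c \<circ> (\<lambda>t. \<gamma> (m * t + k))) piecewise_C1_differentiable_on {a..b}"
    by (rule piecewise_C1_affine_piece[OF \<gamma> \<open>c \<in> A\<close> m _ h']) (use ab in auto)
qed

text \<open>The factor \<open>\<bar>m\<bar>\<close> in the speed cancels against the substitution
  rule. Preimages of exceptional points are finite in number and hence form a null set.\<close>

lemma curve_length_affine:
  assumes \<gamma>: "pw_C1_curve A \<gamma>" and m: "m \<noteq> 0" and h: "\<And>t. t \<in> {0..1} \<Longrightarrow> m * t + k \<in> {0..1}"
    and im: "(\<lambda>t. m * t + k) ` {0..1} = {a..b}"
  shows "curve_length A g (\<lambda>t. \<gamma> (m * t + k)) = length_on \<gamma> a b"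
proof -
  obtain S where S: "finite S" "\<And>t. t \<in> {0<..<1} - S \<Longrightarrow> regular_at \<gamma> t"
    "continuous_on ({0<..<1} - S) (speed A g \<gamma>)"
    by (rule curve_regular[OF \<gamma>]) (rule that)
  let ?V = "{0<..<1} - S"
  have ab: "0 \<le> a" "a \<le> b" "b \<le> 1"
  proof -
    have "{a..b} \<subseteq> {0..1}" unfolding im[symmetric] using h by (rule image_subsetI)
    moreover have "{a..b} \<noteq> {}" unfolding im[symmetric] by simp
    ultimately show "0 \<le> a" "a \<le> b" "b \<le> 1" by auto
  qed
  have "(\<lambda>t. m * t + k) -` (S \<union> {0, 1}) \<in> null_sets lborel"
    using m S(1) by (intro finite_imp_null_set_lborel finite_vimageI) (auto simp: inj_on_def)
  then have "AE t in lborel. t \<notin> (\<lambda>t. m * t + k) -` (S \<union> {0, 1})" by (rule AE_not_in)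
  then have ae: "AE t in lborel. ennreal (speed A g (\<lambda>t. \<gamma> (m * t + k)) t) * indicator {0..1} t
      = ennreal \<bar>m\<bar> * (ennreal (indicator ?V (k + m * t) * speed A g \<gamma> (k + m * t)) * indicator {a..b} (k + m * t))"
  proof eventually_elim
    case (elim t)
    show ?case
    proof (cases "t \<in> {0..1}")
      case True
      then have "k + m * t \<in> {a..b}" unfolding im[symmetric] by (intro image_eqI[of _ _ t]) simp_all
      moreover have V: "m * t + k \<in> ?V" using elim h[OF True] by auto
      ultimately show ?thesis
        using True speed_affine[OF S(2)[OF V]] by (simp add: add.commute ennreal_mult')
    next
      case False
      have "k + m * t \<notin> {a..b}"
      proof
        assume "k + m * t \<in> {a..b}"
        then obtain s where "s \<in> {0..1}" "m * s + k = m * t + k" unfolding im[symmetric] by (auto simp: add.commute)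
        then show False using False m by simp
      qed
      then show ?thesis using False by simp
    qed
  qed
  let ?F = "\<lambda>t. ennreal (indicator ?V t * speed A g \<gamma> t) * indicator {a..b} t"
  have mF: "?F \<in> borel_measurable borel"
    using regular_speed_measurable[OF S(1,3)] by measurable
  have "curve_length A g (\<lambda>t. \<gamma> (m * t + k)) = (\<integral>\<^sup>+ t. ennreal \<bar>m\<bar> * ?F (k + m * t) \<partial>lborel)"
    unfolding curve_length_def by (rule nn_integral_cong_AE[OF ae])
  also have "\<dots> = ennreal \<bar>m\<bar> * (\<integral>\<^sup>+ t. ?F (k + m * t) \<partial>lborel)"
    by (rule nn_integral_cmult) (use mF in measurable)
  also have "\<dots> = (\<integral>\<^sup>+ t. ?F t \<partial>lborel)"
    by (rule nn_integral_real_affine[OF mF m, symmetric])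
  also have "\<dots> = length_on \<gamma> a b"
    by (rule length_on_restrict[OF S(1) ab(1,3), symmetric])
  finally show ?thesis .
qed

lemma pw_C1_curve_join:
  assumes \<gamma>: "pw_C1_curve A \<gamma>1" "pw_C1_curve A \<gamma>2" and eq: "\<gamma>1 1 = \<gamma>2 0"
  shows "pw_C1_curve A (\<gamma>1 +++ \<gamma>2)"
  unfolding pw_C1_curve_def
proof (intro conjI ballI allI impI)
  have "path \<gamma>1" "path \<gamma>2" using \<gamma> by (auto simp: pw_C1_curve_def path_def)
  then have "path (\<gamma>1 +++ \<gamma>2)" using eq by (simp add: pathfinish_def pathstart_def)
  then show "continuous_on {0..1} (\<gamma>1 +++ \<gamma>2)" by (simp add: path_def)
  fix c a b assume c: "c \<in> A"
    and ab: "0 \<le> a \<and> a < b \<and> b \<le> 1 \<and> (\<gamma>1 +++ \<gamma>2) ` {a..b} \<subseteq> chart_dom c"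
  let ?f = "coord c \<circ> (\<gamma>1 +++ \<gamma>2)"
  have left: "?f piecewise_C1_differentiable_on {a..min b (1/2)}" if "a < 1/2"
    by (rule piecewise_C1_affine_piece[OF \<gamma>(1) c, of 2 _ _ 0])
      (use ab that in \<open>auto simp: joinpaths_def image_subset_iff\<close>)
  have right: "?f piecewise_C1_differentiable_on {max a (1/2)..b}" if "1/2 < b"
  proof (rule piecewise_C1_affine_piece[OF \<gamma>(2) c, of 2 _ _ "-1"])
    fix t assume t: "t \<in> {max a (1/2)..b}"
    show "2 * t + - 1 \<in> {0..1}" using t ab by auto
    \<comment> \<open>At the midpoint \<open>joinpaths\<close> still follows the first path, so
      there the meeting of the end points is needed.\<close>
    show "(\<gamma>1 +++ \<gamma>2) t = \<gamma>2 (2 * t + - 1)"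
    proof (cases "t = 1/2")
      case True
      show ?thesis unfolding True using eq by (simp add: joinpaths_def)
    qed (use t in \<open>auto simp: joinpaths_def\<close>)
  qed (use ab that in \<open>auto simp: image_subset_iff\<close>)
  consider "b \<le> 1/2" | "1/2 \<le> a" | "a < 1/2" "1/2 < b" by linarith
  then show "?f piecewise_C1_differentiable_on {a..b}"
  proof cases
    case 1
    then show ?thesis using left ab by (simp add: min_absorb1)
  next
    case 2
    then show ?thesis using right ab by (simp add: max_absorb1)
  next
    case 3
    have "F piecewise_C1_differentiable_on {a..b}"
      if "F piecewise_C1_differentiable_on {a..1/2}" "F piecewise_C1_differentiable_on {1/2..b}"
      for F :: "real \<Rightarrow> real^'n"
      using piecewise_C1_differentiable_cases[of F a "1/2" F b] that 3 by simp
    then show ?thesis using left right 3 by simp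
  qed
qed

text \<open>At 0 and 1 the two-sided derivative sees values outside the unit interval, where the
  curves may differ. These two points form a null set; at interior points the curves agree
  nearby.\<close>

lemma curve_length_cong:
  assumes "\<And>t. t \<in> {0..1} \<Longrightarrow> \<gamma> t = \<gamma>' t"
  shows "curve_length A g \<gamma> = curve_length A g \<gamma>'"
  unfolding curve_length_def
proof (rule nn_integral_cong_AE)
  have "{0, 1::real} \<in> null_sets lborel"
    by (intro finite_imp_null_set_lborel) auto
  then have "AE t in lborel. t \<notin> {0, 1::real}" by (rule AE_not_in)
  then show "AE t in lborel. ennreal (speed A g \<gamma> t) * indicator {0..1} t
      = ennreal (speed A g \<gamma>' t) * indicator {0..1} t"
  proof eventually_elim
    case (elim t)
    show ?case
    proof (cases "t \<in> {0..1}")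
      case True
      then have "t \<in> {0<..<1}" using elim by auto
      then have "\<forall>\<^sub>F s in nhds t. s \<in> {0<..<1}" by (intro eventually_nhds_in_open) auto
      then have "\<forall>\<^sub>F s in nhds t. (coord c \<circ> \<gamma>) s = (coord c \<circ> \<gamma>') s" for c :: "('a, 'n) chart"
        by eventually_elim (use assms in auto)
      then have "vector_derivative (coord c \<circ> \<gamma>) (at t) = vector_derivative (coord c \<circ> \<gamma>') (at t)" for c :: "('a, 'n) chart"
        using True assms by (intro vector_derivative_cong_eq) (auto simp: eventually_at_filter elim: eventually_mono)
      moreover have "\<gamma> t = \<gamma>' t" using True assms by simp
      ultimately show ?thesis unfolding speed_def Let_def by simp
    qed simp
  qed
qed

lemma curve_length_join:
  assumes \<gamma>: "pw_C1_curve A \<gamma>1" "pw_C1_curve A \<gamma>2" and eq: "\<gamma>1 1 = \<gamma>2 0"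
  shows "curve_length A g (\<gamma>1 +++ \<gamma>2) = curve_length A g \<gamma>1 + curve_length A g \<gamma>2"
proof -
  let ?\<gamma> = "\<gamma>1 +++ \<gamma>2"
  note j = pw_C1_curve_join[OF assms]
  have "curve_length A g \<gamma>1 = curve_length A g (\<lambda>t. ?\<gamma> ((1/2) * t + 0))"
    by (rule curve_length_cong) (auto simp: joinpaths_def)
  also have "\<dots> = length_on ?\<gamma> 0 (1/2)"
    by (rule curve_length_affine[OF j]) (use image_affinity_atLeastAtMost[of "1/2" 0 0 1] in auto)
  finally have 1: "curve_length A g \<gamma>1 = length_on ?\<gamma> 0 (1/2)" .
  have "curve_length A g \<gamma>2 = curve_length A g (\<lambda>t. ?\<gamma> ((1/2) * t + 1/2))"
    by (rule curve_length_cong) (use eq in \<open>auto simp: joinpaths_def field_simps\<close>)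
  also have "\<dots> = length_on ?\<gamma> (1/2) 1"
    by (rule curve_length_affine[OF j]) (use image_affinity_atLeastAtMost[of "1/2" "1/2" 0 1] in auto)
  finally have 2: "curve_length A g \<gamma>2 = length_on ?\<gamma> (1/2) 1" .
  show ?thesis
    unfolding 1 2 curve_length_eq[of ?\<gamma>] by (rule length_on_add[OF j]) auto
qed

text \<open>The distance \<open>riem_dist\<close> sends an infinite infimum to \<open>0\<close>, so the metric axioms are
  first established for the extended distance.\<close>

definition ldist :: "'a \<Rightarrow> 'a \<Rightarrow> ennreal" where
  "ldist p q = (INF \<gamma>\<in>{\<gamma>. pw_C1_curve A \<gamma> \<and> \<gamma> 0 = p \<and> \<gamma> 1 = q}. curve_length A g \<gamma>)"

lemma riem_dist_eq: "riem_dist A g p q = enn2real (ldist p q)"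
  by (simp add: riem_dist_def ldist_def)

lemma ldist_le: "pw_C1_curve A \<gamma> \<Longrightarrow> \<gamma> 0 = p \<Longrightarrow> \<gamma> 1 = q \<Longrightarrow> ldist p q \<le> curve_length A g \<gamma>"
  unfolding ldist_def by (rule INF_lower) simp

lemma ldist_lessE:
  assumes "ldist p q < r"
  obtains \<gamma> where "pw_C1_curve A \<gamma>" "\<gamma> 0 = p" "\<gamma> 1 = q" "curve_length A g \<gamma> < r"
  using assms unfolding ldist_def INF_less_iff by blast

lemma ldist_triangle: "ldist p r \<le> ldist p q + ldist q r"
proof (rule ennreal_le_epsilon)
  fix e :: real assume fin: "ldist p q + ldist q r < top" and e: "0 < e"
  have less1: "a < a + ennreal (e/2)" if "a \<noteq> top" for a
    using that e ennreal_add_left_cancel_less[of a 0 "ennreal (e/2)"] by (simp add: ennreal_zero_less_divide)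
  obtain \<gamma>1 where 1: "pw_C1_curve A \<gamma>1" "\<gamma>1 0 = p" "\<gamma>1 1 = q" "curve_length A g \<gamma>1 < ldist p q + ennreal (e/2)"
    by (rule ldist_lessE[OF less1[of "ldist p q"]]) (use fin in \<open>auto simp: ennreal_add_eq_top less_top\<close>)
  obtain \<gamma>2 where 2: "pw_C1_curve A \<gamma>2" "\<gamma>2 0 = q" "\<gamma>2 1 = r" "curve_length A g \<gamma>2 < ldist q r + ennreal (e/2)"
    by (rule ldist_lessE[OF less1[of "ldist q r"]]) (use fin in \<open>auto simp: ennreal_add_eq_top less_top\<close>)
  have "ldist p r \<le> curve_length A g (\<gamma>1 +++ \<gamma>2)"
    by (rule ldist_le[OF pw_C1_curve_join]) (use 1 2 in \<open>auto simp: joinpaths_def\<close>)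
  also have "\<dots> = curve_length A g \<gamma>1 + curve_length A g \<gamma>2"
    by (rule curve_length_join) (use 1 2 in auto)
  also have "\<dots> \<le> (ldist p q + ennreal (e/2)) + (ldist q r + ennreal (e/2))"
    using 1 2 by (intro add_mono) auto
  also have "\<dots> = ldist p q + ldist q r + (ennreal (e/2) + ennreal (e/2))" by (simp add: ac_simps)
  also have "ennreal (e/2) + ennreal (e/2) = ennreal e" using e by (simp flip: ennreal_plus)
  finally show "ldist p r \<le> ldist p q + ldist q r + ennreal e" .
qed

lemma ldist_le_commute: "ldist q p \<le> ldist p q"
  unfolding ldist_def[of p q]
proof (rule INF_greatest)
  fix \<gamma> assume "\<gamma> \<in> {\<gamma>. pw_C1_curve A \<gamma> \<and> \<gamma> 0 = p \<and> \<gamma> 1 = q}"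
  then have \<gamma>: "pw_C1_curve A \<gamma>" "\<gamma> 0 = p" "\<gamma> 1 = q" by auto
  have "curve_length A g (\<lambda>t. \<gamma> ((-1) * t + 1)) = curve_length A g \<gamma>"
    unfolding curve_length_eq[of \<gamma>]
    by (rule curve_length_affine[OF \<gamma>(1)]) (use image_affinity_atLeastAtMost[of "-1" 1 0 "1::real"] in auto)
  moreover have "pw_C1_curve A (\<lambda>t. \<gamma> ((-1) * t + 1))"
    by (rule pw_C1_curve_affine[OF \<gamma>(1)]) auto
  ultimately show "ldist q p \<le> curve_length A g \<gamma>"
    using ldist_le[of "\<lambda>t. \<gamma> ((-1) * t + 1)" q p] \<gamma> by auto
qed

lemma ldist_commute: "ldist p q = ldist q p"
  by (rule antisym) (rule ldist_le_commute)+

text \<open>Reparametrised over the unit interval, both arcs compete in the infima. Together with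
  the intermediate value theorem this yields the points between \<open>p\<close> and
  \<open>q\<close> that the Hopf-Rinow argument needs.\<close>

lemma ldist_split:
  assumes \<gamma>: "pw_C1_curve A \<gamma>" and t: "t \<in> {0<..<1}"
  shows "ldist (\<gamma> 0) (\<gamma> t) + ldist (\<gamma> t) (\<gamma> 1) \<le> curve_length A g \<gamma>"
proof -
  have "pw_C1_curve A (\<lambda>s. \<gamma> (t * s + 0))"
    by (rule pw_C1_curve_affine[OF \<gamma>]) (use t in \<open>auto simp: mult_le_one\<close>)
  then have "ldist (\<gamma> 0) (\<gamma> t) \<le> curve_length A g (\<lambda>s. \<gamma> (t * s + 0))"
    by (rule ldist_le) auto
  also have "\<dots> = length_on \<gamma> 0 t"
    by (rule curve_length_affine[OF \<gamma>])
      (use t image_affinity_atLeastAtMost[of t 0 0 1] in \<open>auto simp: mult_le_one\<close>)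
  finally have 1: "ldist (\<gamma> 0) (\<gamma> t) \<le> length_on \<gamma> 0 t" .
  have h: "(1 - t) * s + t \<in> {0..1}" if "s \<in> {0..1}" for s
  proof -
    have "(1 - t) * s \<le> 1 - t" using that t mult_left_le[of s "1 - t"] by auto
    moreover have "0 \<le> (1 - t) * s" using that t by auto
    ultimately show ?thesis using t unfolding atLeastAtMost_iff greaterThanLessThan_iff by linarith
  qed
  have "pw_C1_curve A (\<lambda>s. \<gamma> ((1 - t) * s + t))"
    by (rule pw_C1_curve_affine[OF \<gamma>]) (use t h in auto)
  then have "ldist (\<gamma> t) (\<gamma> 1) \<le> curve_length A g (\<lambda>s. \<gamma> ((1 - t) * s + t))"
    by (rule ldist_le) auto
  also have "\<dots> = length_on \<gamma> t 1"
    by (rule curve_length_affine[OF \<gamma>]) (use t h image_affinity_atLeastAtMost[of "1 - t" t 0 1] in auto)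
  finally have 2: "ldist (\<gamma> t) (\<gamma> 1) \<le> length_on \<gamma> t 1" .
  show ?thesis
    unfolding curve_length_eq using length_on_add[OF \<gamma>, of 0 t 1] t add_mono[OF 1 2] by simp
qed

text \<open>The straight segment in the chart is a competitor. In another chart it becomes a
  transition map along a line, hence continuously differentiable, and its speed at \<open>z\<close>
  is \<open>gnorm c z (y - x)\<close>.\<close>

lemma ldist_segment:
  assumes c: "c \<in> A" and seg: "closed_segment x y \<subseteq> chart_img c"
    and K: "\<And>z. z \<in> closed_segment x y \<Longrightarrow> gnorm c z (y - x) \<le> K"
  shows "ldist (param c x) (param c y) \<le> ennreal K"
proof -
  define l where "l t = x + t *\<^sub>R (y - x)" for t :: real
  define \<gamma> where "\<gamma> t = param c (l t)" for t
  have lseg: "l t \<in> closed_segment x y" if "t \<in> {0..1}" for t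
    using that by (auto simp: l_def in_segment algebra_simps intro!: exI[of _ t])
  have limg: "l t \<in> chart_img c" if "t \<in> {0..1}" for t using lseg[OF that] seg by blast
  have dl: "(l has_vector_derivative (y - x)) (at t)" for t :: real
    unfolding l_def by (auto intro!: derivative_eq_intros)
  have cont: "isCont \<gamma> t" if "t \<in> {0..1}" for t
    unfolding \<gamma>_def
  proof (rule isCont_o2[where f = l and g = "param c" and a = t])
    show "isCont l t" unfolding l_def by (intro continuous_intros)
    show "isCont (param c) (l t)"
      using continuous_on_param[OF c] open_chart_img[OF c] limg[OF that] continuous_on_eq_continuous_at by blast
  qed
  have deriv: "((coord d \<circ> \<gamma>) has_vector_derivative frechet_derivative (transition c d) (at (l t)) (y - x)) (at t)"
    if "d \<in> A" "t \<in> {0..1}" "\<gamma> t \<in> chart_dom d" for d t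
  proof -
    have "l t \<in> overlap c d" using limg[OF that(2)] that(3) overlap_eq[OF c] by (auto simp: \<gamma>_def)
    then have D: "(transition c d has_derivative frechet_derivative (transition c d) (at (l t))) (at (l t))"
      by (rule C1_on_has_derivative[OF smooth_on_imp_C1_on[OF smooth_on_transition[OF c that(1)]]])
    have "((\<lambda>t. transition c d (l t)) has_derivative
        (\<lambda>s. frechet_derivative (transition c d) (at (l t)) (s *\<^sub>R (y - x)))) (at t)"
      by (rule has_derivative_compose[OF dl[unfolded has_vector_derivative_def] D])
    then have "((\<lambda>t. transition c d (l t)) has_vector_derivative
        frechet_derivative (transition c d) (at (l t)) (y - x)) (at t)"
      unfolding has_vector_derivative_def linear_cmul[OF has_derivative_linear[OF D]] .
    then show ?thesis
      by (simp add: transition_def \<gamma>_def o_def)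
  qed
  have "pw_C1_curve A \<gamma>"
    unfolding pw_C1_curve_def
  proof (intro conjI ballI allI impI)
    show "continuous_on {0..1} \<gamma>" using cont by (simp add: continuous_at_imp_continuous_on)
    fix d a b assume d: "d \<in> A" and ab: "0 \<le> a \<and> a < b \<and> b \<le> 1 \<and> \<gamma> ` {a..b} \<subseteq> chart_dom d"
    have ov: "l ` {a..b} \<subseteq> overlap c d"
      using limg ab overlap_eq[OF c] by (auto simp: \<gamma>_def image_subset_iff)
    have "continuous_on {a..b} (\<lambda>t. frechet_derivative (transition c d) (at (l t)) (y - x))"
      by (rule C1_on_continuous_derivative_compose[OF smooth_on_imp_C1_on[OF smooth_on_transition[OF c d]] _ ov])
        (auto simp: l_def intro!: continuous_intros)
    then have "(coord d \<circ> \<gamma>) C1_differentiable_on {a..b}"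
      unfolding C1_differentiable_on_def using deriv[OF d] ab by (intro exI conjI ballI) (auto simp: image_subset_iff)
    then show "(coord d \<circ> \<gamma>) piecewise_C1_differentiable_on {a..b}"
      by (rule C1_differentiable_imp_piecewise)
  qed
  then have "ldist (param c x) (param c y) \<le> curve_length A g \<gamma>"
    by (rule ldist_le) (auto simp: \<gamma>_def l_def)
  also have "\<dots> \<le> (\<integral>\<^sup>+ t. ennreal K * indicator {0..1::real} t \<partial>lborel)"
    unfolding curve_length_def
  proof (rule nn_integral_mono)
    fix t :: real
    show "ennreal (speed A g \<gamma> t) * indicator {0..1} t \<le> ennreal K * indicator {0..1} t"
    proof (cases "t \<in> {0..1}")
      case True
      have dom: "\<gamma> t \<in> chart_dom c" unfolding \<gamma>_def using param_in_dom[OF c limg[OF True]] .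
      have "((coord c \<circ> \<gamma>) has_vector_derivative (y - x)) (at t)"
      proof (rule has_vector_derivative_transform_within_open[OF dl])
        show "open (l -` chart_img c)"
          by (rule open_vimage[OF open_chart_img[OF c]]) (auto simp: l_def intro!: continuous_intros)
        show "t \<in> l -` chart_img c" using limg[OF True] by simp
        show "l s = (coord c \<circ> \<gamma>) s" if "s \<in> l -` chart_img c" for s
          using that c by (simp add: \<gamma>_def)
      qed
      from speed_eq[OF c dom cont[OF True] this]
      have "speed A g \<gamma> t = gnorm c (l t) (y - x)"
        using limg[OF True] c by (simp add: \<gamma>_def)
      then show ?thesis using K[OF lseg[OF True]] True by (simp add: ennreal_leI)
    qed simp
  qed
  also have "\<dots> = ennreal K" by (simp add: nn_integral_cmult_indicator)
  finally show ?thesis .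
qed

text \<open>A curve ending outside the coordinate ball has to leave it. Up to the first exit it runs
  in a single chart, where its length is at least \<open>\<delta>\<close> times the Euclidean
  displacement.\<close>

lemma ldist_lower_bound:
  assumes c: "c \<in> A" and s: "0 < s" "cball x0 s \<subseteq> chart_img c"
    and \<delta>: "0 \<le> \<delta>" "\<And>x v. x \<in> cball x0 s \<Longrightarrow> \<delta> * norm v \<le> gnorm c x v"
    and q: "q \<notin> param c ` ball x0 s"
  shows "ennreal (\<delta> * s) \<le> ldist (param c x0) q"
  unfolding ldist_def
proof (rule INF_greatest)
  fix \<gamma> assume "\<gamma> \<in> {\<gamma>. pw_C1_curve A \<gamma> \<and> \<gamma> 0 = param c x0 \<and> \<gamma> 1 = q}"
  then have \<gamma>: "pw_C1_curve A \<gamma>" "\<gamma> 0 = param c x0" "\<gamma> 1 = q" by auto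
  then have cont: "continuous_on {0..1} \<gamma>" by (simp add: pw_C1_curve_def)
  have bsub: "ball x0 s \<subseteq> chart_img c" using s(2) ball_subset_cball by blast
  define U where "U = param c ` ball x0 s"
  have "U = chart_dom c \<inter> coord c -` ball x0 s"
  proof (intro set_eqI iffI)
    fix p assume "p \<in> chart_dom c \<inter> coord c -` ball x0 s"
    then show "p \<in> U" unfolding U_def using param_coord[OF c] by (intro image_eqI[of _ _ "coord c p"]) auto
  qed (use bsub c param_in_dom[OF c] coord_param[OF c] in \<open>auto simp: U_def subset_iff\<close>)
  then have U: "open U" using open_coord_vimage[OF c open_ball] by simp
  have "compact (param c ` cball x0 s)"
    by (rule compact_continuous_image[OF continuous_on_subset[OF continuous_on_param[OF c] s(2)] compact_cball])
  then have Kcl: "closed (param c ` cball x0 s)" by (rule compact_imp_closed)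
  \<comment> \<open>These are the times spent outside the open set \<open>U\<close>. They form a
    compact set, so there is a first exit time \<open>\<tau>\<close>.\<close>
  define C where "C = {0..1} \<inter> \<gamma> -` (- U)"
  have "closed C" unfolding C_def
    by (rule continuous_closed_preimage[OF cont]) (use U in auto)
  then have "compact C" unfolding C_def by (metis compact_Icc closed_Int_compact Int_commute Int_left_absorb compact_Int_closed)
  moreover have "1 \<in> C" using \<gamma> q by (auto simp: C_def U_def)
  ultimately obtain \<tau> where \<tau>: "\<tau> \<in> C" "\<And>t. t \<in> C \<Longrightarrow> \<tau> \<le> t"
    using compact_attains_inf by (metis empty_iff)
  have "0 \<notin> C" using \<gamma> s by (auto simp: C_def U_def)
  then have \<tau>01: "0 < \<tau>" "\<tau> \<le> 1" using \<tau>(1) by (auto simp: C_def less_le)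
  have below: "\<gamma> t \<in> U" if "0 \<le> t" "t < \<tau>" for t
    using \<tau>(2)[of t] that \<tau>01 by (force simp: C_def)
  \<comment> \<open>At time \<open>\<tau>\<close> the open ball has been left, but the image of the
    closed ball is closed and still contains the curve; hence the chart covers the whole arc over
    \<open>{0..\<tau>}\<close>.\<close>
  have "closed ({0..1} \<inter> \<gamma> -` (param c ` cball x0 s))"
    by (rule continuous_closed_preimage[OF cont _ Kcl]) auto
  moreover have "{0..<\<tau>} \<subseteq> {0..1} \<inter> \<gamma> -` (param c ` cball x0 s)"
    using below \<tau>01 ball_subset_cball[of x0 s] by (fastforce simp: U_def)
  ultimately have "closure {0..<\<tau>} \<subseteq> {0..1} \<inter> \<gamma> -` (param c ` cball x0 s)"
    by (rule closure_minimal[rotated])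
  then have inK: "\<gamma> t \<in> param c ` cball x0 s" if "t \<in> {0..\<tau>}" for t
    using that \<tau>01 by (auto simp: closure_atLeastLessThan)
  then have dom: "\<gamma> ` {0..\<tau>} \<subseteq> chart_dom c"
  proof (intro image_subsetI)
    fix t assume "t \<in> {0..\<tau>}"
    then obtain x where "x \<in> cball x0 s" "\<gamma> t = param c x" using inK by blast
    then show "\<gamma> t \<in> chart_dom c" using s(2) param_in_dom[OF c] by auto
  qed
  have cb: "coord c (\<gamma> t) \<in> cball x0 s" if t: "t \<in> {0..\<tau>}" for t
  proof -
    obtain x where "x \<in> cball x0 s" "\<gamma> t = param c x" using inK[OF t] by blast
    then show ?thesis using s(2) coord_param[OF c] by auto
  qed
  let ?f = "coord c \<circ> \<gamma>"
  have f: "?f piecewise_C1_differentiable_on {0..\<tau>}"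
    by (rule pw_C1_curveD[OF \<gamma>(1) c]) (use dom \<tau>01 in auto)
  have "coord c (\<gamma> \<tau>) \<notin> ball x0 s"
  proof
    assume "coord c (\<gamma> \<tau>) \<in> ball x0 s"
    then have "param c (coord c (\<gamma> \<tau>)) \<in> U" unfolding U_def by blast
    moreover have "\<gamma> \<tau> \<in> chart_dom c" using dom \<tau>01 by auto
    ultimately show False using \<tau>(1) c by (simp add: C_def)
  qed
  moreover have "coord c (\<gamma> 0) = x0" using \<gamma>(2) s c centre_in_cball by (metis coord_param less_imp_le subsetD)
  ultimately have far: "s \<le> norm (?f \<tau> - ?f 0)"
    by (simp add: dist_norm norm_minus_commute)
  obtain S where S: "finite S" "\<And>t. t \<in> {0<..<1} - S \<Longrightarrow> regular_at \<gamma> t"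
    "continuous_on ({0<..<1} - S) (speed A g \<gamma>)"
    by (rule curve_regular[OF \<gamma>(1)]) (rule that)
  have "ennreal (\<delta> * s) \<le> ennreal (\<delta> * norm (?f \<tau> - ?f 0))"
    using far \<delta>(1) by (intro ennreal_leI mult_left_mono)
  also have "\<dots> \<le> (\<integral>\<^sup>+ t\<in>{0..\<tau>}. ennreal (\<delta> * norm (vector_derivative ?f (at t))) \<partial>lborel)"
    by (rule norm_increment_le_nn_integral[OF f _ \<delta>(1)]) (use \<tau>01 in auto)
  also have "\<dots> \<le> length_on \<gamma> 0 \<tau>"
    unfolding length_on_def
  proof (rule nn_integral_mono_AE)
    have "S \<union> {0, \<tau>, 1} \<in> null_sets lborel"
      using S by (intro finite_imp_null_set_lborel) auto
    then have "AE t in lborel. t \<notin> S \<union> {0, \<tau>, 1}" by (rule AE_not_in)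
    then show "AE t in lborel. ennreal (\<delta> * norm (vector_derivative ?f (at t))) * indicator {0..\<tau>} t
        \<le> ennreal (speed A g \<gamma> t) * indicator {0..\<tau>} t"
    proof eventually_elim
      case (elim t)
      show ?case
      proof (cases "t \<in> {0..\<tau>}")
        case True
        then have t: "t \<in> {0<..<1} - S" using elim \<tau>01 by auto
        obtain d w where d: "d \<in> A" "\<gamma> t \<in> chart_dom d" "((coord d \<circ> \<gamma>) has_vector_derivative w) (at t)"
          and ct: "isCont \<gamma> t"
          using S(2)[OF t] by (auto simp: regular_at_def vector_derivative_works)
        have dc: "\<gamma> t \<in> chart_dom c" using dom True by auto
        note v = coord_curve_has_vector_derivative[where \<gamma> = \<gamma> and t = t, OF d(1,2) c dc ct d(3)]
        have "speed A g \<gamma> t = gnorm c (coord c (\<gamma> t)) (vector_derivative ?f (at t))"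
          using speed_eq[where \<gamma> = \<gamma> and t = t, OF c dc ct v] vector_derivative_at[OF v] by simp
        then have "\<delta> * norm (vector_derivative ?f (at t)) \<le> speed A g \<gamma> t"
          using \<delta>(2)[OF cb[OF True]] by simp
        then show ?thesis using True by (simp add: ennreal_leI)
      qed simp
    qed
  qed
  also have "\<dots> \<le> length_on \<gamma> 0 1"
    unfolding length_on_def by (rule nn_integral_mono) (use \<tau>01 in \<open>auto simp: indicator_def\<close>)
  finally show "ennreal (\<delta> * s) \<le> curve_length A g \<gamma>" by (simp add: curve_length_eq)
qed

end

section \<open>The Riemannian metric space\<close>

text \<open>The Hopf-Rinow argument without geodesics: \<open>mid\<close> only says that distances
  can be split approximately. If the radii of compact closed balls around \<open>p\<close> had a
  finite supremum \<open>\<rho>\<close>, the ball of radius \<open>\<rho>\<close> would be close to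
  smaller compact balls, hence totally bounded and, by completeness, compact. Finitely many compact
  balls around its points would then cover a slightly larger ball.\<close>

lemma (in Metric_space) compactin_mcball:
  assumes comp: mcomplete
    and loc: "\<And>x. x \<in> M \<Longrightarrow> \<exists>r>0. compactin mtopology (mcball x r)"
    and mid: "\<And>p q r s. p \<in> M \<Longrightarrow> q \<in> M \<Longrightarrow> 0 < r \<Longrightarrow> 0 < s \<Longrightarrow> d p q < r + s \<Longrightarrow>
      \<exists>z\<in>M. d p z < r \<and> d z q < s"
    and p: "p \<in> M"
  shows "compactin mtopology (mcball p r)"
proof (rule ccontr)
  define P where "P r = compactin mtopology (mcball p r)" for r
  assume "\<not> compactin mtopology (mcball p r)"
  then have r: "\<not> P r" by (simp add: P_def)
  have mono: "P s" if "P t" "s \<le> t" for s t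
    using that closed_compactin[of mtopology "mcball p t" "mcball p s"] mcball_subset_concentric[of s t p]
    by (auto simp: P_def)
  have bdd: "bdd_above {s. P s}"
    using mono r by (intro bdd_aboveI[of _ r]) (metis linear mem_Collect_eq)
  obtain r1 where r1: "r1 > 0" "P r1" using loc[OF p] by (auto simp: P_def)
  define \<rho> where "\<rho> = Sup {s. P s}"
  have \<rho>: "\<rho> \<ge> r1" unfolding \<rho>_def using bdd r1 by (intro cSup_upper) auto
  have below: "P s" if "s < \<rho>" for s
    using less_cSupD[of "{s. P s}" s] that r1 mono unfolding \<rho>_def by (metis empty_iff less_imp_le mem_Collect_eq)
  have "mtotally_bounded (mcball p \<rho>)"
    unfolding mtotally_bounded_def
  proof (intro allI impI)
    fix e :: real assume e: "e > 0"
    \<comment> \<open>The net in the smaller ball uses up \<open>e / 2\<close>, and the step to it,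
      of length below \<open>2 * \<eta>\<close>, the other half. The step is not
      \<open>\<eta>\<close> because \<open>mid\<close> asks for a strict inequality;
      \<open>\<rho> / 2\<close> keeps \<open>\<rho> - \<eta>\<close> positive.\<close>
    define \<eta> where "\<eta> = min (e / 4) (\<rho> / 2)"
    have \<eta>: "\<eta> > 0" "2 * \<eta> \<le> e / 2" "0 < \<rho> - \<eta>" "\<rho> - \<eta> < \<rho>" using e \<rho> r1 by (auto simp: \<eta>_def)
    have "mtotally_bounded (mcball p (\<rho> - \<eta>))"
      using below[OF \<eta>(4)] compactin_imp_mtotally_bounded by (simp add: P_def)
    then obtain K where K: "finite K" "K \<subseteq> mcball p (\<rho> - \<eta>)" "mcball p (\<rho> - \<eta>) \<subseteq> (\<Union>x\<in>K. mball x (e/2))"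
      using e unfolding mtotally_bounded_def by (metis half_gt_zero)
    have "mcball p \<rho> \<subseteq> (\<Union>x\<in>K. mball x e)"
    proof
      fix q assume q: "q \<in> mcball p \<rho>"
      then have "d p q < (\<rho> - \<eta>) + 2 * \<eta>" using \<eta>(1) by auto
      then obtain z where z: "z \<in> M" "d p z < \<rho> - \<eta>" "d z q < 2 * \<eta>"
        using mid[of p q "\<rho> - \<eta>" "2 * \<eta>"] q \<eta> by auto
      then have "z \<in> mcball p (\<rho> - \<eta>)" using p by simp
      then obtain x where x: "x \<in> K" "z \<in> mball x (e/2)" using K(3) by blast
      then have "d x q < e" using triangle[of x z q] z q \<eta> by auto
      then show "q \<in> (\<Union>x\<in>K. mball x e)" using x q by auto
    qed
    moreover have "K \<subseteq> mcball p \<rho>" using K(2) mcball_subset_concentric[of "\<rho> - \<eta>" \<rho> p] \<eta> by auto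
    ultimately show "\<exists>K. finite K \<and> K \<subseteq> mcball p \<rho> \<and> mcball p \<rho> \<subseteq> (\<Union>x\<in>K. mball x e)"
      using K(1) by blast
  qed
  then have "compactin mtopology (mtopology closure_of mcball p \<rho>)"
    using mtotally_bounded_eq_compact_closure_of[OF comp] by blast
  then have C: "compactin mtopology (mcball p \<rho>)" by (simp add: closure_of_closedin)
  obtain R where R: "\<And>x. x \<in> M \<Longrightarrow> R x > 0" "\<And>x. x \<in> M \<Longrightarrow> compactin mtopology (mcball x (R x))"
    using loc by metis
  have "\<exists>F. finite F \<and> F \<subseteq> (\<lambda>x. mball x (R x / 2)) ` mcball p \<rho> \<and> mcball p \<rho> \<subseteq> \<Union> F"
  proof (rule compactinD[OF C])
    show "mcball p \<rho> \<subseteq> \<Union> ((\<lambda>x. mball x (R x / 2)) ` mcball p \<rho>)"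
    proof
      fix x assume x: "x \<in> mcball p \<rho>"
      then have "x \<in> mball x (R x / 2)" using R(1)[of x] by simp
      then show "x \<in> \<Union> ((\<lambda>x. mball x (R x / 2)) ` mcball p \<rho>)" using x by blast
    qed
  qed auto
  then obtain F' where F': "finite F'" "F' \<subseteq> (\<lambda>x. mball x (R x / 2)) ` mcball p \<rho>" "mcball p \<rho> \<subseteq> \<Union> F'"
    by blast
  obtain F where F: "F \<subseteq> mcball p \<rho>" "finite F" "F' = (\<lambda>x. mball x (R x / 2)) ` F"
    using finite_subset_image[OF F'(1,2)] by blast
  have cover: "mcball p \<rho> \<subseteq> (\<Union>x\<in>F. mball x (R x / 2))" using F'(3) F(3) by simp
  have FM: "F \<subseteq> M" using F(1) by auto
  have "p \<in> mcball p \<rho>" using p \<rho> r1 by simp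
  then have "F \<noteq> {}" using cover by blast
  \<comment> \<open>A step shorter than \<open>\<delta>\<close> from a ball of half radius stays
    within the full radius \<open>R x\<close>. The ball is enlarged by \<open>\<delta> / 2\<close>
    only, again because \<open>mid\<close> is strict.\<close>
  define \<delta> where "\<delta> = Min ((\<lambda>x. R x / 2) ` F)"
  have \<delta>: "\<delta> > 0"
    using F(2) \<open>F \<noteq> {}\<close> FM R(1) by (auto simp: \<delta>_def)
  have \<delta>_le: "\<delta> \<le> R x / 2" if "x \<in> F" for x
    unfolding \<delta>_def by (rule Min_le) (use F(2) that in auto)
  have sub: "mcball p (\<rho> + \<delta> / 2) \<subseteq> (\<Union>x\<in>F. mcball x (R x))"
  proof
    fix q assume q: "q \<in> mcball p (\<rho> + \<delta> / 2)"
    then have "d p q < \<rho> + \<delta>" using \<delta> by auto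
    then obtain z where z: "z \<in> M" "d p z < \<rho>" "d z q < \<delta>"
      using mid[of p q \<rho> \<delta>] q \<delta> \<rho> r1 by auto
    then have "z \<in> mcball p \<rho>" using p by simp
    then obtain x where x: "x \<in> F" "z \<in> mball x (R x / 2)" using cover by blast
    then have "d x q \<le> R x" using triangle[of x z q] z q \<delta>_le[OF x(1)] by auto
    then show "q \<in> (\<Union>x\<in>F. mcball x (R x))" using x q by auto
  qed
  have "compactin mtopology (\<Union>x\<in>F. mcball x (R x))"
    by (rule compactin_Union) (use F(2) FM R(2) in auto)
  then have "P (\<rho> + \<delta> / 2)"
    unfolding P_def using closed_compactin[OF _ sub] by blast
  then have "\<rho> + \<delta> / 2 \<le> \<rho>" unfolding \<rho>_def using bdd by (intro cSup_upper) auto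
  then show False using \<delta> by simp
qed

section \<open>Metric axioms, agreement of topologies, compactness of closed balls\<close>

context riemannian_manifold
begin

lemma ldist_refl: "ldist p p = 0"
proof -
  obtain c where c: "c \<in> A" "p \<in> chart_dom c" "coord c p \<in> chart_img c" by (rule chart_around)
  have "ldist (param c (coord c p)) (param c (coord c p)) \<le> ennreal 0"
    by (rule ldist_segment[OF c(1)]) (use c in \<open>auto simp: gnorm_def\<close>)
  then show ?thesis using c by simp
qed

lemma ldist_small_near:
  assumes e: "e > 0"
  obtains N where "open N" "p \<in> N" "\<And>q. q \<in> N \<Longrightarrow> ldist p q \<le> ennreal e"
proof -
  obtain c where c: "c \<in> A" "p \<in> chart_dom c" "coord c p \<in> chart_img c" by (rule chart_around)
  define x0 where "x0 = coord c p"
  have x0: "x0 \<in> chart_img c" using c by (simp add: x0_def)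
  obtain r \<delta> K where r: "r > 0" "\<delta> > 0" "K > 0" "cball x0 r \<subseteq> chart_img c"
    "\<And>x v. x \<in> cball x0 r \<Longrightarrow> \<delta> * norm v \<le> gnorm c x v"
    "\<And>x v. x \<in> cball x0 r \<Longrightarrow> gnorm c x v \<le> K * norm v"
    by (rule gnorm_bounds[OF c(1) x0]) (rule that)
  define s where "s = min r (e / K)"
  have s: "s > 0" "s \<le> r" "K * s \<le> e" using r e by (auto simp: s_def min_def field_simps)
  show thesis
  proof (rule that)
    show "open (chart_dom c \<inter> coord c -` ball x0 s)"
      by (rule open_coord_vimage[OF c(1) open_ball])
    show "p \<in> chart_dom c \<inter> coord c -` ball x0 s" using c s by (simp add: x0_def)
    fix q assume q: "q \<in> chart_dom c \<inter> coord c -` ball x0 s"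
    have "x0 \<in> cball x0 s" "coord c q \<in> cball x0 s" using q s by auto
    then have seg: "closed_segment x0 (coord c q) \<subseteq> cball x0 r"
      using closed_segment_subset[OF _ _ convex_cball, of x0 x0 s "coord c q"] s by auto
    have "ldist (param c x0) (param c (coord c q)) \<le> ennreal e"
    proof (rule ldist_segment[OF c(1)])
      show "closed_segment x0 (coord c q) \<subseteq> chart_img c" using seg r(4) by blast
      fix z assume "z \<in> closed_segment x0 (coord c q)"
      then have "gnorm c z (coord c q - x0) \<le> K * norm (coord c q - x0)" using seg r(6) by blast
      also have "\<dots> \<le> K * s" using q r(3) by (intro mult_left_mono) (auto simp: dist_norm norm_minus_commute)
      finally show "gnorm c z (coord c q - x0) \<le> e" using s(3) by simp
    qed
    then show "ldist p q \<le> ennreal e" using q c by (simp add: x0_def)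
  qed
qed

text \<open>The points at finite distance from \<open>p\<close> form an open set with open
  complement, because every point has a neighbourhood within distance 1 of it; connectedness leaves
  the whole manifold. So the value that \<open>enn2real\<close> gives to infinity never occurs in
  \<open>riem_dist\<close>.\<close>

lemma ldist_finite: "ldist p q < top"
proof -
  define S where "S = {q. ldist p q < top}"
  have loc: "\<exists>N. open N \<and> q \<in> N \<and> (\<forall>q'\<in>N. q' \<in> S \<longleftrightarrow> q \<in> S)" for q
  proof -
    obtain N where N: "open N" "q \<in> N" "\<And>q'. q' \<in> N \<Longrightarrow> ldist q q' \<le> ennreal 1"
      by (rule ldist_small_near[OF zero_less_one]) (rule that)
    have step: "b \<in> S" if "a \<in> S" "ldist a b \<le> ennreal 1" for a b
    proof -
      have "ldist p b \<le> ldist p a + ennreal 1"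
        using ldist_triangle[of p b a] that(2) by (meson add_left_mono order_trans)
      also have "\<dots> < top" using that(1) by (simp add: S_def)
      finally show ?thesis by (simp add: S_def)
    qed
    show ?thesis
    proof (intro exI conjI ballI)
      fix q' assume "q' \<in> N"
      then have d: "ldist q q' \<le> ennreal 1" "ldist q' q \<le> ennreal 1"
        using N(3) ldist_commute[of q' q] by simp_all
      show "q' \<in> S \<longleftrightarrow> q \<in> S" using step[OF _ d(1)] step[OF _ d(2)] by blast
    qed (rule N)+
  qed
  have "\<exists>T. open T \<and> q \<in> T \<and> T \<subseteq> S" if "q \<in> S" for q
    using loc[of q] that by blast
  moreover have "\<exists>T. open T \<and> q \<in> T \<and> T \<subseteq> - S" if "q \<in> - S" for q
    using loc[of q] that by blast
  ultimately have S: "open S" "open (- S)"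
    using open_subopen[of S] open_subopen[of "- S"] by simp_all
  have "p \<in> S" by (simp add: S_def ldist_refl)
  then have "- S = {}"
    using connectedD[OF connected_manifold S] by auto
  then show ?thesis by (auto simp: S_def)
qed

lemma ldist_eq: "ldist p q = ennreal (riem_dist A g p q)"
  using ldist_finite by (simp add: riem_dist_eq)

text \<open>This turns the lower bound for curves leaving a coordinate ball into topology: it yields
  the definiteness of the distance and one half of the agreement with the manifold topology.\<close>

lemma ldist_separates:
  assumes U: "open U" "p \<in> U"
  obtains e where "e > 0" "\<And>q. ldist p q < ennreal e \<Longrightarrow> q \<in> U"
proof -
  obtain c where c: "c \<in> A" "p \<in> chart_dom c" "coord c p \<in> chart_img c" by (rule chart_around)
  define x0 where "x0 = coord c p"
  have x0: "x0 \<in> chart_img c" "param c x0 = p" using c by (simp_all add: x0_def)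
  obtain r \<delta> K where r: "r > 0" "\<delta> > 0" "K > 0" "cball x0 r \<subseteq> chart_img c"
    "\<And>x v. x \<in> cball x0 r \<Longrightarrow> \<delta> * norm v \<le> gnorm c x v"
    "\<And>x v. x \<in> cball x0 r \<Longrightarrow> gnorm c x v \<le> K * norm v"
    by (rule gnorm_bounds[OF c(1) x0(1)]) (rule that)
  have "open (chart_img c \<inter> param c -` U)"
    by (rule open_param_vimage[OF c(1) U(1)])
  then obtain t where t: "t > 0" "ball x0 t \<subseteq> chart_img c \<inter> param c -` U"
    using x0 U(2) by (metis IntI open_contains_ball vimageI)
  define s where "s = min r t"
  have s: "s > 0" "s \<le> r" "s \<le> t" using r t by (auto simp: s_def)
  show thesis
  proof (rule that)
    show "\<delta> * s > 0" using s r by simp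
    fix q assume q: "ldist p q < ennreal (\<delta> * s)"
    have "q \<in> param c ` ball x0 s"
    proof (rule ccontr)
      assume "q \<notin> param c ` ball x0 s"
      then have "ennreal (\<delta> * s) \<le> ldist (param c x0) q"
        using s r by (intro ldist_lower_bound[OF c(1)]) auto
      then show False using q x0 by simp
    qed
    then obtain x where x: "x \<in> ball x0 s" "q = param c x" by blast
    then have "x \<in> ball x0 t" using s(3) by simp
    then show "q \<in> U" using t(2) x(2) by auto
  qed
qed

sublocale riem: Metric_space UNIV "riem_dist A g"
proof
  fix x y z
  show "0 \<le> riem_dist A g x y" by (simp add: riem_dist_eq)
  show "riem_dist A g x y = riem_dist A g y x" by (simp add: riem_dist_eq ldist_commute)
  show "riem_dist A g x y = 0 \<longleftrightarrow> x = y"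
  proof
    assume "riem_dist A g x y = 0"
    then have d0: "ldist x y = 0" by (simp add: ldist_eq)
    show "x = y"
    proof (rule ccontr)
      assume "x \<noteq> y"
      then have "open (- {y})" "x \<in> - {y}" by auto
      then obtain e where "e > 0" "\<And>q. ldist x q < ennreal e \<Longrightarrow> q \<in> - {y}"
        by (rule ldist_separates) (rule that)
      from this(2)[of y] this(1) show False using d0 by simp
    qed
  qed (simp add: riem_dist_eq ldist_refl)
  have nn: "0 \<le> riem_dist A g u v" for u v by (simp add: riem_dist_eq)
  have "ennreal (riem_dist A g x z) \<le> ennreal (riem_dist A g x y) + ennreal (riem_dist A g y z)"
    unfolding ldist_eq[symmetric] by (rule ldist_triangle)
  then show "riem_dist A g x z \<le> riem_dist A g x y + riem_dist A g y z"
    using nn by (simp flip: ennreal_plus)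
qed

lemma riem_ball_eq: "riem_ball A g p r = {q. riem_dist A g p q < r}"
  by (auto simp: riem_ball_def riem.in_mball)

lemma riem_ball_subset:
  assumes "open U" "p \<in> U"
  obtains r where "r > 0" "\<And>q. riem_dist A g p q < r \<Longrightarrow> q \<in> U"
proof -
  obtain e where "e > 0" "\<And>q. ldist p q < ennreal e \<Longrightarrow> q \<in> U"
    by (rule ldist_separates[OF assms]) (rule that)
  then show thesis using that[of e] by (simp add: ldist_eq ennreal_less_iff)
qed

lemma openin_riem_mtopology: "openin riem.mtopology U \<longleftrightarrow> open U"
proof
  assume U: "openin riem.mtopology U"
  show "open U"
  proof (subst open_subopen, intro ballI)
    fix p assume "p \<in> U"
    then obtain r where r: "r > 0" "riem.mball p r \<subseteq> U" using U by (auto simp: riem.openin_mtopology)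
    obtain N where N: "open N" "p \<in> N" "\<And>q. q \<in> N \<Longrightarrow> ldist p q \<le> ennreal (r/2)"
      by (rule ldist_small_near[of "r/2"]) (use r that in auto)
    have "q \<in> U" if "q \<in> N" for q
      using N(3)[OF that] r by (auto simp: ldist_eq)
    then show "\<exists>T. open T \<and> p \<in> T \<and> T \<subseteq> U" using N by blast
  qed
next
  assume U: "open U"
  show "openin riem.mtopology U"
    unfolding riem.openin_mtopology
  proof (intro conjI allI impI)
    fix p assume "p \<in> U"
    then obtain r where "r > 0" "\<And>q. riem_dist A g p q < r \<Longrightarrow> q \<in> U"
      by (rule riem_ball_subset[OF U]) (rule that)
    then show "\<exists>r>0. riem.mball p r \<subseteq> U" by (intro exI[of _ r]) auto
  qed auto
qed

lemma riem_mtopology: "riem.mtopology = euclidean"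
  by (simp add: topology_eq openin_riem_mtopology)

lemma continuous_on_riem_dist: "continuous_on UNIV (riem_dist A g p)"
  unfolding continuous_on_open_vimage[OF open_UNIV]
proof (intro allI impI)
  fix B :: "real set" assume B: "open B"
  show "open (riem_dist A g p -` B \<inter> UNIV)"
    unfolding openin_riem_mtopology[symmetric] riem.openin_mtopology
  proof (intro conjI allI impI)
    fix q assume "q \<in> riem_dist A g p -` B \<inter> UNIV"
    then have "riem_dist A g p q \<in> B" by simp
    then obtain r where r: "r > 0" "ball (riem_dist A g p q) r \<subseteq> B" using B open_contains_ball by blast
    have "riem.mball q r \<subseteq> riem_dist A g p -` B"
    proof
      fix q' assume "q' \<in> riem.mball q r"
      then have "\<bar>riem_dist A g p q - riem_dist A g p q'\<bar> < r"
        using riem.triangle[of p q q'] riem.triangle[of p q' q] riem.commute[of q' q] by (auto simp: abs_if)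
      then show "q' \<in> riem_dist A g p -` B" using r(2) by (auto simp: dist_real_def)
    qed
    then show "\<exists>r>0. riem.mball q r \<subseteq> riem_dist A g p -` B \<inter> UNIV" using r(1) by auto
  qed auto
qed

text \<open>On a curve of length \<open>l < r + s\<close>, a point at distance \<open>u\<close> from
  \<open>p\<close> leaves at most \<open>l - u\<close> for the rest, so any \<open>u\<close>
  strictly between \<open>l - s\<close> and \<open>r\<close> will do.\<close>

lemma riem_dist_between:
  assumes r: "0 < r" and s: "0 < s" and pq: "riem_dist A g p q < r + s"
  shows "\<exists>z. riem_dist A g p z < r \<and> riem_dist A g z q < s"
proof (cases "riem_dist A g p q < r")
  case True
  then show ?thesis using s by (intro exI[of _ q]) simp
next
  case False
  have "ldist p q < ennreal (r + s)" using pq by (simp add: ldist_eq ennreal_less_iff)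
  then obtain \<gamma> where \<gamma>: "pw_C1_curve A \<gamma>" "\<gamma> 0 = p" "\<gamma> 1 = q" "curve_length A g \<gamma> < ennreal (r + s)"
    by (rule ldist_lessE) (rule that)
  define l where "l = enn2real (curve_length A g \<gamma>)"
  have "curve_length A g \<gamma> < top" using \<gamma>(4) by (meson ennreal_less_top less_trans)
  then have l: "curve_length A g \<gamma> = ennreal l" "l \<ge> 0" by (simp_all add: l_def)
  have lrs: "l < r + s" using \<gamma>(4) l by (simp add: ennreal_less_iff)
  \<comment> \<open>The middle of the admissible range; the maximum with 0 makes \<open>u\<close>
    positive, so that the point found is not the start of the curve.\<close>
  define u where "u = (max 0 (l - s) + r) / 2"
  have u: "0 < u" "u < r" "l - s < u" using lrs r s by (auto simp: u_def)
  have "continuous_on {0..1} (\<lambda>t. riem_dist A g p (\<gamma> t))"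
    using \<gamma>(1) by (intro continuous_on_compose2[OF continuous_on_riem_dist]) (auto simp: pw_C1_curve_def)
  then obtain t where t: "0 \<le> t" "t \<le> 1" "riem_dist A g p (\<gamma> t) = u"
    using IVT'[of "\<lambda>t. riem_dist A g p (\<gamma> t)" 0 u 1] \<gamma> u False by auto
  then have "t \<noteq> 0" "t \<noteq> 1" using \<gamma> u False by auto
  then have "ldist (\<gamma> 0) (\<gamma> t) + ldist (\<gamma> t) (\<gamma> 1) \<le> curve_length A g \<gamma>"
    using t by (intro ldist_split[OF \<gamma>(1)]) auto
  then have "ennreal (u + riem_dist A g (\<gamma> t) q) \<le> ennreal l"
    using \<gamma> t u l by (simp add: ldist_eq)
  then have "u + riem_dist A g (\<gamma> t) q \<le> l" using l(2) by simp
  then show ?thesis using u t by (intro exI[of _ "\<gamma> t"]) auto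
qed

lemma compact_riem_cball:
  assumes "complete_riemannian A g"
  shows "compact {q. riem_dist A g p q \<le> r}"
proof -
  have "compactin riem.mtopology (riem.mcball p r)"
  proof (rule riem.compactin_mcball)
    show "riem.mcomplete" using assms by (simp add: complete_riemannian_def)
    show "\<exists>z\<in>UNIV. riem_dist A g p z < r \<and> riem_dist A g z q < s"
      if "0 < r" "0 < s" "riem_dist A g p q < r + s" for p q r s
      using riem_dist_between[OF that] by simp
    fix x
    obtain c where c: "c \<in> A" "x \<in> chart_dom c" "coord c x \<in> chart_img c" by (rule chart_around)
    then obtain s where s: "s > 0" "cball (coord c x) s \<subseteq> chart_img c"
      using open_chart_img[OF c(1)] open_contains_cball by blast
    let ?K = "param c ` cball (coord c x) s"
    have K: "compact ?K"
      by (rule compact_continuous_image[OF continuous_on_subset[OF continuous_on_param[OF c(1)] s(2)] compact_cball])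
    have "open (chart_dom c \<inter> coord c -` ball (coord c x) s)"
      by (rule open_coord_vimage[OF c(1) open_ball])
    moreover have "x \<in> chart_dom c \<inter> coord c -` ball (coord c x) s" using c s by simp
    ultimately obtain r where r: "r > 0" "\<And>q. riem_dist A g x q < r \<Longrightarrow> q \<in> chart_dom c \<inter> coord c -` ball (coord c x) s"
      by (rule riem_ball_subset) (rule that)
    have "riem.mcball x (r/2) \<subseteq> ?K"
    proof
      fix q assume "q \<in> riem.mcball x (r/2)"
      then have q: "q \<in> chart_dom c" "coord c q \<in> cball (coord c x) s" using r(2)[of q] r(1) by auto
      then show "q \<in> ?K" using c by (intro image_eqI[of _ _ "coord c q"]) auto
    qed
    moreover have "compactin riem.mtopology ?K" using K by (simp add: riem_mtopology)
    ultimately have "compactin riem.mtopology (riem.mcball x (r/2))"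
      using closed_compactin riem.closedin_mcball by blast
    then show "\<exists>r>0. compactin riem.mtopology (riem.mcball x r)" using r(1) by (intro exI[of _ "r/2"]) auto
  qed simp_all
  moreover have "riem.mcball p r = {q. riem_dist A g p q \<le> r}" by auto
  ultimately show ?thesis by (simp add: riem_mtopology)
qed

end

section \<open>Integration by parts against Lipschitz functions\<close>

lemma C1_on_cong_open:
  assumes f: "C1_on W f" and W: "open W" and eq: "\<And>x. x \<in> W \<Longrightarrow> f x = h x"
  shows "C1_on W h"
proof (rule C1_onI[where f' = "\<lambda>x. frechet_derivative f (at x)"])
  show "(h has_derivative frechet_derivative f (at x)) (at x)" if "x \<in> W" for x
    by (rule has_derivative_transform_within_open[OF C1_on_has_derivative[OF f that] W that eq])
  show "continuous_on W (\<lambda>x. frechet_derivative f (at x) v)" for v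
    by (rule C1_on_continuous_derivative[OF f])
qed

lemma C1_on_local:
  assumes loc: "\<And>x. x \<in> S \<Longrightarrow> \<exists>W. open W \<and> x \<in> W \<and> C1_on W f"
  shows "C1_on S f"
proof (rule C1_onI[where f' = "\<lambda>x. frechet_derivative f (at x)"])
  show "(f has_derivative frechet_derivative f (at x)) (at x)" if "x \<in> S" for x
    using loc[OF that] C1_on_has_derivative by blast
  show "continuous_on S (\<lambda>x. frechet_derivative f (at x) v)" for v
  proof (rule continuous_at_imp_continuous_on, rule ballI)
    fix x assume "x \<in> S"
    then obtain W where W: "open W" "x \<in> W" "C1_on W f" using loc by blast
    then show "isCont (\<lambda>x. frechet_derivative f (at x) v) x"
      using C1_on_continuous_derivative[OF W(3)] continuous_on_eq_continuous_at[OF W(1)] by blast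
  qed
qed

text \<open>A point outside \<open>S\<close> has the neighbourhood \<open>- K\<close>, on which the
  extension is 0, so nothing has to be matched at the boundary of \<open>S\<close>.\<close>

lemma C1_on_extend_zero:
  fixes f :: "'b::real_normed_vector \<Rightarrow> 'c::real_normed_vector"
  assumes f: "C1_on S f" and S: "open S" and K: "closed K" "K \<subseteq> S"
    and z: "\<And>x. x \<in> S - K \<Longrightarrow> f x = 0"
  shows "C1_on UNIV (\<lambda>x. if x \<in> S then f x else 0)"
proof (rule C1_on_local)
  fix x
  show "\<exists>W. open W \<and> x \<in> W \<and> C1_on W (\<lambda>x. if x \<in> S then f x else 0)"
  proof (cases "x \<in> S")
    case True
    have "C1_on S (\<lambda>x. if x \<in> S then f x else 0)"
      by (rule C1_on_cong_open[OF f S]) simp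
    then show ?thesis using S True by blast
  next
    case False
    have "C1_on (- K) (\<lambda>x. if x \<in> S then f x else 0)"
      by (rule C1_on_cong_open[OF C1_on_const[of _ 0]]) (use K z in \<open>auto simp: open_Compl\<close>)
    moreover have "x \<in> - K" using False K by blast
    ultimately show ?thesis using K(1) by (blast intro: open_Compl)
  qed
qed

lemma frechet_derivative_zero_outside:
  fixes f :: "'b::real_normed_vector \<Rightarrow> 'c::real_normed_vector"
  assumes "closed K" "x \<notin> K" "\<And>y. y \<notin> K \<Longrightarrow> f y = 0"
  shows "frechet_derivative f (at x) = (\<lambda>v. 0)"
proof -
  have "(f has_derivative (\<lambda>v. 0)) (at x)"
    by (rule has_derivative_transform_within_open[OF has_derivative_const[of 0], of "- K"])
      (use assms in \<open>auto simp: open_Compl\<close>)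
  then show ?thesis using frechet_derivative_at by metis
qed

section \<open>Cut-off functions and compactly supported integrands\<close>

lemma C1_on_pos_part_square: "C1_on UNIV (\<lambda>t::real. (max 0 t)\<^sup>2)"
proof (rule C1_onI[where f' = "\<lambda>t v. 2 * max 0 t * v"])
  show "continuous_on UNIV (\<lambda>t::real. 2 * max 0 t * v)" for v
    by (intro continuous_intros)
  fix t :: real
  consider "t > 0" | "t < 0" | "t = 0" by linarith
  then show "((\<lambda>t. (max 0 t)\<^sup>2) has_derivative (\<lambda>v. 2 * max 0 t * v)) (at t)"
  proof cases
    case 1
    have "((\<lambda>t. t\<^sup>2) has_derivative (\<lambda>v. 2 * max 0 t * v)) (at t)"
      using 1 by (auto intro!: derivative_eq_intros)
    then show ?thesis
      by (rule has_derivative_transform_within_open[of _ _ _ _ "{0<..}"]) (use 1 in auto)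
  next
    case 2
    have "((\<lambda>t. 0) has_derivative (\<lambda>v. 2 * max 0 t * v)) (at t)"
      using 2 by (auto intro!: derivative_eq_intros simp: max_def)
    then show ?thesis
      by (rule has_derivative_transform_within_open[of _ _ _ _ "{..<0}"]) (use 2 in auto)
  next
    case 3
    have "((\<lambda>t. (max 0 t)\<^sup>2) has_real_derivative 0) (at (0::real))"
      unfolding DERIV_def
    proof (rule tendsto_0_le[where K = 1])
      show "((\<lambda>h::real. h) \<longlongrightarrow> 0) (at 0)" by (rule tendsto_ident_at)
      show "\<forall>\<^sub>F h::real in at 0. norm (((max 0 (0 + h))\<^sup>2 - (max 0 0)\<^sup>2) / h) \<le> norm h * (1::real)"
        by (rule always_eventually) (auto simp: max_def power2_eq_square)
    qed
    moreover have "(*) (0::real) = (\<lambda>v. 0)" by auto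
    ultimately show ?thesis using 3 by (simp add: has_field_derivative_def)
  qed
qed

lemma plateau_bump:
  fixes x0 :: "'b::euclidean_space"
  assumes \<rho>: "\<rho> > 0"
  obtains \<eta> :: "'b \<Rightarrow> real" where "C1_on UNIV \<eta>" "\<And>x. 0 \<le> \<eta> x" "\<And>x. \<eta> x \<le> 1"
    "\<And>x. x \<in> ball x0 \<rho> \<Longrightarrow> \<eta> x = 1" "\<And>x. x \<notin> cball x0 (2 * \<rho>) \<Longrightarrow> \<eta> x = 0"
proof -
  define P where "P t = (max 0 t)\<^sup>2" for t :: real
  define w where "w x = (x - x0) \<bullet> (x - x0) / \<rho>\<^sup>2" for x
  \<comment> \<open>On the inner ball \<open>w x \<le> 1\<close>, so the inner \<open>P\<close> is 0
    and the outer one is \<open>P 1 = 1\<close>. Outside the ball of radius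
    \<open>2 * \<rho>\<close> one has \<open>w x \<ge> 4\<close>, the inner \<open>P\<close> is at
    least 1, and the outer argument is at most 0.\<close>
  define \<eta> where "\<eta> x = P (1 - P (w x - 1))" for x
  have P: "P t \<ge> 0" "t \<le> 1 \<Longrightarrow> P t \<le> 1" "t \<le> 0 \<Longrightarrow> P t = 0" "t \<ge> 1 \<Longrightarrow> P t \<ge> 1" for t
    by (auto simp: P_def max_def power_le_one)
  have cP: "C1_on UNIV P" unfolding P_def[abs_def] by (rule C1_on_pos_part_square)
  have "(w has_derivative (\<lambda>v. 2 * ((x - x0) \<bullet> v) / \<rho>\<^sup>2)) (at x)" for x
    unfolding w_def using \<rho> by (auto intro!: derivative_eq_intros simp: inner_commute fun_eq_iff field_simps
        power2_eq_square power4_eq_xxxx)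
  then have cw: "C1_on UNIV w"
    by (rule C1_onI) (intro continuous_intros, use \<rho> in auto)
  have 1: "C1_on UNIV (\<lambda>x. w x + (-1))" by (intro C1_on_add cw C1_on_const)
  have 2: "C1_on UNIV (\<lambda>x. P (w x + (-1)))" by (rule C1_on_compose[OF 1 cP]) simp
  have 3: "C1_on UNIV (\<lambda>x. 1 + (-1) *\<^sub>R P (w x + (-1)))"
    by (intro C1_on_add C1_on_scaleR C1_on_const 2)
  have 4: "C1_on UNIV (\<lambda>x. P (1 + (-1) *\<^sub>R P (w x + (-1))))" by (rule C1_on_compose[OF 3 cP]) simp
  show thesis
  proof (rule that[of \<eta>])
    show "C1_on UNIV \<eta>" using 4 by (simp add: \<eta>_def[abs_def])
    show "0 \<le> \<eta> x" "\<eta> x \<le> 1" for x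
      using P(1)[of "1 - P (w x - 1)"] P(2)[of "1 - P (w x - 1)"] P(1)[of "w x - 1"] by (auto simp: \<eta>_def)
    show "\<eta> x = 1" if "x \<in> ball x0 \<rho>" for x
    proof -
      have "norm (x - x0) \<le> \<rho>" using that by (simp add: dist_norm norm_minus_commute)
      then have "(norm (x - x0))\<^sup>2 \<le> \<rho>\<^sup>2" by (simp add: power_mono)
      then have "w x \<le> 1" using \<rho> by (simp add: w_def power2_norm_eq_inner)
      then show ?thesis by (simp add: \<eta>_def P(3)) (simp add: P_def)
    qed
    show "\<eta> x = 0" if "x \<notin> cball x0 (2 * \<rho>)" for x
    proof -
      have "2 * \<rho> \<le> norm (x - x0)" using that by (simp add: dist_norm norm_minus_commute)
      then have "(2 * \<rho>)\<^sup>2 \<le> (norm (x - x0))\<^sup>2" using \<rho> by (intro power_mono) auto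
      then have "4 * \<rho>\<^sup>2 \<le> (norm (x - x0))\<^sup>2" by (simp add: power_mult_distrib)
      then have "4 \<le> w x" using \<rho> by (simp add: w_def power2_norm_eq_inner field_simps)
      then have "P (w x - 1) \<ge> 1" by (intro P) simp
      then show ?thesis by (simp add: \<eta>_def P(3))
    qed
  qed
qed

lemma bounded_compact_support:
  fixes f :: "'b::topological_space \<Rightarrow> real"
  assumes f: "continuous_on UNIV f" and K: "compact K" "\<And>x. x \<notin> K \<Longrightarrow> f x = 0"
  shows "\<exists>N>0. \<forall>x. \<bar>f x\<bar> \<le> N"
proof -
  have "compact (f ` K)" by (intro compact_continuous_image continuous_on_subset[OF f] K) auto
  then obtain N where N: "N > 0" "\<And>x. x \<in> K \<Longrightarrow> \<bar>f x\<bar> \<le> N"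
    using compact_imp_bounded[of "f ` K"] unfolding bounded_pos by auto
  have "\<bar>f x\<bar> \<le> N" for x using N K(2)[of x] by (cases "x \<in> K") auto
  then show ?thesis using N(1) by blast
qed

lemma integrable_mult_compact_support:
  fixes u f :: "'b::euclidean_space \<Rightarrow> real"
  assumes u: "u \<in> borel_measurable borel" "\<And>x. \<bar>u x\<bar> \<le> K"
    and f: "continuous_on UNIV f" "\<And>x. x \<notin> cball x0 r \<Longrightarrow> f x = 0"
  shows "integrable lborel (\<lambda>x. u x * f x)"
proof -
  obtain N where N: "N > 0" "\<And>x. \<bar>f x\<bar> \<le> N"
    using bounded_compact_support[OF f(1) compact_cball[of x0 r] f(2)] by blast
  have i: "integrable lborel (\<lambda>x. K * N * indicator (cball x0 r) x :: real)"
    using emeasure_lborel_cball_finite[of x0 r] by (intro integrable_mult_right integrable_real_indicator) auto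
  have m: "(\<lambda>x. u x * f x) \<in> borel_measurable lborel"
    using u(1) borel_measurable_continuous_onI[OF f(1)] by simp
  have "\<bar>u x * f x\<bar> \<le> \<bar>K * N * indicator (cball x0 r) x\<bar>" for x
  proof (cases "x \<in> cball x0 r")
    case True
    have "\<bar>u x\<bar> * \<bar>f x\<bar> \<le> K * N"
      by (rule mult_mono) (use N(2)[of x] u(2)[of x] in auto)
    then show ?thesis using True abs_ge_self[of "K * N"] by (simp add: abs_mult)
  qed (simp add: f(2))
  then show ?thesis by (intro Bochner_Integration.integrable_bound[OF i m] AE_I2) simp
qed

section \<open>Translations, difference quotients and integration by parts\<close>

lemma integral_lborel_shift:
  fixes f :: "'b::euclidean_space \<Rightarrow> real"
  assumes "f \<in> borel_measurable borel"
  shows "(\<integral>x. f (x + a) \<partial>lborel) = (\<integral>x. f x \<partial>lborel)"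
proof -
  have "(\<integral>x. f x \<partial>lborel) = (\<integral>x. f x \<partial>(distr lborel borel ((+) a)))" by (simp add: lborel_distr_plus)
  also have "\<dots> = (\<integral>x. f (a + x) \<partial>lborel)" by (rule integral_distr) (use assms in auto)
  finally show ?thesis by (simp add: add.commute)
qed

text \<open>The factor \<open>u\<close> need not be differentiable: the difference quotient is moved from \<open>\<beta>\<close>
  to \<open>u\<close> by translation invariance before the limit is taken.\<close>

lemma directional_integration_by_parts_bound:
  fixes \<beta> u :: "'b::euclidean_space \<Rightarrow> real"
  assumes \<beta>: "C1_on UNIV \<beta>" "\<And>x. x \<notin> cball x0 r \<Longrightarrow> \<beta> x = 0"
    and u: "u \<in> borel_measurable borel" "\<And>x. \<bar>u x\<bar> \<le> K"
    and s0: "s0 > 0"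
    and L: "\<And>x s. x \<in> cball x0 r \<Longrightarrow> 0 < s \<Longrightarrow> s < s0 \<Longrightarrow> \<bar>u (x - s *\<^sub>R b) - u x\<bar> \<le> L * s"
  shows "\<bar>\<integral>x. u x * frechet_derivative \<beta> (at x) b \<partial>lborel\<bar> \<le> L * (\<integral>x. \<bar>\<beta> x\<bar> \<partial>lborel)"
proof -
  have K0: "K \<ge> 0" using u(2)[of undefined] by linarith
  have cont\<beta>: "continuous_on UNIV \<beta>" using C1_on_imp_continuous_on[OF \<beta>(1)] .
  have m\<beta>: "\<beta> \<in> borel_measurable borel" using borel_measurable_continuous_onI[OF cont\<beta>] .
  define D where "D x = frechet_derivative \<beta> (at x) b" for x
  have contD: "continuous_on UNIV D" unfolding D_def by (rule C1_on_continuous_derivative[OF \<beta>(1)])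
  have mD: "D \<in> borel_measurable borel" using borel_measurable_continuous_onI[OF contD] .
  have D0: "D x = 0" if "x \<notin> cball x0 r" for x
    unfolding D_def using frechet_derivative_zero_outside[of "cball x0 r" x \<beta>] \<beta>(2) that by simp
  obtain N where N: "N > 0" "\<And>x. \<bar>D x\<bar> \<le> N"
    using bounded_compact_support[OF contD compact_cball[of x0 r] D0] by blast
  have i\<beta>: "integrable lborel \<beta>"
    using integrable_mult_compact_support[of "\<lambda>_. 1" 1, OF _ _ cont\<beta> \<beta>(2)] by simp
  have dl: "((\<lambda>s. \<beta> (x + s *\<^sub>R b)) has_real_derivative D (x + s *\<^sub>R b)) (at s)" for x s
    unfolding D_def by (rule has_real_derivative_along_line[OF C1_on_has_derivative[OF \<beta>(1)]]) simp
  have lip: "\<bar>\<beta> (x + s *\<^sub>R b) - \<beta> x\<bar> \<le> N * s" if s: "s > 0" for x s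
  proof -
    obtain t where "\<beta> (x + s *\<^sub>R b) - \<beta> (x + 0 *\<^sub>R b) = (s - 0) * D (x + t *\<^sub>R b)"
      using MVT2[OF s dl[of x]] by blast
    then show ?thesis using N(2)[of "x + t *\<^sub>R b"] s by (simp add: abs_mult mult.commute mult_right_mono)
  qed
  \<comment> \<open>The offset 2 keeps every step strictly below \<open>s0\<close>, as the
    hypothesis \<open>L\<close> demands.\<close>
  define s where "s k = s0 / real (k + 2)" for k
  have s: "s k > 0" "s k < s0" for k
  proof -
    show "s k > 0" using s0 by (simp add: s_def)
    have "s0 * 1 < s0 * real (k + 2)" using s0 by (intro mult_strict_left_mono) auto
    then show "s k < s0" by (simp add: s_def divide_less_eq)
  qed
  have s_lim: "s \<longlonglongrightarrow> 0"
    unfolding s_def using LIMSEQ_ignore_initial_segment[OF lim_const_over_n[of s0], of 2] by simp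
  define q where "q k x = (\<beta> (x + s k *\<^sub>R b) - \<beta> x) / s k" for k x
  have q_le: "\<bar>q k x\<bar> \<le> N" for k x
    using lip[OF s(1)[of k], of x] s(1)[of k] by (simp add: q_def abs_divide divide_le_eq)
  \<comment> \<open>The ball is the same for all \<open>k\<close>, so one integrable function
    dominates all quotients.\<close>
  have q0: "q k x = 0" if x: "x \<notin> cball x0 (r + s0 * norm b)" for k x
  proof -
    have "norm (s k *\<^sub>R b) \<le> s0 * norm b" using s[of k] by (simp add: mult_right_mono)
    moreover have "dist x0 x \<le> dist x0 (x + s k *\<^sub>R b) + norm (s k *\<^sub>R b)"
      using dist_triangle[of x0 x "x + s k *\<^sub>R b"] by (simp add: dist_norm)
    moreover have "0 \<le> s0 * norm b" using s0 by simp
    ultimately have "x + s k *\<^sub>R b \<notin> cball x0 r" "x \<notin> cball x0 r" using x by auto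
    then show ?thesis by (simp add: q_def \<beta>(2))
  qed
  have mq: "q k \<in> borel_measurable borel" for k
  proof -
    have "(\<lambda>x. \<beta> (x + s k *\<^sub>R b)) \<in> borel_measurable borel"
      by (rule measurable_compose[OF _ m\<beta>]) simp
    then show ?thesis unfolding q_def using m\<beta> by simp
  qed
  have q_lim: "(\<lambda>k. q k x) \<longlonglongrightarrow> D x" for x
  proof -
    have "((\<lambda>h. (\<beta> (x + (0 + h) *\<^sub>R b) - \<beta> (x + 0 *\<^sub>R b)) / h) \<longlongrightarrow> D (x + 0 *\<^sub>R b)) (at 0)"
      using dl[of x 0] unfolding DERIV_def .
    then have "((\<lambda>h. (\<beta> (x + h *\<^sub>R b) - \<beta> x) / h) \<longlongrightarrow> D x) (at 0)" by simp
    moreover have "filterlim s (at 0) sequentially"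
      by (rule filterlim_atI[OF s_lim]) (use s in \<open>auto simp: less_imp_neq[THEN not_sym]\<close>)
    ultimately show ?thesis
      unfolding q_def by (rule filterlim_compose)
  qed
  have dom: "\<bar>u x * q k x\<bar> \<le> K * N * indicator (cball x0 (r + s0 * norm b)) x" for k x
    using q0[of x k] q_le[of k x] u(2)[of x] K0 by (auto simp: indicator_def abs_mult intro!: mult_mono)
  have lim: "(\<lambda>k. \<integral>x. u x * q k x \<partial>lborel) \<longlonglongrightarrow> (\<integral>x. u x * D x \<partial>lborel)"
  proof (rule integral_dominated_convergence[where w = "\<lambda>x. K * N * indicator (cball x0 (r + s0 * norm b)) x"])
    show "integrable lborel (\<lambda>x. K * N * indicator (cball x0 (r + s0 * norm b)) x)"
      using emeasure_lborel_cball_finite[of x0 "r + s0 * norm b"]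
      by (intro integrable_mult_right integrable_real_indicator) auto
    show "AE x in lborel. (\<lambda>k. u x * q k x) \<longlonglongrightarrow> u x * D x"
      by (rule AE_I2) (intro tendsto_mult_left q_lim)
  qed (use u(1) mq mD dom in auto)
  have bound: "\<bar>\<integral>x. u x * q k x \<partial>lborel\<bar> \<le> L * (\<integral>x. \<bar>\<beta> x\<bar> \<partial>lborel)" for k
  proof -
    let ?a = "s k *\<^sub>R b"
    have mu: "(\<lambda>x. u (x - ?a)) \<in> borel_measurable borel"
      by (rule measurable_compose[OF _ u(1)]) simp
    have i1: "integrable lborel (\<lambda>x. u x * \<beta> x)" "integrable lborel (\<lambda>x. u (x - ?a) * \<beta> x)"
      by (rule integrable_mult_compact_support[OF u cont\<beta> \<beta>(2)], assumption)
        (rule integrable_mult_compact_support[OF mu u(2) cont\<beta> \<beta>(2)], assumption)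
    have i2: "integrable lborel (\<lambda>x. u x * \<beta> (x + ?a))"
    proof (rule integrable_mult_compact_support[OF u])
      show "continuous_on UNIV (\<lambda>x. \<beta> (x + ?a))"
        by (rule continuous_on_compose2[OF cont\<beta>]) (auto intro!: continuous_intros)
      show "\<beta> (x + ?a) = 0" if "x \<notin> cball (x0 - ?a) r" for x
        using that by (intro \<beta>(2)) (simp add: dist_norm algebra_simps)
    qed
    \<comment> \<open>Writing \<open>u x\<close> as \<open>u ((x + ?a) - ?a)\<close> exhibits the
      integrand as a translate; the substitution moves the increment from \<open>\<beta>\<close> to
      \<open>u\<close>.\<close>
    have "(\<integral>x. u x * \<beta> (x + ?a) \<partial>lborel) = (\<integral>x. u ((x + ?a) - ?a) * \<beta> (x + ?a) \<partial>lborel)" by simp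
    also have "\<dots> = (\<integral>x. u (x - ?a) * \<beta> x \<partial>lborel)"
      by (rule integral_lborel_shift) (use mu m\<beta> in simp)
    finally have sh: "(\<integral>x. u x * \<beta> (x + ?a) \<partial>lborel) = (\<integral>x. u (x - ?a) * \<beta> x \<partial>lborel)" .
    have "(\<integral>x. u x * q k x \<partial>lborel) = (\<integral>x. (u x * \<beta> (x + ?a) - u x * \<beta> x) / s k \<partial>lborel)"
      by (simp add: q_def right_diff_distrib)
    also have "\<dots> = ((\<integral>x. u (x - ?a) * \<beta> x \<partial>lborel) - (\<integral>x. u x * \<beta> x \<partial>lborel)) / s k"
      using i1 i2 sh by simp
    also have "\<dots> = (\<integral>x. (u (x - ?a) - u x) / s k * \<beta> x \<partial>lborel)"
      using i1 by (simp add: left_diff_distrib diff_divide_distrib)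
    finally have e: "(\<integral>x. u x * q k x \<partial>lborel) = (\<integral>x. (u (x - ?a) - u x) / s k * \<beta> x \<partial>lborel)" .
    have "\<bar>\<integral>x. (u (x - ?a) - u x) / s k * \<beta> x \<partial>lborel\<bar> \<le> (\<integral>x. L * \<bar>\<beta> x\<bar> \<partial>lborel)"
      unfolding real_norm_def[symmetric]
    proof (rule Bochner_Integration.integral_norm_bound_integral)
      show "integrable lborel (\<lambda>x. (u (x - ?a) - u x) / s k * \<beta> x)"
        using i1 by (simp add: left_diff_distrib diff_divide_distrib)
      show "integrable lborel (\<lambda>x. L * norm (\<beta> x))" using i\<beta> by simp
      fix x
      show "norm ((u (x - ?a) - u x) / s k * \<beta> x) \<le> L * norm (\<beta> x)"
      proof (cases "x \<in> cball x0 r")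
        case True
        have "\<bar>u (x - ?a) - u x\<bar> / s k \<le> L" using L[OF True s] s(1)[of k] by (simp add: divide_le_eq)
        from mult_right_mono[OF this abs_ge_zero[of "\<beta> x"]] show ?thesis
          using s(1)[of k] by (simp add: abs_mult)
      qed (simp add: \<beta>(2))
    qed
    then show ?thesis using e by simp
  qed
  have "(\<lambda>k. \<bar>\<integral>x. u x * q k x \<partial>lborel\<bar>) \<longlonglongrightarrow> \<bar>\<integral>x. u x * D x \<partial>lborel\<bar>"
    by (rule tendsto_rabs[OF lim])
  then have "\<bar>\<integral>x. u x * D x \<partial>lborel\<bar> \<le> L * (\<integral>x. \<bar>\<beta> x\<bar> \<partial>lborel)"
    by (rule LIMSEQ_le_const2) (use bound in auto)
  then show ?thesis by (simp add: D_def)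
qed

lemma divergence_integration_by_parts_bound:
  fixes Y :: "real^'n \<Rightarrow> real^'n" and u :: "real^'n \<Rightarrow> real" and B :: "real^'n^'n"
  assumes B: "det B \<noteq> 0"
    and Y: "C1_on UNIV Y" "\<And>x. x \<notin> cball x0 r \<Longrightarrow> Y x = 0"
    and u: "u \<in> borel_measurable borel" "\<And>x. \<bar>u x\<bar> \<le> K"
    and s0: "s0 > 0"
    and L: "\<And>j x s. x \<in> cball x0 r \<Longrightarrow> 0 < s \<Longrightarrow> s < s0 \<Longrightarrow> \<bar>u (x - s *\<^sub>R column j B) - u x\<bar> \<le> L * s"
  shows "\<bar>\<integral>x. u x * trace (matrix (frechet_derivative Y (at x))) \<partial>lborel\<bar>
    \<le> L * (\<Sum>j\<in>UNIV. \<integral>x. \<bar>(matrix_inv B *v Y x) $ j\<bar> \<partial>lborel)"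
proof -
  define \<beta> where "\<beta> j x = (matrix_inv B *v Y x) $ j" for j x
  define DY where "DY x = frechet_derivative Y (at x)" for x
  have DY: "(Y has_derivative DY x) (at x)" for x
    unfolding DY_def by (rule C1_on_has_derivative[OF Y(1)]) simp
  have \<beta>: "C1_on UNIV (\<beta> j)" for j
    unfolding \<beta>_def[abs_def] by (intro C1_on_vec_nth C1_on_bounded_linear[OF matrix_vector_mul_bounded_linear Y(1)])
  have \<beta>0: "\<beta> j x = 0" if "x \<notin> cball x0 r" for j x using Y(2)[OF that] by (simp add: \<beta>_def)
  have D\<beta>: "frechet_derivative (\<beta> j) (at x) v = (matrix_inv B *v DY x v) $ j" for j x v
  proof -
    have "(\<beta> j has_derivative (\<lambda>v. (matrix_inv B *v DY x v) $ j)) (at x)"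
      unfolding \<beta>_def[abs_def]
      by (intro bounded_linear.has_derivative[OF bounded_linear_vec_nth]
          bounded_linear.has_derivative[OF matrix_vector_mul_bounded_linear] DY)
    then show ?thesis using frechet_derivative_at by metis
  qed
  have tr: "trace (matrix (DY x)) = (\<Sum>j\<in>UNIV. frechet_derivative (\<beta> j) (at x) (column j B))" for x
  proof -
    have m: "matrix (DY x) *v v = DY x v" for v
      by (rule matrix_works) (simp add: linear_matrix_vector_mul_eq has_derivative_linear[OF DY])
    have "trace (matrix (DY x)) = trace (matrix (DY x) ** (B ** matrix_inv B))"
      by (simp add: matrix_inv_mult(2)[OF B])
    also have "\<dots> = trace ((matrix (DY x) ** B) ** matrix_inv B)" by (simp add: matrix_mul_assoc)
    also have "\<dots> = trace (matrix_inv B ** (matrix (DY x) ** B))" by (rule trace_mul_sym)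
    also have "\<dots> = (\<Sum>j\<in>UNIV. ((matrix_inv B ** (matrix (DY x) ** B)) *v axis j 1) $ j)"
      by (simp add: trace_def matrix_vector_mult_basis column_def)
    also have "\<dots> = (\<Sum>j\<in>UNIV. (matrix_inv B *v (matrix (DY x) *v (B *v axis j 1))) $ j)"
      by (simp only: matrix_vector_mul_assoc matrix_mul_assoc)
    also have "\<dots> = (\<Sum>j\<in>UNIV. frechet_derivative (\<beta> j) (at x) (column j B))"
      by (simp only: matrix_vector_mult_basis m D\<beta>)
    finally show ?thesis .
  qed
  have i: "integrable lborel (\<lambda>x. u x * frechet_derivative (\<beta> j) (at x) (column j B))" for j
  proof -
    let ?D = "\<lambda>x. frechet_derivative (\<beta> j) (at x) (column j B)"
    have D0: "?D x = 0" if "x \<notin> cball x0 r" for x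
      using frechet_derivative_zero_outside[of "cball x0 r" x "\<beta> j"] \<beta>0 that by simp
    show ?thesis
      by (rule integrable_mult_compact_support[OF u C1_on_continuous_derivative[OF \<beta>] D0])
  qed
  have "(\<integral>x. u x * trace (matrix (DY x)) \<partial>lborel)
      = (\<Sum>j\<in>UNIV. \<integral>x. u x * frechet_derivative (\<beta> j) (at x) (column j B) \<partial>lborel)"
    using i by (simp add: tr sum_distrib_left)
  also have "\<bar>\<dots>\<bar> \<le> (\<Sum>j\<in>UNIV. \<bar>\<integral>x. u x * frechet_derivative (\<beta> j) (at x) (column j B) \<partial>lborel\<bar>)"
    by (rule sum_abs)
  also have "\<dots> \<le> (\<Sum>j\<in>UNIV. L * (\<integral>x. \<bar>\<beta> j x\<bar> \<partial>lborel))"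
    by (intro sum_mono directional_integration_by_parts_bound[OF \<beta> \<beta>0 u s0 L])
  also have "\<dots> = L * (\<Sum>j\<in>UNIV. \<integral>x. \<bar>\<beta> j x\<bar> \<partial>lborel)" by (simp add: sum_distrib_left)
  finally show ?thesis by (simp add: \<beta>_def DY_def)
qed

section \<open>The volume measure in charts\<close>

context riemannian_manifold
begin

text \<open>An Auerbach basis of the tangent space: it maximises the volume among bases in the unit ball,
  so Cramer's rule bounds every coordinate of a vector by its length.\<close>

lemma auerbach_basis:
  assumes c: "c \<in> A" and x0: "x0 \<in> chart_img c"
  obtains B where "det B \<noteq> 0" "\<And>j. gnorm c x0 (column j B) \<le> 1"
    "\<And>v j. \<bar>(matrix_inv B *v v) $ j\<bar> \<le> gnorm c x0 v"
proof -
  obtain \<delta> K where \<delta>: "\<delta> > 0" and K: "K > 0"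
    and r: "\<And>v. \<delta> * norm v \<le> gnorm c x0 v" "\<And>v. gnorm c x0 v \<le> K * norm v"
    by (rule gnorm_bounds_at[OF c x0]) (rule that)
  define S where "S = {B::real^'n^'n. \<forall>j. gnorm c x0 (column j B) \<le> 1}"
  have "closed S"
    unfolding S_def
  proof (intro closed_Collect_all closed_Collect_le)
    fix j
    have "continuous_on UNIV (\<lambda>B::real^'n^'n. column j B)"
      unfolding column_def by (intro continuous_intros)
    then show "continuous_on UNIV (\<lambda>B. gnorm c x0 (column j B))"
      by (intro continuous_on_gnorm[OF c, where f = "\<lambda>_. x0"]) (use x0 in auto)
  qed (rule continuous_on_const)
  moreover have "bounded S"
  proof (rule boundedI)
    fix B assume "B \<in> S"
    then have B: "gnorm c x0 (column j B) \<le> 1" for j by (simp add: S_def)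
    have ent: "\<bar>B $ i $ j\<bar> \<le> 1 / \<delta>" for i j
    proof -
      have "\<delta> * norm (column j B) \<le> 1" using r(1)[of "column j B"] B[of j] by linarith
      then have "norm (column j B) \<le> 1 / \<delta>" using \<delta> by (simp add: field_simps)
      moreover have "\<bar>column j B $ i\<bar> \<le> norm (column j B)" by (rule component_le_norm_cart)
      ultimately show ?thesis by (simp add: column_def)
    qed
    have "norm B \<le> (\<Sum>i\<in>UNIV. norm (B $ i))" unfolding norm_vec_def by (rule L2_set_le_sum) auto
    also have "\<dots> \<le> (\<Sum>i\<in>UNIV. \<Sum>j\<in>UNIV. \<bar>B $ i $ j\<bar>)" by (intro sum_mono norm_le_l1_cart)
    also have "\<dots> \<le> (\<Sum>i\<in>(UNIV::'n set). \<Sum>j\<in>(UNIV::'n set). 1 / \<delta>)" by (intro sum_mono ent)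
    finally show "norm B \<le> (\<Sum>i\<in>(UNIV::'n set). \<Sum>j\<in>(UNIV::'n set). 1 / \<delta>)" .
  qed
  ultimately have comp: "compact S" using compact_eq_bounded_closed by blast
  \<comment> \<open>A small multiple of the identity lies in \<open>S\<close>, so the maximal
    absolute determinant is not 0.\<close>
  define B0 where "B0 = (1 / K) *\<^sub>R (mat 1 :: real^'n^'n)"
  have colB0: "column j B0 = (1 / K) *\<^sub>R axis j 1" for j
    by (simp add: B0_def column_def mat_def axis_def vec_eq_iff)
  have B0S: "B0 \<in> S"
    unfolding S_def
  proof (intro CollectI allI)
    fix j
    have "gnorm c x0 (axis j 1) \<le> K" using r(2)[of "axis j 1"] by simp
    then show "gnorm c x0 (column j B0) \<le> 1" using K by (simp add: colB0 gnorm_scaleR)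
  qed
  have detB0: "det B0 \<noteq> 0"
  proof -
    have "(K *\<^sub>R mat 1) ** B0 = mat 1"
      using K by (simp add: B0_def scalar_matrix_assoc[symmetric] matrix_scalar_ac)
    then show ?thesis by (metis det_I det_mul mult_zero_right zero_neq_one)
  qed
  have "continuous_on S (\<lambda>B. \<bar>det B\<bar>)" unfolding det_def by (intro continuous_intros)
  then obtain B where B: "B \<in> S" "\<And>B'. B' \<in> S \<Longrightarrow> \<bar>det B'\<bar> \<le> \<bar>det B\<bar>"
    using continuous_attains_sup[OF comp] B0S by blast
  have dB: "det B \<noteq> 0" using B(2)[OF B0S] detB0 by auto
  show thesis
  proof (rule that[OF dB])
    show "gnorm c x0 (column j B) \<le> 1" for j using B(1) by (simp add: S_def)
    fix v k
    show "\<bar>(matrix_inv B *v v) $ k\<bar> \<le> gnorm c x0 v"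
    proof (cases "v = 0")
      case True
      then show ?thesis using gnorm_nonneg[OF c x0, of v] by simp
    next
      case False
      define N where "N = gnorm c x0 v"
      have N: "N > 0" using metric_pos[OF c x0 False] by (simp add: N_def gnorm_def)
      define w where "w = (1 / N) *\<^sub>R (matrix_inv B *v v)"
      have Bw: "B *v w = (1 / N) *\<^sub>R v"
        by (simp add: w_def matrix_vector_mult_scaleR matrix_vector_mul_assoc matrix_inv_mult(2)[OF dB])
      \<comment> \<open>Column \<open>k\<close> is replaced by the unit vector
        \<open>(1 / N) *\<^sub>R v\<close>. The result stays in \<open>S\<close>, and by Cramer's
        rule its determinant is \<open>w $ k * det B\<close>; maximality bounds the new factor by
        1.\<close>
      define B' where "B' = (\<chi> i j. if j = k then (B *v w) $ i else B $ i $ j)"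
      have "column j B' = (if j = k then (1 / N) *\<^sub>R v else column j B)" for j
        by (simp add: B'_def column_def Bw vec_eq_iff)
      then have "B' \<in> S"
        using B(1) N by (auto simp: S_def gnorm_scaleR N_def[symmetric])
      then have "\<bar>w $ k * det B\<bar> \<le> \<bar>det B\<bar>"
        using B(2)[of B'] cramer_lemma[of k B w] by (simp add: B'_def)
      then have "\<bar>w $ k\<bar> \<le> 1" using dB by (simp add: abs_mult)
      then show ?thesis using N by (simp add: w_def N_def[symmetric] abs_mult divide_le_eq)
    qed
  qed
qed

lemma continuous_on_at_point:
  assumes inv: "\<And>c d p. c \<in> A \<Longrightarrow> d \<in> A \<Longrightarrow> p \<in> chart_dom c \<Longrightarrow> p \<in> chart_dom d \<Longrightarrow>
      F c (coord c p) = F d (coord d p)"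
    and cont: "\<And>c. c \<in> A \<Longrightarrow> continuous_on (chart_img c) (F c)"
  shows "continuous_on UNIV (at_point A F)"
proof (rule continuous_at_imp_continuous_on, rule ballI)
  fix p
  obtain c where c: "c \<in> A" "p \<in> chart_dom c" "coord c p \<in> chart_img c" by (rule chart_around)
  have "continuous_on (chart_dom c) (\<lambda>q. F c (coord c q))"
    by (rule continuous_on_compose2[OF cont[OF c(1)] continuous_on_coord[OF c(1)]]) auto
  moreover have "at_point A F q = F c (coord c q)" if "q \<in> chart_dom c" for q
    by (rule at_point_eq[where f = F, OF inv c(1) that])
  ultimately have "continuous_on (chart_dom c) (at_point A F)" by (simp cong: continuous_on_cong)
  then show "isCont (at_point A F) p"
    using c open_chart_dom[OF c(1)] continuous_on_eq_continuous_at by blast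
qed

definition C1_fun :: "('a \<Rightarrow> real) \<Rightarrow> bool" where
  "C1_fun h \<longleftrightarrow> (\<forall>c\<in>A. C1_on (chart_img c) (\<lambda>x. h (param c x)))"

lemma C1_funD: "C1_fun h \<Longrightarrow> c \<in> A \<Longrightarrow> C1_on (chart_img c) (\<lambda>x. h (param c x))"
  by (simp add: C1_fun_def)

lemma C1_fun_const: "C1_fun (\<lambda>_. a)"
  by (simp add: C1_fun_def)

lemma C1_fun_add: "C1_fun f \<Longrightarrow> C1_fun h \<Longrightarrow> C1_fun (\<lambda>p. f p + h p)"
  by (simp add: C1_fun_def C1_on_add)

lemma C1_fun_mult: "C1_fun f \<Longrightarrow> C1_fun h \<Longrightarrow> C1_fun (\<lambda>p. f p * h p)"
  by (simp add: C1_fun_def C1_on_mult)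

lemma C1_fun_imp_continuous_on:
  assumes h: "C1_fun h"
  shows "continuous_on UNIV h"
proof -
  have "continuous_on UNIV (at_point A (\<lambda>c x. h (param c x)))"
    by (rule continuous_on_at_point) (use C1_on_imp_continuous_on[OF C1_funD[OF h]] in auto)
  moreover have "at_point A (\<lambda>c x. h (param c x)) p = h p" for p
    using chart_at[of p] by (simp add: at_point_def)
  ultimately show ?thesis by (simp cong: continuous_on_cong)
qed

lemma compact_param_cball:
  assumes "c \<in> A" "cball x0 r \<subseteq> chart_img c"
  shows "compact (param c ` cball x0 r)"
  by (rule compact_continuous_image[OF continuous_on_subset[OF continuous_on_param[OF assms(1)] assms(2)]
        compact_cball])

text \<open>The image of the closed ball is compact, hence closed in the Hausdorff manifold. A point
  outside the domain of \<open>c\<close> therefore has a neighbourhood, in any other chart, on which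
  the function is 0, and there is no jump where the domain of \<open>c\<close> ends.\<close>

lemma C1_fun_extend_zero:
  assumes c: "c \<in> A" "cball x0 r \<subseteq> chart_img c"
    and \<eta>: "C1_on UNIV \<eta>" "\<And>x. x \<notin> cball x0 r \<Longrightarrow> \<eta> x = (0::real)"
  shows "C1_fun (\<lambda>q. if q \<in> chart_dom c then \<eta> (coord c q) else 0)"
  unfolding C1_fun_def
proof (rule ballI, rule C1_on_local)
  fix d y assume d: "d \<in> A" and y: "y \<in> chart_img d"
  let ?b = "\<lambda>q. if q \<in> chart_dom c then \<eta> (coord c q) else 0"
  let ?K = "param c ` cball x0 r"
  show "\<exists>W. open W \<and> y \<in> W \<and> C1_on W (\<lambda>x. ?b (param d x))"
  proof (cases "param d y \<in> chart_dom c")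
    case True
    then have "y \<in> overlap d c" using y by (simp add: overlap_eq[OF d])
    moreover have "C1_on (overlap d c) (\<lambda>x. \<eta> (transition d c x))"
      by (rule C1_on_compose[OF smooth_on_imp_C1_on[OF smooth_on_transition[OF d c(1)]] \<eta>(1)]) simp
    then have "C1_on (overlap d c) (\<lambda>x. ?b (param d x))"
      by (rule C1_on_cong_open[OF _ open_overlap[OF d c(1)]])
        (simp add: overlap_eq[OF d] transition_def)
    ultimately show ?thesis using open_overlap[OF d c(1)] by blast
  next
    case False
    have "closed ?K" by (intro compact_imp_closed compact_param_cball c)
    then have op: "open (chart_img d \<inter> param d -` (- ?K))"
      by (intro open_param_vimage[OF d]) auto
    have z: "?b q = 0" if "q \<notin> ?K" for q
    proof (cases "q \<in> chart_dom c")
      case True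
      have "coord c q \<notin> cball x0 r"
      proof
        assume "coord c q \<in> cball x0 r"
        then have "param c (coord c q) \<in> ?K" by blast
        then show False using that True c by simp
      qed
      then show ?thesis using \<eta>(2) by simp
    qed simp
    have "C1_on (chart_img d \<inter> param d -` (- ?K)) (\<lambda>x. ?b (param d x))"
    proof (rule C1_on_cong_open[OF C1_on_const[of _ 0] op])
      fix x assume "x \<in> chart_img d \<inter> param d -` (- ?K)"
      then show "0 = ?b (param d x)" using z[of "param d x"] by (simp del: if_split)
    qed
    moreover have "param d y \<notin> ?K"
    proof
      assume "param d y \<in> ?K"
      then obtain x where "x \<in> cball x0 r" "param d y = param c x" by blast
      then show False using False c(2) param_in_dom[OF c(1), of x] by auto
    qed
    then have "y \<in> chart_img d \<inter> param d -` (- ?K)" using y by simp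
    ultimately show ?thesis using op by blast
  qed
qed

end

section \<open>Continuous scalars built from the vector field\<close>

context riemannian_manifold_with_field
begin

definition dir_deriv :: "('a \<Rightarrow> real) \<Rightarrow> ('a, 'n) scalar" where
  "dir_deriv h c x = frechet_derivative (\<lambda>x. h (param c x)) (at x) (X c x)"

lemma dir_deriv_invariant:
  assumes h: "C1_fun h" and c: "c \<in> A" and d: "d \<in> A" and p: "p \<in> chart_dom c" "p \<in> chart_dom d"
  shows "dir_deriv h c (coord c p) = dir_deriv h d (coord d p)"
proof -
  let ?x = "coord c p"
  have x: "?x \<in> overlap c d" using coord_in_overlap[OF p] .
  have Tx: "transition c d ?x = coord d p" by (rule transition_coord[OF c p(1)])
  have D: "((\<lambda>y. h (param d y)) has_derivative frechet_derivative (\<lambda>y. h (param d y)) (at (transition c d ?x)))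
      (at (transition c d ?x))"
    by (rule C1_on_has_derivative[OF C1_funD[OF h d] transition_in_img[OF c x]])
  have "((\<lambda>x. h (param d (transition c d x))) has_derivative
      (\<lambda>v. frechet_derivative (\<lambda>y. h (param d y)) (at (transition c d ?x)) (jac c d ?x *v v))) (at ?x)"
    by (rule has_derivative_compose[OF transition_has_derivative[OF c d x] D])
  then have "((\<lambda>x. h (param c x)) has_derivative
      (\<lambda>v. frechet_derivative (\<lambda>y. h (param d y)) (at (transition c d ?x)) (jac c d ?x *v v))) (at ?x)"
  proof (rule has_derivative_transform_within_open[OF _ open_overlap[OF c d] x])
    fix y assume "y \<in> overlap c d"
    then show "h (param d (transition c d y)) = h (param c y)"
      using d by (simp add: overlap_eq[OF c] transition_def)
  qed
  from fun_cong[OF frechet_derivative_at[OF this], of "X c ?x"]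
  show ?thesis
    using field_transform[OF c d x] Tx by (simp add: dir_deriv_def)
qed

lemma at_point_dir_deriv:
  "C1_fun h \<Longrightarrow> c \<in> A \<Longrightarrow> p \<in> chart_dom c \<Longrightarrow> at_point A (dir_deriv h) p = dir_deriv h c (coord c p)"
  by (rule at_point_eq[where f = "dir_deriv h", OF dir_deriv_invariant])

lemma continuous_on_field: "c \<in> A \<Longrightarrow> continuous_on (chart_img c) (X c)"
  by (rule C1_on_imp_continuous_on[OF smooth_on_imp_C1_on[OF smooth_on_field]])

lemma continuous_on_dir_deriv:
  assumes h: "C1_fun h"
  shows "continuous_on UNIV (at_point A (dir_deriv h))"
proof (rule continuous_on_at_point[where F = "dir_deriv h", OF dir_deriv_invariant[OF h]])
  show "continuous_on (chart_img c) (dir_deriv h c)" if "c \<in> A" for c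
    unfolding dir_deriv_def
    using C1_on_continuous_derivative_compose[OF C1_funD[OF h that] continuous_on_id _ continuous_on_field[OF that]]
    by simp
qed

lemma continuous_on_divergence: "continuous_on UNIV (at_point A (divergence g X))"
proof (rule continuous_on_at_point[where F = "divergence g X", OF divergence_invariant])
  fix c assume c: "c \<in> A"
  have tr: "trace (matrix (frechet_derivative (X c) (at x)))
      = (\<Sum>i\<in>UNIV. frechet_derivative (X c) (at x) (axis i 1) $ i)" for x
    by (simp add: trace_def matrix_def)
  have "continuous_on (chart_img c) (\<lambda>x. frechet_derivative (X c) (at x) (axis i 1))" for i
    by (rule C1_on_continuous_derivative[OF smooth_on_imp_C1_on[OF smooth_on_field[OF c]]])
  moreover have "continuous_on (chart_img c) (\<lambda>x. frechet_derivative (vol_density g c) (at x) (X c x))"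
    using C1_on_continuous_derivative_compose[OF C1_on_vol_density[OF c] continuous_on_id _ continuous_on_field[OF c]]
    by simp
  ultimately show "continuous_on (chart_img c) (divergence g X c)"
    unfolding divergence_def tr using vol_density_pos[OF c] C1_on_imp_continuous_on[OF C1_on_vol_density[OF c]]
    by (intro continuous_intros) (auto simp: less_imp_neq[THEN not_sym])
qed

lemma continuous_on_norm_sq: "continuous_on UNIV (at_point A (norm_sq g X))"
proof (rule continuous_on_at_point[where F = "norm_sq g X", OF norm_sq_invariant])
  fix c assume c: "c \<in> A"
  have "continuous_on (chart_img c) (\<lambda>x. (gnorm c x (X c x))\<^sup>2)"
    using continuous_on_gnorm[OF c continuous_on_id _ continuous_on_field[OF c]]
    by (intro continuous_intros) simp
  moreover have "(gnorm c x (X c x))\<^sup>2 = norm_sq g X c x" if "x \<in> chart_img c" for x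
    using metric_nonneg[OF c that] by (simp add: gnorm_def norm_sq_def)
  ultimately show "continuous_on (chart_img c) (norm_sq g X c)" by (simp cong: continuous_on_cong)
qed

lemma dir_deriv_locally_const:
  assumes h: "C1_fun h" and U: "open U" "p \<in> U" "\<And>q. q \<in> U \<Longrightarrow> h q = a"
  shows "at_point A (dir_deriv h) p = 0"
proof -
  obtain c where c: "c \<in> A" "p \<in> chart_dom c" "coord c p \<in> chart_img c" by (rule chart_around)
  note op = open_param_vimage[OF c(1) U(1)]
  have "((\<lambda>x. h (param c x)) has_derivative (\<lambda>v. 0)) (at (coord c p))"
    by (rule has_derivative_transform_within_open[OF has_derivative_const[of a] op]) (use c U in auto)
  from frechet_derivative_at[OF this] show ?thesis
    by (simp add: at_point_dir_deriv[OF h c(1,2)] dir_deriv_def) metis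
qed

end

locale riemannian_manifold_with_volume = riemannian_manifold_with_field A g X
  for A :: "('a::{t2_space, second_countable_topology}, 'n::finite) chart set" and g X +
  fixes dV :: "'a measure"
  assumes volume: "riemannian_volume A g dV"
    and finite_volume: "emeasure dV UNIV < \<infinity>"
begin

lemma sets_dV [simp, measurable_cong]: "sets dV = sets borel"
  using volume by (simp add: riemannian_volume_def)

lemma space_dV [simp]: "space dV = UNIV"
  using sets_eq_imp_space_eq[OF sets_dV] by simp

sublocale finite_measure dV
  by standard (use finite_volume in \<open>auto simp: less_top\<close>)

text \<open>\<open>riemannian_volume\<close> prescribes the measure of Borel sets inside the chart
  only. The volume restricted to the chart domain and the image of weighted Lebesgue measure under
  the parametrisation are shown to be equal as measures, and this transfers integrals and
  integrability.\<close>

lemma integral_in_chart: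
  assumes c: "c \<in> A" and f: "f \<in> borel_measurable borel" and z: "\<And>p. p \<notin> chart_dom c \<Longrightarrow> f p = (0::real)"
  shows "(\<integral>p. f p \<partial>dV) = (\<integral>x. (if x \<in> chart_img c then vol_density g c x * f (param c x) else 0) \<partial>lborel)"
    and "integrable dV f \<longleftrightarrow>
      integrable lborel (\<lambda>x. if x \<in> chart_img c then vol_density g c x * f (param c x) else 0)"
proof -
  \<comment> \<open>Outside the chart image the density and \<open>param c\<close> are arbitrary.
    The default values make \<open>w\<close> and \<open>h\<close> Borel on the whole space, and as
    \<open>w\<close> is 0 there, the value of \<open>h\<close> has no effect.\<close>
  define w where "w x = (if x \<in> chart_img c then vol_density g c x else 0)" for x
  define h where "h x = (if x \<in> chart_img c then param c x else undefined)" for x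
  have img: "chart_img c \<in> sets borel" by (rule borel_open[OF open_chart_img[OF c]])
  have dom: "chart_dom c \<in> sets borel" by (rule borel_open[OF open_chart_dom[OF c]])
  have w: "w \<in> borel_measurable borel"
    unfolding w_def
    by (rule borel_measurable_continuous_on_if[OF img C1_on_imp_continuous_on[OF C1_on_vol_density[OF c]]
          continuous_on_const])
  have h: "h \<in> borel_measurable borel"
    unfolding h_def by (rule borel_measurable_continuous_on_if[OF img continuous_on_param[OF c] continuous_on_const])
  have w0: "w x \<ge> 0" for x using vol_density_pos[OF c, of x] by (auto simp: w_def)
  define \<mu> where "\<mu> = density dV (\<lambda>p. ennreal (indicator (chart_dom c) p))"
  define \<nu> where "\<nu> = distr (density lborel (\<lambda>x. ennreal (w x))) borel h"
  have "\<mu> = \<nu>"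
  proof (rule measure_eqI)
    show "sets \<mu> = sets \<nu>" by (simp add: \<mu>_def \<nu>_def)
    fix B assume "B \<in> sets \<mu>"
    then have B: "B \<in> sets borel" by (simp add: \<mu>_def)
    have "emeasure \<mu> B = (\<integral>\<^sup>+ p. ennreal (indicator (chart_dom c) p) * indicator B p \<partial>dV)"
      unfolding \<mu>_def by (rule emeasure_density) (use B dom in auto)
    also have "\<dots> = (\<integral>\<^sup>+ p. indicator (B \<inter> chart_dom c) p \<partial>dV)"
      by (intro nn_integral_cong) (auto simp: indicator_def)
    also have "\<dots> = emeasure dV (B \<inter> chart_dom c)"
      by (rule nn_integral_indicator) (use B dom in auto)
    also have "\<dots> = (\<integral>\<^sup>+ x\<in>coord c ` (B \<inter> chart_dom c). ennreal (sqrt (det (g c x))) \<partial>lborel)"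
      using volume c B dom by (auto simp: riemannian_volume_def)
    also have "\<dots> = (\<integral>\<^sup>+ x. ennreal (w x) * indicator (h -` B) x \<partial>lborel)"
    proof (rule nn_integral_cong)
      fix x
      have "x \<in> coord c ` (B \<inter> chart_dom c) \<longleftrightarrow> x \<in> chart_img c \<and> param c x \<in> B"
        using c by (auto simp: image_iff)
      then show "ennreal (sqrt (det (g c x))) * indicator (coord c ` (B \<inter> chart_dom c)) x
          = ennreal (w x) * indicator (h -` B) x"
        by (auto simp: w_def h_def vol_density_def indicator_def)
    qed
    also have "\<dots> = emeasure (density lborel (\<lambda>x. ennreal (w x))) (h -` B)"
      by (rule emeasure_density[symmetric]) (use w measurable_sets[OF h B] in auto)
    also have "\<dots> = emeasure \<nu> B"
      unfolding \<nu>_def by (subst emeasure_distr) (use h B in auto)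
    finally show "emeasure \<mu> B = emeasure \<nu> B" .
  qed
  have f': "f \<in> borel_measurable dV" using f by simp
  have h': "h \<in> measurable (density lborel (\<lambda>x. ennreal (w x))) borel" using h by simp
  have fh: "(\<lambda>x. f (h x)) \<in> borel_measurable lborel" using measurable_compose[OF h f] by simp
  have "indicator (chart_dom c) p *\<^sub>R f p = f p" for p by (cases "p \<in> chart_dom c") (use z in auto)
  then have e1: "(\<lambda>p. indicator (chart_dom c) p *\<^sub>R f p) = f" by (rule ext)
  have e2: "w x *\<^sub>R f (h x) = (if x \<in> chart_img c then vol_density g c x * f (param c x) else 0)" for x
    by (simp add: w_def h_def)
  have ind: "indicator (chart_dom c) \<in> borel_measurable dV" using dom by simp
  have "integral\<^sup>L dV f = integral\<^sup>L \<mu> f"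
    unfolding \<mu>_def using integral_density[OF f' ind] unfolding e1 by simp
  also have "\<dots> = (\<integral>x. f (h x) \<partial>density lborel (\<lambda>x. ennreal (w x)))"
    unfolding \<open>\<mu> = \<nu>\<close> \<nu>_def by (rule integral_distr[OF h' f])
  also have "\<dots> = (\<integral>x. w x *\<^sub>R f (h x) \<partial>lborel)"
    by (rule integral_density) (use fh w w0 in auto)
  finally show "(\<integral>p. f p \<partial>dV) = (\<integral>x. (if x \<in> chart_img c then vol_density g c x * f (param c x) else 0) \<partial>lborel)"
    unfolding e2 .
  have "integrable dV f \<longleftrightarrow> integrable \<mu> f"
    unfolding \<mu>_def using integrable_density[OF f' ind] unfolding e1 by simp
  also have "\<dots> \<longleftrightarrow> integrable (density lborel (\<lambda>x. ennreal (w x))) (\<lambda>x. f (h x))"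
    unfolding \<open>\<mu> = \<nu>\<close> \<nu>_def by (rule integrable_distr_eq[OF h' f])
  also have "\<dots> \<longleftrightarrow> integrable lborel (\<lambda>x. w x *\<^sub>R f (h x))"
    by (rule integrable_density) (use fh w w0 in auto)
  finally show "integrable dV f \<longleftrightarrow>
      integrable lborel (\<lambda>x. if x \<in> chart_img c then vol_density g c x * f (param c x) else 0)"
    unfolding e2 .
qed

text \<open>In a chart the set meets the domain in a set with nonempty open image. The density is
  positive there, and a nonempty open set is not Lebesgue null.\<close>

lemma emeasure_open_pos:
  assumes U: "open U" "U \<noteq> {}"
  shows "U \<notin> null_sets dV"
proof
  assume null: "U \<in> null_sets dV"
  obtain p where p: "p \<in> U" using U by blast
  obtain c where c: "c \<in> A" "p \<in> chart_dom c" "coord c p \<in> chart_img c" by (rule chart_around)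
  let ?B = "U \<inter> chart_dom c" and ?O = "chart_img c \<inter> param c -` U"
  note op = open_param_vimage[OF c(1) U(1)]
  have eq: "coord c ` ?B = ?O"
    using c by (auto simp: image_iff)
  have B: "?B \<in> sets borel" using U open_chart_dom[OF c(1)] by (intro borel_open open_Int) auto
  have "emeasure dV ?B \<le> emeasure dV U" by (rule emeasure_mono) (use U in auto)
  then have "emeasure dV ?B = 0" using null by (simp add: null_setsD1)
  then have "(\<integral>\<^sup>+ x\<in>?O. ennreal (sqrt (det (g c x))) \<partial>lborel) = 0"
    using volume c B unfolding eq[symmetric] by (auto simp: riemannian_volume_def)
  moreover have "(\<integral>\<^sup>+ x\<in>?O. ennreal (sqrt (det (g c x))) \<partial>lborel)
      = (\<integral>\<^sup>+ x. ennreal (indicator ?O x *\<^sub>R sqrt (det (g c x))) \<partial>lborel)"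
    by (intro nn_integral_cong) (auto simp: indicator_def)
  ultimately have "(\<integral>\<^sup>+ x. ennreal (indicator ?O x *\<^sub>R sqrt (det (g c x))) \<partial>lborel) = 0"
    by simp
  moreover have "continuous_on ?O (\<lambda>x. sqrt (det (g c x)))"
    using C1_on_imp_continuous_on[OF C1_on_vol_density[OF c(1)]] unfolding vol_density_def
    by (rule continuous_on_subset) auto
  then have "(\<lambda>x. indicator ?O x *\<^sub>R sqrt (det (g c x))) \<in> borel_measurable borel"
    by (rule borel_measurable_continuous_on_indicator[OF borel_open[OF op]])
  ultimately have "AE x in lborel. ennreal (indicator ?O x *\<^sub>R sqrt (det (g c x))) = 0"
    by (subst (asm) nn_integral_0_iff_AE) auto
  then have "AE x in lborel. x \<notin> ?O"
  proof eventually_elim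
    case (elim x)
    show ?case
    proof
      assume x: "x \<in> ?O"
      then have "sqrt (det (g c x)) > 0" using vol_density_pos[OF c(1), of x] by (simp add: vol_density_def)
      then show False using elim x by simp
    qed
  qed
  then have "?O \<in> null_sets lborel"
    using op by (intro AE_iff_null_sets[THEN iffD2]) auto
  then have "negligible ?O" by (simp add: negligible_iff_null_sets null_sets_completionI)
  moreover have "coord c p \<in> ?O" using c p by simp
  ultimately show False using open_not_negligible[OF op] by blast
qed

end

section \<open>The integral of the divergence\<close>

text \<open>The differential of a scalar function times a vector field has this form, and the
  rank-one map \<open>\<lambda>v. l v *\<^sub>R w\<close> has trace \<open>l w\<close>.\<close>

lemma trace_rank_one_perturbation:
  fixes L :: "real^'n \<Rightarrow> real^'n" and l :: "real^'n \<Rightarrow> real"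
  assumes l: "linear l"
  shows "trace (matrix (\<lambda>v. a *\<^sub>R L v + l v *\<^sub>R w)) = a * trace (matrix L) + l w"
proof -
  have "w = (\<Sum>i\<in>UNIV. w $ i *\<^sub>R axis i 1)"
    using basis_expansion[of w] by (simp add: scalar_mult_eq_scaleR)
  from arg_cong[OF this, of l] have "l w = (\<Sum>i\<in>UNIV. w $ i * l (axis i 1))"
    by (simp add: linear_sum[OF l] linear_cmul[OF l])
  then show ?thesis
    by (simp add: trace_def matrix_def sum.distrib sum_distrib_left mult.commute)
qed

locale riemannian_manifold_integrable_field = riemannian_manifold_with_volume A g X dV
  for A :: "('a::{t2_space, second_countable_topology}, 'n::finite) chart set" and g X dV +
  assumes integrable_field: "integrable dV (\<lambda>p. sqrt (at_point A (norm_sq g X) p))"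
begin

abbreviation "dvg \<equiv> at_point A (divergence g X)"
abbreviation "fnorm p \<equiv> sqrt (at_point A (norm_sq g X) p)"
abbreviation "Xderiv h \<equiv> at_point A (dir_deriv h)"

text \<open>The divergence of the product \<open>f X\<close>.\<close>

definition div_form where "div_form f p = f p * dvg p + Xderiv f p"

lemma fnorm_eq: "c \<in> A \<Longrightarrow> p \<in> chart_dom c \<Longrightarrow> fnorm p = gnorm c (coord c p) (X c (coord c p))"
  by (simp add: at_point_norm_sq norm_sq_def gnorm_def)

lemma fnorm_nonneg: "fnorm p \<ge> 0"
proof -
  have "at_point A (norm_sq g X) p \<ge> 0"
    using chart_at[of p] by (simp add: at_point_def norm_sq_def metric_nonneg)
  then show ?thesis by simp
qed

lemma continuous_on_div_form: "C1_fun f \<Longrightarrow> continuous_on UNIV (div_form f)"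
  unfolding div_form_def
  by (intro continuous_intros C1_fun_imp_continuous_on continuous_on_divergence continuous_on_dir_deriv)

lemma Xderiv_add:
  assumes "C1_fun f" "C1_fun h"
  shows "Xderiv (\<lambda>p. f p + h p) p = Xderiv f p + Xderiv h p"
proof -
  obtain c where c: "c \<in> A" "p \<in> chart_dom c" "coord c p \<in> chart_img c" by (rule chart_around)
  have "((\<lambda>x. f (param c x) + h (param c x)) has_derivative
      (\<lambda>v. frechet_derivative (\<lambda>x. f (param c x)) (at (coord c p)) v
         + frechet_derivative (\<lambda>x. h (param c x)) (at (coord c p)) v)) (at (coord c p))"
    by (intro has_derivative_add C1_on_has_derivative[OF C1_funD] assms c)
  from fun_cong[OF frechet_derivative_at[OF this], of "X c (coord c p)"]
  show ?thesis
    using assms c by (simp add: at_point_dir_deriv[OF _ c(1,2)] C1_fun_add dir_deriv_def)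
qed

lemma div_form_add:
  "C1_fun f \<Longrightarrow> C1_fun h \<Longrightarrow> div_form (\<lambda>p. f p + h p) p = div_form f p + div_form h p"
  by (simp add: div_form_def Xderiv_add algebra_simps)

lemma div_form_eq_0:
  assumes "C1_fun f" "closed K" "\<And>q. q \<notin> K \<Longrightarrow> f q = 0" "p \<notin> K"
  shows "div_form f p = 0"
  using assms dir_deriv_locally_const[OF assms(1), of "- K" p 0]
  by (simp add: div_form_def open_Compl)

lemma div_form_eq_divergence:
  assumes "C1_fun f" "open U" "\<And>q. q \<in> U \<Longrightarrow> f q = 1" "p \<in> U"
  shows "div_form f p = dvg p"
  using assms dir_deriv_locally_const[OF assms(1), of U p 1] by (simp add: div_form_def)

lemma integrable_div_form:
  assumes f: "C1_fun f" and K: "compact K" "\<And>p. p \<notin> K \<Longrightarrow> f p = 0"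
    and \<phi>: "continuous_on UNIV \<phi>" "\<And>p. 0 \<le> \<phi> p \<and> \<phi> p \<le> 1"
  shows "integrable dV (\<lambda>p. \<phi> p * div_form f p)"
proof -
  have cont: "continuous_on UNIV (div_form f)" by (rule continuous_on_div_form[OF f])
  obtain N where N: "N > 0" "\<And>p. \<bar>div_form f p\<bar> \<le> N"
    using bounded_compact_support[OF cont K(1) div_form_eq_0[OF f compact_imp_closed[OF K(1)] K(2)]]
    by blast
  have "\<bar>\<phi> p\<bar> * \<bar>div_form f p\<bar> \<le> 1 * N" for p
    using \<phi>(2)[of p] N by (intro mult_mono) auto
  then have "norm (\<phi> p * div_form f p) \<le> N" for p by (simp add: abs_mult)
  moreover have "continuous_on UNIV (\<lambda>p. \<phi> p * div_form f p)" by (intro continuous_intros \<phi> cont)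
  from borel_measurable_continuous_onI[OF this]
  have "(\<lambda>p. \<phi> p * div_form f p) \<in> borel_measurable dV" by simp
  ultimately show ?thesis by (intro integrable_const_bound) auto
qed

lemma integrable_mult_fnorm:
  assumes "C1_fun f" "\<And>p. 0 \<le> f p \<and> f p \<le> 1"
  shows "integrable dV (\<lambda>p. f p * fnorm p)"
proof (rule Bochner_Integration.integrable_bound[OF integrable_field])
  have "continuous_on UNIV (\<lambda>p. f p * fnorm p)"
    by (intro continuous_intros C1_fun_imp_continuous_on assms(1) continuous_on_norm_sq)
  from borel_measurable_continuous_onI[OF this]
  show "(\<lambda>p. f p * fnorm p) \<in> borel_measurable dV" by simp
  have "norm (f p * fnorm p) \<le> norm (fnorm p)" for p
    using assms(2)[of p] mult_right_mono[of "f p" 1 "fnorm p"] fnorm_nonneg[of p] by (simp add: abs_mult)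
  then show "AE p in dV. norm (f p * fnorm p) \<le> norm (fnorm p)" by (intro AE_I2)
qed

definition Lipschitz_cutoff where
  "Lipschitz_cutoff L \<phi> \<longleftrightarrow> 0 \<le> L \<and> continuous_on UNIV \<phi> \<and> (\<forall>p. 0 \<le> \<phi> p \<and> \<phi> p \<le> 1) \<and>
     (\<forall>p q. \<bar>\<phi> p - \<phi> q\<bar> \<le> L * riem_dist A g p q)"

text \<open>The weight \<open>f\<close> also occurs on the right and the constant does not depend on
  \<open>f\<close>; this makes the property additive. The bounds and the compact support ensure that
  the integrals can be split.\<close>

definition flux_bounded where
  "flux_bounded f \<longleftrightarrow> C1_fun f \<and> (\<forall>p. 0 \<le> f p \<and> f p \<le> 1) \<and> (\<exists>K. compact K \<and> (\<forall>p. p \<notin> K \<longrightarrow> f p = 0)) \<and>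
     (\<forall>L \<phi>. Lipschitz_cutoff L \<phi> \<longrightarrow>
        \<bar>\<integral>p. \<phi> p * div_form f p \<partial>dV\<bar> \<le> 4 * real CARD('n) * L * (\<integral>p. f p * fnorm p \<partial>dV))"

text \<open>The origin of \<open>4 * real CARD('n)\<close>: a displacement by \<open>s\<close> along
  an Auerbach vector has length at most \<open>2 * s\<close>, so increments of the cut-off are at
  most \<open>2 * L * s\<close>; each Auerbach coordinate of a vector is at most its length at
  \<open>x0\<close>, hence twice its length at \<open>x\<close>; and there are
  \<open>CARD('n)\<close> coordinates.\<close>

lemma flux_bound_in_chart:
  assumes c: "c \<in> A" and \<rho>: "\<rho> > 0" "cball x0 (3 * \<rho>) \<subseteq> chart_img c"
    and cmp: "\<And>x v. x \<in> cball x0 (3 * \<rho>) \<Longrightarrow> gnorm c x v \<le> 2 * gnorm c x0 v"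
      "\<And>x v. x \<in> cball x0 (3 * \<rho>) \<Longrightarrow> gnorm c x0 v \<le> 2 * gnorm c x v"
    and f: "C1_fun f" "\<And>p. 0 \<le> f p \<and> f p \<le> 1"
      "\<And>p. p \<notin> param c ` cball x0 (2 * \<rho>) \<Longrightarrow> f p = 0"
    and \<phi>: "Lipschitz_cutoff L \<phi>"
  shows "\<bar>\<integral>p. \<phi> p * div_form f p \<partial>dV\<bar> \<le> 4 * real CARD('n) * L * (\<integral>p. f p * fnorm p \<partial>dV)"
proof -
  let ?I = "chart_img c" and ?C = "cball x0 (2 * \<rho>)" and ?v = "vol_density g c"
  have x0I: "x0 \<in> ?I" using \<rho> by auto
  have CI: "?C \<subseteq> ?I" using \<rho> subset_cball[of "2 * \<rho>" "3 * \<rho>" x0] by auto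
  have \<phi>': "0 \<le> L" "continuous_on UNIV \<phi>" "\<And>p. 0 \<le> \<phi> p \<and> \<phi> p \<le> 1"
    "\<And>p q. \<bar>\<phi> p - \<phi> q\<bar> \<le> L * riem_dist A g p q"
    using \<phi> by (auto simp: Lipschitz_cutoff_def)
  have Kc: "closed (param c ` ?C)" by (intro compact_imp_closed compact_param_cball c CI)
  have Kdom: "param c ` ?C \<subseteq> chart_dom c" using CI param_in_dom[OF c] by auto
  define fx where "fx x = f (param c x)" for x
  have fx0: "fx x = 0" if "x \<in> ?I - ?C" for x
    unfolding fx_def
  proof (rule f(3))
    show "param c x \<notin> param c ` ?C"
    proof
      assume "param c x \<in> param c ` ?C"
      then obtain y where y: "y \<in> ?C" "param c x = param c y" by blast
      then have "coord c (param c x) = coord c (param c y)" by simp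
      then have "x = y" using that CI c y(1) coord_param[OF c] by (metis DiffD1 subsetD)
      then show False using y that by blast
    qed
  qed
  have Cfx: "C1_on ?I fx" unfolding fx_def by (rule C1_funD[OF f(1) c])
  have CX: "C1_on ?I (X c)" by (rule smooth_on_imp_C1_on[OF smooth_on_field[OF c]])
  have Cv: "C1_on ?I ?v" by (rule C1_on_vol_density[OF c])
  \<comment> \<open>Multiplication by the density turns the Riemannian divergence into the Euclidean
    one, and the support of \<open>f\<close> permits extension by 0 to the whole space.\<close>
  define Y where "Y x = (if x \<in> ?I then (?v x * fx x) *\<^sub>R X c x else 0)" for x
  have CY: "C1_on UNIV Y"
    unfolding Y_def
    by (rule C1_on_extend_zero[where K = ?C, OF _ open_chart_img[OF c] closed_cball CI])
      (use fx0 in \<open>auto intro!: C1_on_scaleR C1_on_mult Cv Cfx CX\<close>)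
  have Y0: "Y x = 0" if "x \<notin> ?C" for x using fx0[of x] that by (auto simp: Y_def)
  have trY: "trace (matrix (frechet_derivative Y (at x))) = ?v x * div_form f (param c x)" if x: "x \<in> ?I" for x
  proof -
    let ?Dv = "frechet_derivative ?v (at x)" and ?Df = "frechet_derivative fx (at x)"
      and ?DX = "frechet_derivative (X c) (at x)"
    note D = C1_on_has_derivative[OF Cv x] C1_on_has_derivative[OF Cfx x] C1_on_has_derivative[OF CX x]
    note D2 = has_derivative_mult[OF D(1,2)]
    have "((\<lambda>x. (?v x * fx x) *\<^sub>R X c x) has_derivative
        (\<lambda>w. (?v x * fx x) *\<^sub>R ?DX w + (?v x * ?Df w + ?Dv w * fx x) *\<^sub>R X c x)) (at x)"
      by (rule has_derivative_scaleR[OF D2 D(3)])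
    then have "(Y has_derivative
        (\<lambda>w. (?v x * fx x) *\<^sub>R ?DX w + (?v x * ?Df w + ?Dv w * fx x) *\<^sub>R X c x)) (at x)"
      by (rule has_derivative_transform_within_open[OF _ open_chart_img[OF c] x]) (simp add: Y_def)
    note FY = frechet_derivative_at[OF this, symmetric]
    have "trace (matrix (frechet_derivative Y (at x)))
        = (?v x * fx x) * trace (matrix ?DX) + (?v x * ?Df (X c x) + ?Dv (X c x) * fx x)"
      unfolding FY by (rule trace_rank_one_perturbation[OF has_derivative_linear[OF D2]])
    also have "\<dots> = ?v x * (fx x * divergence g X c x + ?Df (X c x))"
      using vol_density_pos[OF c x] by (simp add: divergence_def field_simps)
    also have "fx x * divergence g X c x + ?Df (X c x) = div_form f (param c x)"
      using x c param_in_dom[OF c x]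
      by (simp add: div_form_def at_point_divergence[OF c] at_point_dir_deriv[OF f(1) c] dir_deriv_def fx_def[abs_def])
    finally show ?thesis .
  qed
  define u where "u x = (if x \<in> ?I then \<phi> (param c x) else 0)" for x
  have u: "u \<in> borel_measurable borel" "\<bar>u x\<bar> \<le> 1" for x
  proof -
    have "continuous_on ?I (\<lambda>x. \<phi> (param c x))"
      by (rule continuous_on_compose2[OF \<phi>'(2) continuous_on_param[OF c]]) auto
    then show "u \<in> borel_measurable borel" unfolding u_def
      by (rule borel_measurable_continuous_on_if[OF borel_open[OF open_chart_img[OF c]] _ continuous_on_const])
    show "\<bar>u x\<bar> \<le> 1" using \<phi>'(3) by (auto simp: u_def)
  qed
  obtain B where B: "det B \<noteq> 0" "\<And>j. gnorm c x0 (column j B) \<le> 1"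
    "\<And>v j. \<bar>(matrix_inv B *v v) $ j\<bar> \<le> gnorm c x0 v"
    by (rule auerbach_basis[OF c x0I]) (rule that)
  \<comment> \<open>Since \<open>s0 * N = \<rho>\<close>, a displacement by less than
    \<open>s0\<close> along any column leads from the ball of radius \<open>2 * \<rho>\<close> into
    that of radius \<open>3 * \<rho>\<close>, where lengths are comparable. The summand 1 keeps
    \<open>N\<close> positive.\<close>
  define N where "N = 1 + (\<Sum>j\<in>UNIV. norm (column j B))"
  have N: "N > 0" "norm (column j B) \<le> N" for j
    unfolding N_def using member_le_sum[of j UNIV "\<lambda>j. norm (column j B)"] by (auto simp: sum_nonneg add_pos_nonneg)
  define s0 where "s0 = \<rho> / N"
  have s0: "s0 > 0" using \<rho> N by (simp add: s0_def)
  have Lu: "\<bar>u (x - s *\<^sub>R column j B) - u x\<bar> \<le> 2 * L * s" if x: "x \<in> ?C" and s: "0 < s" "s < s0" for j x s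
  proof -
    let ?z = "x - s *\<^sub>R column j B"
    have "norm (s *\<^sub>R column j B) \<le> s0 * N" using s N(2)[of j] by (simp add: mult_mono)
    also have "\<dots> = \<rho>" using N by (simp add: s0_def)
    finally have "dist x ?z \<le> \<rho>" by (simp add: dist_norm)
    then have z: "?z \<in> cball x0 (3 * \<rho>)" using x dist_triangle[of x0 ?z x] by simp
    have x3: "x \<in> cball x0 (3 * \<rho>)" using x \<rho>(1) by simp
    have seg: "closed_segment x ?z \<subseteq> cball x0 (3 * \<rho>)"
      by (rule closed_segment_subset[OF x3 z convex_cball])
    have "ldist (param c x) (param c ?z) \<le> ennreal (2 * s)"
    proof (rule ldist_segment[OF c])
      show "closed_segment x ?z \<subseteq> ?I" using seg \<rho>(2) by blast
      fix y assume "y \<in> closed_segment x ?z"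
      then have "gnorm c y (?z - x) \<le> 2 * gnorm c x0 (?z - x)" using cmp(1) seg by blast
      also have "?z - x = (- s) *\<^sub>R column j B" by simp
      also have "gnorm c x0 ((- s) *\<^sub>R column j B) = s * gnorm c x0 (column j B)"
        using s by (simp only: gnorm_scaleR)
      also have "2 * (s * gnorm c x0 (column j B)) \<le> 2 * s" using B(2)[of j] s by simp
      finally show "gnorm c y (?z - x) \<le> 2 * s" by simp
    qed
    then have "riem_dist A g (param c ?z) (param c x) \<le> 2 * s"
      using s by (simp add: ldist_eq riem.commute)
    then have "L * riem_dist A g (param c ?z) (param c x) \<le> L * (2 * s)"
      by (rule mult_left_mono) (rule \<phi>')
    moreover have "x \<in> ?I" "?z \<in> ?I" using x3 z \<rho>(2) by auto
    ultimately show ?thesis using \<phi>'(4)[of "param c ?z" "param c x"] by (simp add: u_def mult_ac)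
  qed
  have m1: "(\<lambda>p. \<phi> p * div_form f p) \<in> borel_measurable borel"
    by (intro borel_measurable_continuous_onI continuous_on_mult \<phi>' continuous_on_div_form f)
  have z1: "\<phi> p * div_form f p = 0" if "p \<notin> chart_dom c" for p
    using div_form_eq_0[OF f(1) Kc f(3), of p] that Kdom by auto
  have m2: "(\<lambda>p. f p * fnorm p) \<in> borel_measurable borel"
    by (intro borel_measurable_continuous_onI continuous_intros C1_fun_imp_continuous_on f continuous_on_norm_sq)
  have z2: "f p * fnorm p = 0" if "p \<notin> chart_dom c" for p
    using f(3)[of p] that Kdom by auto
  define H where "H x = (if x \<in> ?I then ?v x * (f (param c x) * fnorm (param c x)) else 0)" for x
  have H: "(\<integral>p. f p * fnorm p \<partial>dV) = (\<integral>x. H x \<partial>lborel)" "integrable lborel H"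
    using integral_in_chart[OF c m2 z2] integrable_mult_fnorm[OF f(1,2)] by (simp_all add: H_def[abs_def])
  have H0: "H x \<ge> 0" for x
    using vol_density_pos[OF c, of x] f(2) fnorm_nonneg by (auto simp: H_def)
  have coef: "(\<integral>x. \<bar>(matrix_inv B *v Y x) $ j\<bar> \<partial>lborel) \<le> (\<integral>x. 2 * H x \<partial>lborel)" for j
  proof (rule integral_mono')
    show "integrable lborel (\<lambda>x. 2 * H x)" using H(2) by simp
    show "0 \<le> 2 * H x" for x using H0[of x] by simp
    show "\<bar>(matrix_inv B *v Y x) $ j\<bar> \<le> 2 * H x" for x
    proof (cases "x \<in> ?C")
      case True
      then have x: "x \<in> ?I" "x \<in> cball x0 (3 * \<rho>)" using CI \<rho>(1) by auto
      have "\<bar>(matrix_inv B *v Y x) $ j\<bar> \<le> gnorm c x0 (Y x)" by (rule B(3))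
      also have "\<dots> \<le> 2 * gnorm c x (Y x)" by (rule cmp(2)[OF x(2)])
      also have "gnorm c x (Y x) = H x"
        using x(1) vol_density_pos[OF c x(1)] f(2)[of "param c x"] c param_in_dom[OF c x(1)]
        by (simp add: Y_def H_def gnorm_scaleR fx_def fnorm_eq[OF c] abs_mult)
      finally show ?thesis .
    next
      case False
      then show ?thesis using Y0[OF False] H0[of x] by simp
    qed
  qed
  have "(\<integral>p. \<phi> p * div_form f p \<partial>dV)
      = (\<integral>x. (if x \<in> ?I then ?v x * (\<phi> (param c x) * div_form f (param c x)) else 0) \<partial>lborel)"
    by (rule integral_in_chart(1)[OF c m1 z1])
  also have "\<dots> = (\<integral>x. u x * trace (matrix (frechet_derivative Y (at x))) \<partial>lborel)"
    by (intro Bochner_Integration.integral_cong) (auto simp: u_def trY)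
  also have "\<bar>\<dots>\<bar> \<le> 2 * L * (\<Sum>j\<in>UNIV. \<integral>x. \<bar>(matrix_inv B *v Y x) $ j\<bar> \<partial>lborel)"
    by (rule divergence_integration_by_parts_bound[OF B(1) CY Y0 u s0 Lu])
  also have "\<dots> \<le> 2 * L * (\<Sum>j\<in>(UNIV::'n set). \<integral>x. 2 * H x \<partial>lborel)"
    using \<phi>'(1) by (intro mult_left_mono sum_mono coef) auto
  also have "\<dots> = 4 * real CARD('n) * L * (\<integral>p. f p * fnorm p \<partial>dV)"
    by (simp add: H(1))
  finally show ?thesis .
qed

text \<open>The estimate is required for every product \<open>b q * h q\<close>, because the gluing
  multiplies a new bump by the complement of the weight already constructed.\<close>

definition flux_bump where
  "flux_bump p V b \<longleftrightarrow> open V \<and> p \<in> V \<and> C1_fun b \<and> (\<forall>q. 0 \<le> b q \<and> b q \<le> 1) \<and> (\<forall>q\<in>V. b q = 1) \<and>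
     (\<forall>h. C1_fun h \<longrightarrow> (\<forall>q. 0 \<le> h q \<and> h q \<le> 1) \<longrightarrow> flux_bounded (\<lambda>q. b q * h q))"

lemma ex_flux_bump: "\<exists>V b. flux_bump p V b"
proof -
  obtain c where c: "c \<in> A" "p \<in> chart_dom c" "coord c p \<in> chart_img c" by (rule chart_around)
  define x0 where "x0 = coord c p"
  have x0: "x0 \<in> chart_img c" using c by (simp add: x0_def)
  obtain r where r: "r > 0" "cball x0 r \<subseteq> chart_img c"
    "\<And>x v. x \<in> cball x0 r \<Longrightarrow> gnorm c x v \<le> 2 * gnorm c x0 v"
    "\<And>x v. x \<in> cball x0 r \<Longrightarrow> gnorm c x0 v \<le> 2 * gnorm c x v"
    by (rule gnorm_comparable[OF c(1) x0]) (rule that)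
  \<comment> \<open>The radii \<open>\<rho>\<close>, \<open>2 * \<rho>\<close> and
    \<open>3 * \<rho>\<close> belong to the plateau of the bump, to its support, and to the region
    where lengths are comparable.\<close>
  define \<rho> where "\<rho> = r / 3"
  have \<rho>: "\<rho> > 0" "3 * \<rho> = r" using r by (auto simp: \<rho>_def)
  have sub: "cball x0 (2 * \<rho>) \<subseteq> chart_img c"
    using r(2) subset_cball[of "2 * \<rho>" r x0] \<rho> by auto
  obtain \<eta> :: "real^'n \<Rightarrow> real" where \<eta>: "C1_on UNIV \<eta>" "\<And>x. 0 \<le> \<eta> x" "\<And>x. \<eta> x \<le> 1"
    "\<And>x. x \<in> ball x0 \<rho> \<Longrightarrow> \<eta> x = 1" "\<And>x. x \<notin> cball x0 (2 * \<rho>) \<Longrightarrow> \<eta> x = 0"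
    by (rule plateau_bump[OF \<rho>(1), of x0]) (rule that)
  define b where "b q = (if q \<in> chart_dom c then \<eta> (coord c q) else 0)" for q
  have b: "C1_fun b" unfolding b_def by (rule C1_fun_extend_zero[OF c(1) sub \<eta>(1,5)])
  have b01: "0 \<le> b q \<and> b q \<le> 1" for q using \<eta>(2,3) by (simp add: b_def)
  have b0: "b q = 0" if "q \<notin> param c ` cball x0 (2 * \<rho>)" for q
  proof (cases "q \<in> chart_dom c")
    case True
    have "coord c q \<notin> cball x0 (2 * \<rho>)"
    proof
      assume "coord c q \<in> cball x0 (2 * \<rho>)"
      then have "param c (coord c q) \<in> param c ` cball x0 (2 * \<rho>)" by (rule imageI)
      then show False using that True c by simp
    qed
    then show ?thesis using \<eta>(5) by (simp add: b_def)
  qed (simp add: b_def)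
  show ?thesis
    unfolding flux_bump_def
  proof (intro exI conjI allI ballI impI)
    show "open (chart_dom c \<inter> coord c -` ball x0 \<rho>)"
      by (rule open_coord_vimage[OF c(1) open_ball])
    show "p \<in> chart_dom c \<inter> coord c -` ball x0 \<rho>" using c \<rho> by (simp add: x0_def)
    show "C1_fun b" by (rule b)
    show "0 \<le> b q" "b q \<le> 1" for q using b01[of q] by auto
    show "b q = 1" if "q \<in> chart_dom c \<inter> coord c -` ball x0 \<rho>" for q using that \<eta>(4) by (simp add: b_def)
    fix h :: "'a \<Rightarrow> real" assume h: "C1_fun h" "\<forall>q. 0 \<le> h q \<and> h q \<le> 1"
    have f1: "C1_fun (\<lambda>q. b q * h q)" by (rule C1_fun_mult[OF b h(1)])
    have f2: "0 \<le> b q * h q \<and> b q * h q \<le> 1" for q using b01[of q] h(2) by (simp add: mult_le_one)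
    have f3: "b q * h q = 0" if "q \<notin> param c ` cball x0 (2 * \<rho>)" for q using b0[OF that] by simp
    show "flux_bounded (\<lambda>q. b q * h q)"
      unfolding flux_bounded_def
    proof (intro conjI allI impI)
      show "\<exists>K. compact K \<and> (\<forall>p. p \<notin> K \<longrightarrow> b p * h p = 0)"
        using compact_param_cball[OF c(1) sub] f3 by blast
      show "\<bar>\<integral>p. \<phi> p * div_form (\<lambda>q. b q * h q) p \<partial>dV\<bar>
          \<le> 4 * real CARD('n) * L * (\<integral>p. b p * h p * fnorm p \<partial>dV)" if "Lipschitz_cutoff L \<phi>" for L \<phi>
        by (rule flux_bound_in_chart[OF c(1) \<rho>(1) _ _ _ f1 f2 f3 that]) (use r \<rho>(2) in auto)
    qed (use f1 f2 in auto)
  qed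
qed

text \<open>Both sides of the estimate are additive in the weight. Compact supports make the left
  integrands integrable, and the integrability of the length of the field serves the right
  ones.\<close>

lemma flux_bounded_add:
  assumes f: "flux_bounded f" and h: "flux_bounded h" and le: "\<And>p. f p + h p \<le> 1"
  shows "flux_bounded (\<lambda>p. f p + h p)"
proof -
  obtain K1 where K1: "compact K1" "\<And>p. p \<notin> K1 \<Longrightarrow> f p = 0" using f by (auto simp: flux_bounded_def)
  obtain K2 where K2: "compact K2" "\<And>p. p \<notin> K2 \<Longrightarrow> h p = 0" using h by (auto simp: flux_bounded_def)
  have C1: "C1_fun f" "C1_fun h" and f01: "\<And>p. 0 \<le> f p \<and> f p \<le> 1" and h01: "\<And>p. 0 \<le> h p \<and> h p \<le> 1"
    using f h by (auto simp: flux_bounded_def)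
  show ?thesis
    unfolding flux_bounded_def
  proof (intro conjI allI impI)
    show "C1_fun (\<lambda>p. f p + h p)" by (rule C1_fun_add[OF C1])
    show "0 \<le> f p + h p" "f p + h p \<le> 1" for p using f01[of p] h01[of p] le by auto
    show "\<exists>K. compact K \<and> (\<forall>p. p \<notin> K \<longrightarrow> f p + h p = 0)"
      using K1 K2 by (intro exI[of _ "K1 \<union> K2"]) auto
    fix L \<phi> assume \<phi>: "Lipschitz_cutoff L \<phi>"
    then have \<phi>': "continuous_on UNIV \<phi>" "\<And>p. 0 \<le> \<phi> p \<and> \<phi> p \<le> 1" by (auto simp: Lipschitz_cutoff_def)
    note i = integrable_div_form[OF C1(1) K1 \<phi>'] integrable_div_form[OF C1(2) K2 \<phi>']
    have "(\<integral>p. \<phi> p * div_form (\<lambda>p. f p + h p) p \<partial>dV)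
        = (\<integral>p. \<phi> p * div_form f p \<partial>dV) + (\<integral>p. \<phi> p * div_form h p \<partial>dV)"
      using i by (simp add: div_form_add[OF C1] distrib_left)
    moreover have "(\<integral>p. (f p + h p) * fnorm p \<partial>dV) = (\<integral>p. f p * fnorm p \<partial>dV) + (\<integral>p. h p * fnorm p \<partial>dV)"
      using integrable_mult_fnorm[OF C1(1) f01] integrable_mult_fnorm[OF C1(2) h01] by (simp add: distrib_right)
    moreover have "\<bar>\<integral>p. \<phi> p * div_form f p \<partial>dV\<bar> \<le> 4 * real CARD('n) * L * (\<integral>p. f p * fnorm p \<partial>dV)"
      "\<bar>\<integral>p. \<phi> p * div_form h p \<partial>dV\<bar> \<le> 4 * real CARD('n) * L * (\<integral>p. h p * fnorm p \<partial>dV)"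
      using f h \<phi> by (auto simp: flux_bounded_def)
    ultimately show "\<bar>\<integral>p. \<phi> p * div_form (\<lambda>p. f p + h p) p \<partial>dV\<bar>
        \<le> 4 * real CARD('n) * L * (\<integral>p. (f p + h p) * fnorm p \<partial>dV)"
      by (simp add: distrib_left)
  qed
qed

text \<open>Local estimates are glued by passing from \<open>f\<close> to \<open>f + b (1 - f)\<close>, which is \<open>1\<close> wherever
  \<open>f\<close> or \<open>b\<close> is; this avoids the quotients of a partition of unity.\<close>

lemma flux_bounded_partition:
  assumes K: "compact K"
  obtains f U where "flux_bounded f" "open U" "K \<subseteq> U" "\<And>q. q \<in> U \<Longrightarrow> f q = 1"
proof -
  obtain V b where bump: "\<And>p. flux_bump p (V p) (b p)" using ex_flux_bump by metis
  then have V: "\<And>p. open (V p)" "\<And>p. p \<in> V p" and b: "\<And>p. C1_fun (b p)"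
    "\<And>p q. 0 \<le> b p q \<and> b p q \<le> 1" "\<And>p q. q \<in> V p \<Longrightarrow> b p q = 1"
    "\<And>p h. C1_fun h \<Longrightarrow> (\<And>q. 0 \<le> h q \<and> h q \<le> 1) \<Longrightarrow> flux_bounded (\<lambda>q. b p q * h q)"
    unfolding flux_bump_def by simp_all
  have ex: "\<exists>f. flux_bounded f \<and> (\<forall>q\<in>(\<Union>p\<in>P. V p). f q = 1)" if "finite P" for P
    using that
  proof (induction P)
    case empty
    \<comment> \<open>The zero weight is obtained as some bump times the zero function.\<close>
    have "flux_bounded (\<lambda>q. b undefined q * 0)" by (rule b(4)) (auto simp: C1_fun_const)
    then show ?case by auto
  next
    case (insert p P)
    then obtain f where f: "flux_bounded f" "\<And>q. q \<in> (\<Union>p\<in>P. V p) \<Longrightarrow> f q = 1" by blast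
    have f': "C1_fun f" "\<And>q. 0 \<le> f q \<and> f q \<le> 1" using f(1) by (auto simp: flux_bounded_def)
    have "C1_fun (\<lambda>q. 1 + (-1) * f q)" by (intro C1_fun_add C1_fun_mult C1_fun_const f')
    then have h: "flux_bounded (\<lambda>q. b p q * (1 + (-1) * f q))"
      by (rule b(4)) (use f'(2) in auto)
    have "flux_bounded (\<lambda>q. f q + b p q * (1 + (-1) * f q))"
    proof (rule flux_bounded_add[OF f(1) h])
      fix q
      have "b p q * (1 + (-1) * f q) \<le> 1 * (1 + (-1) * f q)"
        by (rule mult_right_mono) (use f'(2)[of q] b(2)[of p q] in auto)
      then show "f q + b p q * (1 + (-1) * f q) \<le> 1" by simp
    qed
    moreover have "f q + b p q * (1 + (-1) * f q) = 1" if "q \<in> (\<Union>p\<in>insert p P. V p)" for q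
    proof (cases "q \<in> (\<Union>p\<in>P. V p)")
      case True
      then show ?thesis using f(2)[OF True] by simp
    next
      case False
      then have "q \<in> V p" using that by auto
      then show ?thesis using b(3) by simp
    qed
    ultimately show ?case by blast
  qed
  have "K \<subseteq> (\<Union>p\<in>UNIV. V p)" using V(2) by auto
  then obtain P where P: "finite P" "K \<subseteq> (\<Union>p\<in>P. V p)"
    using compactE_image[OF K, of UNIV V] V(1) by metis
  obtain f where "flux_bounded f" "\<forall>q\<in>(\<Union>p\<in>P. V p). f q = 1" using ex[OF P(1)] by blast
  then show thesis by (intro that[of f "\<Union>p\<in>P. V p"]) (use V(1) P(2) in auto)
qed

text \<open>A weight \<open>f\<close> is taken that is 1 on a neighbourhood of \<open>K\<close>.
  There its derivative vanishes and \<open>div_form f\<close> is the divergence itself, while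
  \<open>f \<le> 1\<close> bounds the right side independently of the size of
  \<open>K\<close>.\<close>

lemma integral_cutoff_divergence:
  assumes \<phi>: "Lipschitz_cutoff L \<phi>" and K: "compact K" "\<And>p. p \<notin> K \<Longrightarrow> \<phi> p = 0"
  shows "\<bar>\<integral>p. \<phi> p * dvg p \<partial>dV\<bar> \<le> 4 * real CARD('n) * L * (\<integral>p. fnorm p \<partial>dV)"
    and "integrable dV (\<lambda>p. \<phi> p * dvg p)"
proof -
  obtain f U where f: "flux_bounded f" and U: "open U" "K \<subseteq> U" "\<And>q. q \<in> U \<Longrightarrow> f q = 1"
    by (rule flux_bounded_partition[OF K(1)]) (rule that)
  have f': "C1_fun f" "\<And>q. 0 \<le> f q \<and> f q \<le> 1" using f by (auto simp: flux_bounded_def)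
  obtain K' where K': "compact K'" "\<And>p. p \<notin> K' \<Longrightarrow> f p = 0" using f by (auto simp: flux_bounded_def)
  have \<phi>': "0 \<le> L" "continuous_on UNIV \<phi>" "\<And>p. 0 \<le> \<phi> p \<and> \<phi> p \<le> 1"
    using \<phi> by (auto simp: Lipschitz_cutoff_def)
  have eq: "\<phi> p * dvg p = \<phi> p * div_form f p" for p
    using K(2)[of p] U(2) div_form_eq_divergence[OF f'(1) U(1,3), of p] by (cases "p \<in> K") auto
  show "integrable dV (\<lambda>p. \<phi> p * dvg p)"
    unfolding eq by (rule integrable_div_form[OF f'(1) K' \<phi>'(2,3)])
  have "(\<integral>p. f p * fnorm p \<partial>dV) \<le> (\<integral>p. fnorm p \<partial>dV)"
  proof (rule integral_mono[OF integrable_mult_fnorm[OF f'] integrable_field])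
    show "f p * fnorm p \<le> fnorm p" for p
      using mult_right_mono[of "f p" 1 "fnorm p"] f'(2)[of p] fnorm_nonneg[of p] by simp
  qed
  then have "4 * real CARD('n) * L * (\<integral>p. f p * fnorm p \<partial>dV) \<le> 4 * real CARD('n) * L * (\<integral>p. fnorm p \<partial>dV)"
    using \<phi>'(1) by (intro mult_left_mono) auto
  moreover have "\<bar>\<integral>p. \<phi> p * div_form f p \<partial>dV\<bar> \<le> 4 * real CARD('n) * L * (\<integral>p. f p * fnorm p \<partial>dV)"
    using f \<phi> by (auto simp: flux_bounded_def)
  ultimately show "\<bar>\<integral>p. \<phi> p * dvg p \<partial>dV\<bar> \<le> 4 * real CARD('n) * L * (\<integral>p. fnorm p \<partial>dV)"
    unfolding eq by linarith
qed

text \<open>As \<open>\<phi> 0 \<le> \<phi> k\<close> pointwise and the divergence is nonnegative,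
  its integral against the fixed function \<open>\<phi> 0\<close> is at most
  \<open>C / real (Suc k)\<close> for every \<open>k\<close> and hence vanishes. Integrability of
  \<open>dvg\<close> over the whole manifold is never claimed.\<close>

lemma divergence_nonneg_imp_zero:
  assumes complete: "complete_riemannian A g" and nonneg: "\<And>p. dvg p \<ge> 0"
  shows "dvg p = 0"
proof (rule ccontr)
  assume "dvg p \<noteq> 0"
  then have pos: "dvg p > 0" using nonneg[of p] by linarith
  \<comment> \<open>\<open>Suc k\<close> avoids division by 0, so that already
    \<open>\<phi> 0\<close> is a genuine cut-off, with value 1 at \<open>p\<close>.\<close>
  define \<phi> where "\<phi> k q = max 0 (min 1 (2 - riem_dist A g p q / real (Suc k)))" for k q
  have \<phi>: "Lipschitz_cutoff (1 / real (Suc k)) (\<phi> k)" for k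
    unfolding Lipschitz_cutoff_def
  proof (intro conjI allI)
    show "continuous_on UNIV (\<phi> k)"
      unfolding \<phi>_def by (intro continuous_intros continuous_on_riem_dist) auto
    fix q q'
    have "\<bar>riem_dist A g p q - riem_dist A g p q'\<bar> \<le> riem_dist A g q q'"
      using riem.triangle[of p q q'] riem.triangle[of p q' q] riem.commute[of q' q] by (simp add: abs_if)
    then have le: "\<bar>riem_dist A g p q / real (Suc k) - riem_dist A g p q' / real (Suc k)\<bar>
        \<le> 1 / real (Suc k) * riem_dist A g q q'"
      by (simp add: diff_divide_distrib[symmetric] abs_divide divide_right_mono)
    have "\<bar>max 0 (min 1 (2 - a)) - max 0 (min 1 (2 - b))\<bar> \<le> \<bar>a - b\<bar>" for a b :: real
      by (auto simp: max_def min_def)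
    from order_trans[OF this le] show "\<bar>\<phi> k q - \<phi> k q'\<bar> \<le> 1 / real (Suc k) * riem_dist A g q q'"
      unfolding \<phi>_def .
  qed (auto simp: \<phi>_def)
  have supp: "\<phi> k q = 0" if "q \<notin> {q. riem_dist A g p q \<le> 2 * real (Suc k)}" for k q
    using that by (simp add: \<phi>_def max_def min_def field_simps)
  have I: "\<bar>\<integral>q. \<phi> k q * dvg q \<partial>dV\<bar> \<le> 4 * real CARD('n) * (1 / real (Suc k)) * (\<integral>p. fnorm p \<partial>dV)"
    "integrable dV (\<lambda>q. \<phi> k q * dvg q)" for k
    by (rule integral_cutoff_divergence[OF \<phi> compact_riem_cball[OF complete] supp], assumption)+
  have mono: "\<phi> 0 q \<le> \<phi> k q" for k q
  proof -
    have "riem_dist A g p q / real (Suc k) \<le> riem_dist A g p q / 1"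
      by (rule divide_left_mono) auto
    then show ?thesis by (auto simp: \<phi>_def max_def min_def)
  qed
  define I0 where "I0 = (\<integral>q. \<phi> 0 q * dvg q \<partial>dV)"
  define C where "C = 4 * real CARD('n) * (\<integral>p. fnorm p \<partial>dV)"
  have le: "I0 \<le> C / real (Suc k)" for k
  proof -
    have "I0 \<le> (\<integral>q. \<phi> k q * dvg q \<partial>dV)"
      unfolding I0_def by (intro integral_mono I(2) mult_right_mono mono nonneg)
    also have "\<dots> \<le> C / real (Suc k)" using I(1)[of k] by (simp add: C_def)
    finally show ?thesis .
  qed
  have "(\<lambda>k. C / real (Suc k)) \<longlonglongrightarrow> 0"
    using LIMSEQ_Suc[OF lim_const_over_n[of C]] by simp
  then have "I0 \<le> 0" by (rule LIMSEQ_le_const) (use le in auto)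
  have nn: "0 \<le> \<phi> 0 q * dvg q" for q using nonneg[of q] by (simp add: \<phi>_def)
  then have "0 \<le> I0" unfolding I0_def by (intro Bochner_Integration.integral_nonneg)
  with \<open>I0 \<le> 0\<close> have "I0 = 0" by simp
  then have ae: "AE q in dV. \<phi> 0 q * dvg q = 0"
    using integral_nonneg_eq_0_iff_AE[OF I(2)[of 0]] nn by (auto simp: I0_def)
  have cont: "continuous_on UNIV (\<lambda>q. \<phi> 0 q * dvg q)"
    using \<phi>[of 0] by (intro continuous_on_mult continuous_on_divergence) (simp add: Lipschitz_cutoff_def)
  \<comment> \<open>The integrand is nonnegative and 0 almost everywhere, so the open set where it
    is positive is null; but it contains \<open>p\<close>.\<close>
  define U where "U = (\<lambda>q. \<phi> 0 q * dvg q) -` {0<..}"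
  have U: "open U" unfolding U_def using cont by (intro open_vimage) auto
  have "\<phi> 0 p * dvg p > 0" using pos by (simp add: \<phi>_def)
  then have "U \<noteq> {}" by (auto simp: U_def)
  moreover have "U \<in> null_sets dV"
  proof (rule AE_iff_null_sets[THEN iffD2])
    show "U \<in> sets dV" using U by simp
    show "AE q in dV. q \<notin> U" using ae by eventually_elim (auto simp: U_def)
  qed
  ultimately show False using emeasure_open_pos[OF U] by blast
qed

end

theorem theorem1p3:
  fixes A :: "('a::{t2_space, second_countable_topology}, 'n::finite) chart set"
    and g :: "('a, 'n) tensor2"
    and X :: "('a, 'n) vfield"
    and dV :: "'a measure"
    and m :: ereal and lam :: real
  assumes dim: "CARD('n) > 2"
    and manifold: "oriented_smooth_atlas A" "connected (UNIV :: 'a set)"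
    and metric: "riemannian_metric A g"
    and complete: "complete_riemannian A g"
    and noncompact: "\<not> compact (UNIV :: 'a set)"
    and volume: "riemannian_volume A g dV"
    and finite_volume: "emeasure dV UNIV < \<infinity>"
    and field: "smooth_vector_field A X"
    and nonexpanding: "lam \<ge> 0"
    and m_pos: "0 < m"
    and qE: "quasi_einstein A g X m lam"
    and finite_norm: "global_norm_sq A g dV X < \<infinity>"
  shows "\<exists>p r. r > 0 \<and>
    (\<forall>q\<in>riem_ball A g p r. at_point A (scalar_curvature g) q \<ge> lam * real CARD('n))"
proof (rule ccontr)
  interpret riemannian_manifold_with_volume A g X dV
    by unfold_locales (use assms in auto)
  let ?N = "at_point A (norm_sq g X)"
  have Nnn: "?N p \<ge> 0" for p
    using chart_at[of p] by (simp add: at_point_def norm_sq_def metric_nonneg)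
  have mN: "?N \<in> borel_measurable borel" by (rule borel_measurable_continuous_onI[OF continuous_on_norm_sq])
  have "(\<integral>\<^sup>+ p. ennreal (norm (sqrt (?N p))) \<partial>dV) \<le> (\<integral>\<^sup>+ p. 1 + ennreal (?N p) \<partial>dV)"
  proof (rule nn_integral_mono)
    fix p
    \<comment> \<open>The square yields a bound of the length by 1 plus its square; finite volume
      makes the constant 1 integrable.\<close>
    have "0 \<le> (sqrt (?N p) - 1)\<^sup>2" by simp
    also have "\<dots> = ?N p - 2 * sqrt (?N p) + 1" using Nnn[of p] by (simp add: power2_diff)
    finally have "sqrt (?N p) \<le> 1 + ?N p" using Nnn[of p] real_sqrt_ge_zero[of "?N p"] by linarith
    then show "ennreal (norm (sqrt (?N p))) \<le> 1 + ennreal (?N p)"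
      using Nnn[of p] by (simp add: ennreal_leI flip: ennreal_1 ennreal_plus)
  qed
  also have "\<dots> = emeasure dV UNIV + global_norm_sq A g dV X"
    using mN by (simp add: nn_integral_add global_norm_sq_def)
  also have "\<dots> < \<infinity>" using finite_volume finite_norm by simp
  finally have "integrable dV (\<lambda>p. sqrt (?N p))"
    using mN by (intro integrableI_bounded) auto
  then interpret riemannian_manifold_integrable_field A g X dV by unfold_locales
  assume neg: "\<not> (\<exists>p r. r > 0 \<and>
    (\<forall>q\<in>riem_ball A g p r. at_point A (scalar_curvature g) q \<ge> lam * real CARD('n)))"
  have dense: "\<exists>q. riem_dist A g p q < r \<and> dvg q > 0" if r: "r > 0" for p r
  proof -
    obtain q where q: "riem_dist A g p q < r" "at_point A (scalar_curvature g) q < lam * real CARD('n)"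
      using neg r by (force simp: riem_ball_eq)
    have "at_point A (scalar_curvature g) q
        = lam * real CARD('n) + real_of_ereal (1 / m) * ?N q - dvg q"
      using scalar_curvature_quasi_einstein[OF qE chart_at(1)[of q]] chart_at[of q] by (simp add: at_point_def)
    \<comment> \<open>For infinite \<open>m\<close> the quotient is 0, so the sign is right for
      every admissible \<open>m\<close>.\<close>
    moreover have "real_of_ereal (1 / m) * ?N q \<ge> 0"
      using m_pos Nnn[of q] by (intro mult_nonneg_nonneg real_of_ereal_pos) (auto simp: zero_le_divide_ereal)
    ultimately show ?thesis using q by (intro exI[of _ q]) auto
  qed
  \<comment> \<open>By continuity a negative value would persist on a whole ball, and every ball
    contains a point of positive divergence.\<close>
  have "dvg p \<ge> 0" for p
  proof (rule ccontr)
    assume "\<not> dvg p \<ge> 0"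
    then have "p \<in> dvg -` {..<0}" by simp
    moreover have "open (dvg -` {..<0})" using continuous_on_divergence by (intro open_vimage) auto
    ultimately obtain r where "r > 0" "\<And>q. riem_dist A g p q < r \<Longrightarrow> q \<in> dvg -` {..<0}"
      using riem_ball_subset by metis
    then show False using dense[of r p] by force
  qed
  then have "dvg p = 0" for p by (rule divergence_nonneg_imp_zero[OF complete])
  then show False using dense[of 1] by auto
qed

end
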